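(* For each relation $\preceq_x$ with $x\in\{\mathrm{inf},\mathrm{pre},\mathrm{ext},\mathrm{lext},\mathrm{sub},\mathrm{sup}\}$, the min-variant and the max-variant of the $\preceq_x$-matching problem can be solved in time $O(|w|\,m)$, where $w$ is the input string and $m$ the number of transitions of the input $\varepsilon$NFA.
   Context: An $\varepsilon$NFA is a tuple $A=(Q,\Sigma,q_0,q_f,\delta)$ with $\delta\subseteq Q\times(\Sigma\cup\{\varepsilon\})\times Q$, size $m=|\delta|$; $\mathcal{L}(A)$ is the set of strings labelling (ignoring $\varepsilon$) a path from $q_0$ to $q_f$. Standing assumptions: $A$ is trimmed and every symbol of $\Sigma$ labels some transition. Relations on $\Sigma^*$: infix $u\preceq_{\mathrm{inf}} w$ iff $w=vuv'$ for some $v,v'$; prefix $u\preceq_{\mathrm{pre}} w$ iff $w=uv$ for some $v$; left-extension $u\preceq_{\mathrm{lext}} w$ iff $u=vw$ for some $v$; extension $u\preceq_{\mathrm{ext}} w$ iff $w\preceq_{\mathrm{inf}} u$; subsequence $u\preceq_{\mathrm{sub}} w$ iff $u=w[j_1]\cdots w[j_{|u|}]$ for some $1\le j_1<\dots<j_{|u|}\le|w|$; supersequence $u\preceq_{\mathrm{sup}} w$ iff $w\preceq_{\mathrm{sub}} u$. Min-variant of $\preceq$-matching: given $w$ and $A$, compute a shortest $u$ with $u\preceq w$ and $u\in\mathcal{L}(A)$, or report that none exists. Max-variant: given $w$ and $A$, report that there are arbitrarily long $u$ with $u\preceq w$ and $u\in\mathcal{L}(A)$, or compute a longest such $u$, or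 report that none exists. Model: unit-cost word RAM, integer alphabet. *)

theory Defs
  imports Main "HOL-Library.Sublist"
begin

section \<open>Automata with empty transitions\<close>

text \<open>The label \<^term>\<open>None\<close> stands for the empty word.\<close>

record ('q, 'a) enfa =
  states :: "'q set"
  alphabet :: "'a set"
  initial :: 'q
  accepting :: 'q
  transitions :: "('q \<times> 'a option \<times> 'q) set"

definition enfa :: "('q, 'a) enfa \<Rightarrow> bool" where
  "enfa A \<longleftrightarrow>
     finite (states A) \<and> finite (alphabet A) \<and>
     initial A \<in> states A \<and> accepting A \<in> states A \<and>
     transitions A \<subseteq> states A \<times> insert None (Some ` alphabet A) \<times> states A"

definition enfa_size :: "('q, 'a) enfa \<Rightarrow> nat" where
  "enfa_size A = card (transitions A)"

inductive enfa_path :: "('q, 'a) enfa \<Rightarrow> 'q \<Rightarrow> 'a option list \<Rightarrow> 'q \<Rightarrow> bool" for A where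
  path_Nil: "p \<in> states A \<Longrightarrow> enfa_path A p [] p"
| path_Cons: "(p, l, q) \<in> transitions A \<Longrightarrow> enfa_path A q ls r \<Longrightarrow> enfa_path A p (l # ls) r"

definition enfa_lang :: "('q, 'a) enfa \<Rightarrow> 'a list set" where
  "enfa_lang A = {List.map_filter id ls | ls. enfa_path A (initial A) ls (accepting A)}"

definition trimmed :: "('q, 'a) enfa \<Rightarrow> bool" where
  "trimmed A \<longleftrightarrow>
     (\<forall>q \<in> states A. (\<exists>ls. enfa_path A (initial A) ls q) \<and> (\<exists>ls. enfa_path A q ls (accepting A)))"

definition alphabet_used :: "('q, 'a) enfa \<Rightarrow> bool" where
  "alphabet_used A \<longleftrightarrow> (\<forall>a \<in> alphabet A. \<exists>p q. (p, Some a, q) \<in> transitions A)"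

section \<open>The matching problems\<close>

datatype relation = Infix | Prefix | Extension | Left_Extension | Subsequence | Supersequence

text \<open>\<^term>\<open>related x u w\<close> means that \<open>u\<close> is below \<open>w\<close> with respect to \<open>x\<close>. The existential
  witnesses of the library relations are factors of \<open>u\<close> or \<open>w\<close>, so that they are words over the
  alphabet whenever \<open>u\<close> and \<open>w\<close> are.\<close>

fun related :: "relation \<Rightarrow> 'a list \<Rightarrow> 'a list \<Rightarrow> bool" where
  "related Infix u w = sublist u w"
| "related Prefix u w = prefix u w"
| "related Extension u w = sublist w u"
| "related Left_Extension u w = suffix w u"
| "related Subsequence u w = subseq u w"
| "related Supersequence u w = subseq w u"

definition matches :: "relation \<Rightarrow> 'a list \<Rightarrow> ('q, 'a) enfa \<Rightarrow> 'a list set" where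
  "matches x w A = {u. related x u w \<and> u \<in> enfa_lang A}"

datatype variant = Min_Variant | Max_Variant

datatype 'a answer = No_Match | Arbitrarily_Long | Match "'a list"

fun correct_answer ::
  "variant \<Rightarrow> relation \<Rightarrow> 'a list \<Rightarrow> ('q, 'a) enfa \<Rightarrow> 'a answer \<Rightarrow> bool" where
  "correct_answer _ x w A No_Match \<longleftrightarrow> matches x w A = {}"
| "correct_answer Min_Variant x w A (Match u) \<longleftrightarrow>
     u \<in> matches x w A \<and> (\<forall>v \<in> matches x w A. length u \<le> length v)"
| "correct_answer Max_Variant x w A (Match u) \<longleftrightarrow>
     u \<in> matches x w A \<and> (\<forall>v \<in> matches x w A. length v \<le> length u)"
| "correct_answer Min_Variant x w A Arbitrarily_Long \<longleftrightarrow> False"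
| "correct_answer Max_Variant x w A Arbitrarily_Long \<longleftrightarrow>
     (\<forall>n. \<exists>u \<in> matches x w A. n \<le> length u)"

section \<open>The unit-cost word RAM\<close>

text \<open>Machine words of length \<open>b\<close> are the natural numbers below \<open>2 ^ b\<close>. A machine has registers,
  named directly by the instructions of a program, and random access memory, addressed by the
  contents of registers. The word length is a parameter of the execution and not of the program.\<close>

datatype binop =
  Add | Subtract | Mult | Divide | Modulo | Bit_And | Bit_Or | Bit_Xor | Shift_Left | Shift_Right
  | Equal | Less

type_synonym reg = nat

datatype instr =
    Const reg nat
  | Move reg reg
  | Binop binop reg reg reg
  | Load reg reg
  | Store reg reg
  | Jump nat
  | Jump_Zero reg nat
  | Halt

record ram_state =
  pc :: nat
  regs :: "reg \<Rightarrow> nat"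
  mem :: "nat \<Rightarrow> nat"

fun eval_binop :: "nat \<Rightarrow> binop \<Rightarrow> nat \<Rightarrow> nat \<Rightarrow> nat" where
  "eval_binop b Add x y = take_bit b (x + y)"
| "eval_binop b Subtract x y = take_bit b (x + (2 ^ b - y))"
| "eval_binop b Mult x y = take_bit b (x * y)"
| "eval_binop b Divide x y = x div y"
| "eval_binop b Modulo x y = x mod y"
| "eval_binop b Bit_And x y = and x y"
| "eval_binop b Bit_Or x y = or x y"
| "eval_binop b Bit_Xor x y = xor x y"
| "eval_binop b Shift_Left x y = take_bit b (push_bit y x)"
| "eval_binop b Shift_Right x y = drop_bit y x"
| "eval_binop b Equal x y = take_bit b (of_bool (x = y))"
| "eval_binop b Less x y = take_bit b (of_bool (x < y))"

fun exec_instr :: "nat \<Rightarrow> instr \<Rightarrow> ram_state \<Rightarrow> ram_state" where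
  "exec_instr b (Const r n) s =
     s\<lparr>regs := (regs s)(r := take_bit b n), pc := Suc (pc s)\<rparr>"
| "exec_instr b (Move r r1) s =
     s\<lparr>regs := (regs s)(r := regs s r1), pc := Suc (pc s)\<rparr>"
| "exec_instr b (Binop f r r1 r2) s =
     s\<lparr>regs := (regs s)(r := eval_binop b f (regs s r1) (regs s r2)), pc := Suc (pc s)\<rparr>"
| "exec_instr b (Load r r1) s =
     s\<lparr>regs := (regs s)(r := mem s (regs s r1)), pc := Suc (pc s)\<rparr>"
| "exec_instr b (Store r r1) s =
     s\<lparr>mem := (mem s)(regs s r := regs s r1), pc := Suc (pc s)\<rparr>"
| "exec_instr b (Jump l) s = s\<lparr>pc := l\<rparr>"
| "exec_instr b (Jump_Zero r l) s = s\<lparr>pc := (if regs s r = 0 then l else Suc (pc s))\<rparr>"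
| "exec_instr b Halt s = s"

definition halted :: "instr list \<Rightarrow> ram_state \<Rightarrow> bool" where
  "halted P s \<longleftrightarrow> length P \<le> pc s \<or> P ! pc s = Halt"

definition step :: "nat \<Rightarrow> instr list \<Rightarrow> ram_state \<Rightarrow> ram_state" where
  "step b P s = (if halted P s then s else exec_instr b (P ! pc s) s)"

definition init_state :: "nat list \<Rightarrow> ram_state" where
  "init_state xs =
     \<lparr>pc = 0, regs = (\<lambda>_. 0), mem = (\<lambda>i. if i < length xs then xs ! i else 0)\<rparr>"

definition output_words :: "ram_state \<Rightarrow> nat \<Rightarrow> nat \<Rightarrow> nat list" where
  "output_words s start len = map (mem s) [start ..< start + len]"

section \<open>Representation of inputs and outputs in memory\<close>

text \<open>The integer \<open>a\<close> of the alphabet is stored as \<open>a + 1\<close>, leaving \<open>0\<close> for the empty label. The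
  transitions are given as a list, in any order and without repetitions.\<close>

fun label_word :: "nat option \<Rightarrow> nat" where
  "label_word None = 0"
| "label_word (Some a) = Suc a"

definition encode_input ::
  "nat list \<Rightarrow> (nat, nat) enfa \<Rightarrow> (nat \<times> nat option \<times> nat) list \<Rightarrow> nat list" where
  "encode_input w A ts =
     [length w, length ts, card (states A), initial A, accepting A]
     @ map Suc w
     @ concat (map (\<lambda>(p, l, q). [p, label_word l, q]) ts)"

text \<open>Register 0 holds the kind of answer; for a string, register 1 holds the address of its first
  symbol and register 2 its length.\<close>

fun represents_answer :: "nat \<Rightarrow> ram_state \<Rightarrow> nat answer \<Rightarrow> bool" where
  "represents_answer b s No_Match \<longleftrightarrow> regs s 0 = 0"
| "represents_answer b s Arbitrarily_Long \<longleftrightarrow> regs s 0 = 1"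
| "represents_answer b s (Match u) \<longleftrightarrow>
     regs s 0 = 2 \<and> regs s 2 = length u \<and> regs s 1 + length u \<le> 2 ^ b \<and>
     output_words s (regs s 1) (length u) = map Suc u"

text \<open>States are numbered consecutively. The alphabet is an arbitrary finite set of integers whose
  codes fit into a machine word. The word length is at least \<open>k\<close> times the binary logarithm of the
  number of input words.\<close>

definition valid_input ::
  "nat \<Rightarrow> nat \<Rightarrow> nat list \<Rightarrow> (nat, nat) enfa \<Rightarrow> (nat \<times> nat option \<times> nat) list \<Rightarrow> bool" where
  "valid_input k b w A ts \<longleftrightarrow>
     enfa A \<and> trimmed A \<and> alphabet_used A \<and> w \<in> lists (alphabet A) \<and>
     states A = {..<card (states A)} \<and>
     distinct ts \<and> set ts = transitions A \<and>
     (\<forall>x \<in> set (encode_input w A ts). x < 2 ^ b) \<and>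
     length (encode_input w A ts) ^ k \<le> 2 ^ b"

text \<open>The constants \<open>c\<close> and \<open>k\<close> depend on the program only; \<open>k\<close> expresses that the word length is
  logarithmic in the input size, up to a constant factor. The bound \<open>T\<close> is a function
  of the length of the string and of the number of transitions; since the empty string is an
  admissible input, a bound of zero steps has to be avoided, as with \<open>max 1 n * max 1 m\<close>, which is
  \<open>n * m\<close> whenever the string is nonempty.\<close>

definition solvable_in_time :: "variant \<Rightarrow> relation \<Rightarrow> (nat \<Rightarrow> nat \<Rightarrow> nat) \<Rightarrow> bool" where
  "solvable_in_time v x T \<longleftrightarrow>
     (\<exists>P c k. \<forall>b w A ts. valid_input k b w A ts \<longrightarrow>
        (\<exists>t s ans. t \<le> c * T (length w) (enfa_size A) \<and>
           s = (step b P ^^ t) (init_state (encode_input w A ts)) \<and>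
           halted P s \<and> represents_answer b s ans \<and> correct_answer v x w A ans))"

end

theory Submission
  imports Defs
begin

text \<open>The matches are the labels of the walks from a source to a target in a product graph. A node
  consists of a position \<open>i\<close> of the word \<open>w\<close> and a state. A transition leads to position \<open>i + 1\<close>
  if it reads \<open>w ! i\<close>, and it stays at position \<open>i\<close> if it is empty or the relation admits a symbol
  outside of \<open>w\<close> there; for subsequences, empty edges skip the symbols of \<open>w\<close>. The source and the
  target are joined to the positions where the match may start and end. As a trimmed automaton has
  at most \<open>m + 1\<close> states, this graph has \<open>O(|w| m)\<close> edges, and it remains to solve both variants in
  time linear in the graph.

  A shortest label is found by a breadth-first search for edge weights \<open>0\<close> and \<open>1\<close>. For a longest
  label, Kosaraju's algorithm yields the strongly connected components in topological order. If a
  component between source and target has an inner edge with a symbol, then the labels are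
  arbitrarily long. Otherwise the inner edges of all these components are empty, and the longest
  label is found by dynamic programming along the order of the components.

  No loop of the program contains another one. Hence the number of steps of a loop is bounded by any
  measure that decreases in each iteration, and the essential part of this measure is the number of
  edges that are still to be scanned.\<close>

section \<open>A structured language and its compilation\<close>

text \<open>The edges are kept in linked lists whose heads act as cursors: a scan only ever moves a
  head to the next edge. The edges not yet passed by their cursor form a potential that drops with
  each scanned edge, which is how flat loops get linear bounds. The search invariants speak of
  abstract lists and functions; data such as the distances exist in the proofs only.

  The second pass of Kosaraju's algorithm scans incoming edges and completes the components in
  topological order. The longest-label values are therefore computed during this pass: when an edge
  from an earlier component is scanned, the value of that component is final. Working with
  components instead of nodes absorbs the cycles of empty edges.

  All addresses must fit into a word. For an input of \<open>L\<close> words the stride is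
  \<open>L * L\<close>, which exceeds the number of edges and twice the number of nodes. Twenty
  arrays then occupy \<open>20 * L ^ 2 \<le> L ^ 4\<close> words, and \<open>valid_input\<close>
  with \<open>k = 4\<close> provides them.\<close>

text \<open>Scalar variables are the registers below \<open>num_vars\<close>, the registers from there on hold
  intermediate results. Array \<open>k\<close> occupies the addresses from \<open>k * S\<close> on, where the stride \<open>S\<close> is
  only known at run time and kept in the register \<open>stride_var\<close>. Arithmetic is that of the
  natural numbers; the weakest preconditions contain the absence of overflows.\<close>

abbreviation (input) num_vars :: nat where "num_vars \<equiv> 40"
abbreviation (input) num_arrays :: nat where "num_arrays \<equiv> 20"
abbreviation (input) stride_var :: nat where "stride_var \<equiv> 3"

type_synonym store = "(nat \<Rightarrow> nat) \<times> (nat \<Rightarrow> nat \<Rightarrow> nat)"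

datatype exp = N nat | V nat | Rd nat exp | Op binop exp exp

datatype com =
    Skip
  | Assign nat exp
  | Wr nat exp exp
  | Seq com com
  | Cond exp com com
  | While exp com

fun op_val :: "binop \<Rightarrow> nat \<Rightarrow> nat \<Rightarrow> nat" where
  "op_val Add x y = x + y"
| "op_val Subtract x y = x - y"
| "op_val Mult x y = x * y"
| "op_val Equal x y = of_bool (x = y)"
| "op_val Less x y = of_bool (x < y)"
| "op_val _ x y = 0"

text \<open>Subtraction of natural numbers agrees with that of the machine only if no borrow occurs,
  hence \<open>y \<le> x\<close>. The remaining operations are never safe, so the default value of
  \<open>op_val\<close> cannot be observed.\<close>

fun op_safe :: "nat \<Rightarrow> binop \<Rightarrow> nat \<Rightarrow> nat \<Rightarrow> bool" where
  "op_safe b Add x y \<longleftrightarrow> x + y < 2 ^ b"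
| "op_safe b Subtract x y \<longleftrightarrow> y \<le> x \<and> x < 2 ^ b"
| "op_safe b Mult x y \<longleftrightarrow> x * y < 2 ^ b"
| "op_safe b Equal x y \<longleftrightarrow> True"
| "op_safe b Less x y \<longleftrightarrow> True"
| "op_safe b _ x y \<longleftrightarrow> False"

fun exp_val :: "exp \<Rightarrow> store \<Rightarrow> nat" where
  "exp_val (N n) s = n"
| "exp_val (V x) s = fst s x"
| "exp_val (Rd k e) s = snd s k (exp_val e s)"
| "exp_val (Op f e1 e2) s = op_val f (exp_val e1 s) (exp_val e2 s)"

fun exp_safe :: "nat \<Rightarrow> nat \<Rightarrow> exp \<Rightarrow> store \<Rightarrow> bool" where
  "exp_safe b S (N n) s \<longleftrightarrow> n < 2 ^ b"
| "exp_safe b S (V x) s \<longleftrightarrow> x < num_vars"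
| "exp_safe b S (Rd k e) s \<longleftrightarrow> k < num_arrays \<and> exp_safe b S e s \<and> exp_val e s < S"
| "exp_safe b S (Op f e1 e2) s \<longleftrightarrow>
     exp_safe b S e1 s \<and> exp_safe b S e2 s \<and> op_safe b f (exp_val e1 s) (exp_val e2 s)"

text \<open>Only loop-free code has a weakest precondition. A loop is treated by
  \<open>triple_While\<close>, whose body is again loop-free.\<close>

fun wp :: "nat \<Rightarrow> nat \<Rightarrow> com \<Rightarrow> (store \<Rightarrow> bool) \<Rightarrow> store \<Rightarrow> bool" where
  "wp b S Skip Q s \<longleftrightarrow> Q s"
| "wp b S (Assign x e) Q s \<longleftrightarrow>
     x < num_vars \<and> x \<noteq> stride_var \<and> exp_safe b S e s \<and> Q ((fst s)(x := exp_val e s), snd s)"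
| "wp b S (Wr k e1 e2) Q s \<longleftrightarrow>
     k < num_arrays \<and> exp_safe b S e1 s \<and> exp_val e1 s < S \<and> exp_safe b S e2 s \<and>
     Q (fst s, (snd s)(k := (snd s k)(exp_val e1 s := exp_val e2 s)))"
| "wp b S (Seq c1 c2) Q s \<longleftrightarrow> wp b S c1 (wp b S c2 Q) s"
| "wp b S (Cond e c1 c2) Q s \<longleftrightarrow>
     exp_safe b S e s \<and> (if exp_val e s = 0 then wp b S c2 Q s else wp b S c1 Q s)"
| "wp b S (While e c) Q s \<longleftrightarrow> False"

text \<open>Registers from \<open>d\<close> on form an evaluation stack: the result arrives in
  \<open>d\<close>, and everything below \<open>d\<close> is preserved.\<close>

fun exp_code :: "nat \<Rightarrow> exp \<Rightarrow> instr list" where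
  "exp_code d (N n) = [Const d n]"
| "exp_code d (V x) = [Move d x]"
| "exp_code d (Rd k e) = exp_code d e @
     [Const (Suc d) k, Binop Mult (Suc d) (Suc d) stride_var, Binop Add d d (Suc d), Load d d]"
| "exp_code d (Op f e1 e2) = exp_code d e1 @ exp_code (Suc d) e2 @ [Binop f d d (Suc d)]"

text \<open>Jump targets are absolute, so the size has to be known before the code is generated. It
  also serves as the time bound of loop-free code.\<close>

fun code_size :: "com \<Rightarrow> nat" where
  "code_size Skip = 0"
| "code_size (Assign x e) = length (exp_code num_vars e) + 1"
| "code_size (Wr k e1 e2) =
     length (exp_code num_vars e1) + 3 + length (exp_code (Suc num_vars) e2) + 1"
| "code_size (Seq c1 c2) = code_size c1 + code_size c2"
| "code_size (Cond e c1 c2) =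
     length (exp_code num_vars e) + 1 + code_size c1 + 1 + code_size c2"
| "code_size (While e c) = length (exp_code num_vars e) + 1 + code_size c + 1"

fun com_code :: "nat \<Rightarrow> com \<Rightarrow> instr list" where
  "com_code off Skip = []"
| "com_code off (Assign x e) = exp_code num_vars e @ [Move x num_vars]"
| "com_code off (Wr k e1 e2) = exp_code num_vars e1 @
     [Const (Suc num_vars) k, Binop Mult (Suc num_vars) (Suc num_vars) stride_var,
      Binop Add num_vars num_vars (Suc num_vars)] @
     exp_code (Suc num_vars) e2 @ [Store num_vars (Suc num_vars)]"
| "com_code off (Seq c1 c2) = com_code off c1 @ com_code (off + code_size c1) c2"
| "com_code off (Cond e c1 c2) =
     (let l = off + length (exp_code num_vars e) + 1 in
      exp_code num_vars e @ [Jump_Zero num_vars (l + code_size c1 + 1)] @ com_code l c1 @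
      [Jump (l + code_size c1 + 1 + code_size c2)] @ com_code (l + code_size c1 + 1) c2)"
| "com_code off (While e c) =
     (let l = off + length (exp_code num_vars e) + 1 in
      exp_code num_vars e @ [Jump_Zero num_vars (l + code_size c + 1)] @ com_code l c @
      [Jump off])"

section \<open>Placement of compiled code in a program\<close>

lemma length_com_code [simp]: "length (com_code off c) = code_size c"
  by (induction c arbitrary: off) (auto simp: Let_def)

definition code_at :: "instr list \<Rightarrow> nat \<Rightarrow> instr list \<Rightarrow> bool" where
  "code_at P off is \<longleftrightarrow> (\<exists>xs ys. P = xs @ is @ ys \<and> length xs = off)"

lemma code_at_append:
  "code_at P off (is @ js) \<longleftrightarrow> code_at P off is \<and> code_at P (off + length is) js"
proof
  assume "code_at P off (is @ js)"
  then obtain xs ys where "P = xs @ (is @ js) @ ys" "length xs = off"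
    by (auto simp: code_at_def)
  then have "P = xs @ is @ (js @ ys)" "P = (xs @ is) @ js @ ys"
    by auto
  with \<open>length xs = off\<close> show "code_at P off is \<and> code_at P (off + length is) js"
    unfolding code_at_def by (metis length_append)
next
  assume "code_at P off is \<and> code_at P (off + length is) js"
  then obtain xs ys xs' ys' where P: "P = xs @ is @ ys" "length xs = off"
      "P = xs' @ js @ ys'" "length xs' = off + length is"
    unfolding code_at_def by blast
  then have "xs' = xs @ is"
    by (metis append.assoc append_eq_append_conv length_append)
  then have "P = xs @ (is @ js) @ ys'"
    using P by simp
  with P show "code_at P off (is @ js)"
    unfolding code_at_def by blast
qed

lemma code_at_Cons:
  "code_at P off (i # js) \<longleftrightarrow> code_at P off [i] \<and> code_at P (Suc off) js"
  using code_at_append[of P off "[i]" js] by simp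

lemma code_at_nth: "code_at P off [i] \<Longrightarrow> off < length P \<and> P ! off = i"
  by (auto simp: code_at_def nth_append)

lemma step_code: "code_at P (pc s) [i] \<Longrightarrow> i \<noteq> Halt \<Longrightarrow> step b P s = exec_instr b i s"
  using code_at_nth[of P "pc s" i] by (simp add: step_def halted_def)

subsection \<open>Straight-line code\<close>

fun straight :: "instr \<Rightarrow> bool" where
  "straight (Jump l) = False"
| "straight (Jump_Zero r l) = False"
| "straight Halt = False"
| "straight _ = True"

lemma pc_exec_instr: "straight i \<Longrightarrow> pc (exec_instr b i s) = Suc (pc s)"
  by (cases i) auto

lemma pc_fold:
  "\<forall>i \<in> set is. straight i \<Longrightarrow> pc (fold (exec_instr b) is s) = pc s + length is"
  by (induction "is" arbitrary: s) (auto simp: pc_exec_instr)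

lemma step_straight:
  "code_at P (pc s) is \<Longrightarrow> \<forall>i \<in> set is. straight i \<Longrightarrow>
   (step b P ^^ length is) s = fold (exec_instr b) is s"
proof (induction "is" arbitrary: s)
  case (Cons i js)
  from Cons.prems have i: "code_at P (pc s) [i]" "code_at P (Suc (pc s)) js" "straight i"
    using code_at_Cons[of P "pc s" i js] by auto
  then have "step b P s = exec_instr b i s"
    by (intro step_code) auto
  moreover have "(step b P ^^ length js) (exec_instr b i s) = fold (exec_instr b) js (exec_instr b i s)"
    using i Cons.prems by (intro Cons.IH) (auto simp: pc_exec_instr)
  ultimately show ?case
    unfolding list.size(4) add_Suc_right add_0_right funpow_Suc_right by simp
qed simp

section \<open>Simulation of stores by machine states\<close>

definition sim :: "nat \<Rightarrow> store \<Rightarrow> ram_state \<Rightarrow> bool" where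
  "sim S s \<sigma> \<longleftrightarrow> (\<forall>x < num_vars. regs \<sigma> x = fst s x) \<and> fst s stride_var = S \<and>
     (\<forall>k < num_arrays. \<forall>i < S. mem \<sigma> (k * S + i) = snd s k i)"

definition word_ok :: "nat \<Rightarrow> nat \<Rightarrow> bool" where
  "word_ok b S \<longleftrightarrow> num_arrays * S \<le> 2 ^ b \<and> 0 < S"

lemma array_address_bound:
  assumes "word_ok b S" "k < num_arrays" "i < S"
  shows "k * S + i < 2 ^ b"
proof -
  have "k * S + i < (k + 1) * S" using assms by simp
  also have "\<dots> \<le> num_arrays * S" using assms by (intro mult_right_mono) auto
  finally show ?thesis using assms by (simp add: word_ok_def)
qed

lemma word_ok_pos: "word_ok b S \<Longrightarrow> 20 \<le> (2::nat) ^ b"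
  unfolding word_ok_def by linarith

lemma straight_exp_code: "\<forall>i \<in> set (exp_code d e). straight i"
  by (induction e arbitrary: d) auto

text \<open>The machine adds \<open>2 ^ b - y\<close> instead of subtracting \<open>y\<close>, and
  the surplus \<open>2 ^ b\<close> is cut off. With \<open>0 < b\<close> the truth value
  \<open>1\<close> survives truncation.\<close>

lemma eval_binop_safe:
  assumes "op_safe b f x y" "0 < b"
  shows "eval_binop b f x y = op_val f x y"
proof (cases f)
  case Subtract
  then have "x + (2 ^ b - y) = (x - y) + 2 ^ b" "x - y < 2 ^ b"
    using assms by auto
  then show ?thesis
    using Subtract by (simp add: take_bit_eq_mod)
qed (use assms in \<open>auto simp: take_bit_nat_eq_self take_bit_of_1\<close>)

lemma exp_code_correct:
  assumes "word_ok b S" "exp_safe b S e s" "sim S s \<sigma>" "num_vars \<le> d"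
  shows "regs (fold (exec_instr b) (exp_code d e) \<sigma>) d = exp_val e s \<and>
    (\<forall>x < d. regs (fold (exec_instr b) (exp_code d e) \<sigma>) x = regs \<sigma> x) \<and>
    mem (fold (exec_instr b) (exp_code d e) \<sigma>) = mem \<sigma>"
  using assms
proof (induction e arbitrary: d \<sigma>)
  case (N n)
  then show ?case by (simp add: take_bit_nat_eq_self)
next
  case (V x)
  then show ?case by (simp add: sim_def)
next
  case (Rd k e)
  let ?\<sigma> = "fold (exec_instr b) (exp_code d e) \<sigma>"
  from Rd have IH: "regs ?\<sigma> d = exp_val e s" "\<forall>x < d. regs ?\<sigma> x = regs \<sigma> x"
    "mem ?\<sigma> = mem \<sigma>"
    by simp_all
  have k: "k < num_arrays" "exp_val e s < S"
    using Rd.prems by auto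
  then have b: "k * S + exp_val e s < 2 ^ b"
    using array_address_bound Rd.prems by blast
  then have tb: "take_bit b (k * S) = k * S" "take_bit b (k * S + exp_val e s) = k * S + exp_val e s"
    "take_bit b k = k"
    using k word_ok_pos[OF Rd.prems(1)] by (simp_all add: take_bit_nat_eq_self)
  have "regs ?\<sigma> 3 = S"
    using IH Rd.prems by (simp add: sim_def)
  moreover have "mem \<sigma> (exp_val e s + k * S) = snd s k (exp_val e s)"
    unfolding add.commute[of "exp_val e s"] using k Rd.prems by (simp add: sim_def)
  moreover have "take_bit b (exp_val e s + k * S) = exp_val e s + k * S"
    using tb by (simp add: add.commute)
  ultimately show ?case
    using IH tb \<open>num_vars \<le> d\<close> by simp
next
  case (Op f e1 e2)
  let ?\<sigma>1 = "fold (exec_instr b) (exp_code d e1) \<sigma>"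
  let ?\<sigma>2 = "fold (exec_instr b) (exp_code (Suc d) e2) ?\<sigma>1"
  from Op have IH1: "regs ?\<sigma>1 d = exp_val e1 s" "\<forall>x < d. regs ?\<sigma>1 x = regs \<sigma> x"
    "mem ?\<sigma>1 = mem \<sigma>"
    by simp_all
  then have "sim S s ?\<sigma>1"
    using Op.prems by (simp add: sim_def)
  with Op have IH2: "regs ?\<sigma>2 (Suc d) = exp_val e2 s"
    "\<forall>x < Suc d. regs ?\<sigma>2 x = regs ?\<sigma>1 x"
    "mem ?\<sigma>2 = mem ?\<sigma>1"
    by simp_all
  have "0 < b"
    using word_ok_pos[OF Op.prems(1)] by (cases b) auto
  then show ?case
    using IH1 IH2 Op.prems by (simp add: eval_binop_safe del: eval_binop.simps)
qed

lemma run_exp_code: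
  assumes "word_ok b S" "exp_safe b S e s" "sim S s \<sigma>" "num_vars \<le> d"
    "code_at P (pc \<sigma>) (exp_code d e)"
  obtains \<sigma>' where "(step b P ^^ length (exp_code d e)) \<sigma> = \<sigma>'"
    "pc \<sigma>' = pc \<sigma> + length (exp_code d e)" "sim S s \<sigma>'" "regs \<sigma>' d = exp_val e s"
    "\<forall>x < d. regs \<sigma>' x = regs \<sigma> x" "mem \<sigma>' = mem \<sigma>"
proof
  let ?\<sigma> = "fold (exec_instr b) (exp_code d e) \<sigma>"
  show "(step b P ^^ length (exp_code d e)) \<sigma> = ?\<sigma>"
    using assms straight_exp_code by (simp add: step_straight)
  show "pc ?\<sigma> = pc \<sigma> + length (exp_code d e)"
    by (simp add: pc_fold straight_exp_code)
  show "regs ?\<sigma> d = exp_val e s" "\<forall>x < d. regs ?\<sigma> x = regs \<sigma> x"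
    "mem ?\<sigma> = mem \<sigma>"
    using exp_code_correct assms by blast+
  then show "sim S s ?\<sigma>"
    using assms by (simp add: sim_def)
qed

subsection \<open>Timed triples\<close>

text \<open>The code may stand anywhere in an arbitrary program \<open>P\<close>, which makes
  triples composable. The final state does not halt but stands directly behind the code.\<close>

definition triple ::
  "nat \<Rightarrow> nat \<Rightarrow> (store \<Rightarrow> bool) \<Rightarrow> com \<Rightarrow> nat \<Rightarrow> (store \<Rightarrow> bool) \<Rightarrow> bool" where
  "triple b S pre c T post \<longleftrightarrow>
     (\<forall>P s \<sigma>. pre s \<longrightarrow> sim S s \<sigma> \<longrightarrow> code_at P (pc \<sigma>) (com_code (pc \<sigma>) c) \<longrightarrow>
        (\<exists>t s'. t \<le> T \<and> post s' \<and> sim S s' ((step b P ^^ t) \<sigma>) \<and>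
           pc ((step b P ^^ t) \<sigma>) = pc \<sigma> + code_size c))"

lemma triple_conseq:
  "triple b S pre c T post \<Longrightarrow> (\<And>s. pre' s \<Longrightarrow> pre s) \<Longrightarrow> T \<le> T' \<Longrightarrow> (\<And>s. post s \<Longrightarrow> post' s) \<Longrightarrow>
   triple b S pre' c T' post'"
  unfolding triple_def by (metis (no_types, lifting) order_trans)

lemma triple_Seq:
  assumes "triple b S pre c1 T1 mid" "triple b S mid c2 T2 post"
  shows "triple b S pre (Seq c1 c2) (T1 + T2) post"
  unfolding triple_def
proof (intro allI impI)
  fix P s \<sigma>
  assume s: "pre s" "sim S s \<sigma>" "code_at P (pc \<sigma>) (com_code (pc \<sigma>) (Seq c1 c2))"
  then have c: "code_at P (pc \<sigma>) (com_code (pc \<sigma>) c1)"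
    "code_at P (pc \<sigma> + code_size c1) (com_code (pc \<sigma> + code_size c1) c2)"
    by (simp_all add: code_at_append)
  with s assms(1) obtain t1 s1 where t1: "t1 \<le> T1" "mid s1" "sim S s1 ((step b P ^^ t1) \<sigma>)"
    "pc ((step b P ^^ t1) \<sigma>) = pc \<sigma> + code_size c1"
    unfolding triple_def by metis
  with c assms(2) obtain t2 s2 where t2: "t2 \<le> T2" "post s2"
    "sim S s2 ((step b P ^^ t2) ((step b P ^^ t1) \<sigma>))"
    "pc ((step b P ^^ t2) ((step b P ^^ t1) \<sigma>)) = pc \<sigma> + code_size c1 + code_size c2"
    unfolding triple_def by metis
  have "(step b P ^^ t2) ((step b P ^^ t1) \<sigma>) = (step b P ^^ (t1 + t2)) \<sigma>"
    by (simp add: funpow_add add.commute[of t1])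
  with t1 t2 show "\<exists>t s'. t \<le> T1 + T2 \<and> post s' \<and> sim S s' ((step b P ^^ t) \<sigma>) \<and>
      pc ((step b P ^^ t) \<sigma>) = pc \<sigma> + code_size (Seq c1 c2)"
    by (metis add_mono add.assoc code_size.simps(4))
qed

text \<open>With the initial store fixed, parameters of the specification such as a graph or a class
  function can be read off from its arrays.\<close>

lemma triple_pre_store:
  "(\<And>s. pre s \<Longrightarrow> triple b S (\<lambda>s'. s' = s) c T post) \<Longrightarrow> triple b S pre c T post"
  unfolding triple_def by blast

text \<open>All jumps of loop-free code lead forward, so each instruction is executed at most
  once.\<close>

lemma triple_wp:
  assumes "word_ok b S"
  shows "triple b S (wp b S c Q) c (code_size c) Q"
proof (induction c arbitrary: Q)
  case Skip
  show ?case
    unfolding triple_def by auto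
next
  case (Assign x e)
  show ?case
    unfolding triple_def
  proof (intro allI impI)
    fix P s \<sigma>
    assume s: "wp b S (Assign x e) Q s" "sim S s \<sigma>"
      "code_at P (pc \<sigma>) (com_code (pc \<sigma>) (Assign x e))"
    then obtain \<sigma>' where \<sigma>': "(step b P ^^ length (exp_code num_vars e)) \<sigma> = \<sigma>'"
      "pc \<sigma>' = pc \<sigma> + length (exp_code num_vars e)" "sim S s \<sigma>'"
        "regs \<sigma>' num_vars = exp_val e s"
      using run_exp_code[OF assms, of e s \<sigma> num_vars P] by (auto simp: code_at_append)
    have "step b P \<sigma>' = exec_instr b (Move x num_vars) \<sigma>'"
      by (rule step_code) (use s \<sigma>' in \<open>auto simp: code_at_append\<close>)
    then have eq: "(step b P ^^ code_size (Assign x e)) \<sigma> = exec_instr b (Move x num_vars) \<sigma>'"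
      using \<sigma>' by simp
    have "sim S ((fst s)(x := exp_val e s), snd s) (exec_instr b (Move x num_vars) \<sigma>')"
      using \<sigma>'(3,4) s(1) by (simp add: sim_def)
    moreover have "pc (exec_instr b (Move x num_vars) \<sigma>') = pc \<sigma> + code_size (Assign x e)"
      using \<sigma>'(2) by simp
    moreover have "Q ((fst s)(x := exp_val e s), snd s)"
      using s(1) by simp
    ultimately show "\<exists>t s'. t \<le> code_size (Assign x e) \<and> Q s' \<and> sim S s' ((step b P ^^ t) \<sigma>) \<and>
        pc ((step b P ^^ t) \<sigma>) = pc \<sigma> + code_size (Assign x e)"
      unfolding eq[symmetric] by blast
  qed
next
  case (Wr k e1 e2)
  let ?is = "[Const (Suc num_vars) k, Binop Mult (Suc num_vars) (Suc num_vars) stride_var,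
      Binop Add num_vars num_vars (Suc num_vars)]"
  show ?case
    unfolding triple_def
  proof (intro allI impI)
    fix P s \<sigma>
    assume s: "wp b S (Wr k e1 e2) Q s" "sim S s \<sigma>"
      "code_at P (pc \<sigma>) (com_code (pc \<sigma>) (Wr k e1 e2))"
    let ?n1 = "length (exp_code num_vars e1)" and ?n2 = "length (exp_code (Suc num_vars) e2)"
    from s have c: "code_at P (pc \<sigma>) (exp_code num_vars e1)"
      "code_at P (pc \<sigma> + ?n1) ?is" "code_at P (pc \<sigma> + ?n1 + 3) (exp_code (Suc num_vars) e2)"
      "code_at P (pc \<sigma> + ?n1 + 3 + ?n2) [Store num_vars (Suc num_vars)]"
      unfolding com_code.simps code_at_append by (simp_all add: eval_nat_numeral)
    with s obtain \<sigma>1 where \<sigma>1: "(step b P ^^ ?n1) \<sigma> = \<sigma>1"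
      "pc \<sigma>1 = pc \<sigma> + ?n1" "sim S s \<sigma>1" "regs \<sigma>1 num_vars = exp_val e1 s"
        "mem \<sigma>1 = mem \<sigma>"
      using run_exp_code[OF assms, of e1 s \<sigma> num_vars P] by auto
    let ?\<sigma>2 = "fold (exec_instr b) ?is \<sigma>1"
    have st2: "(step b P ^^ 3) \<sigma>1 = ?\<sigma>2"
      using step_straight[of P \<sigma>1 ?is b] c(2) \<sigma>1(2) by (simp add: numeral_3_eq_3)
    have k: "k < num_arrays" "exp_val e1 s < S"
      using s by auto
    then have "k * S + exp_val e1 s < 2 ^ b"
      using array_address_bound assms by blast
    then have tb: "take_bit b (k * S) = k * S"
      "take_bit b (k * S + exp_val e1 s) = k * S + exp_val e1 s" "take_bit b k = k"
      using k word_ok_pos[OF assms] by (simp_all add: take_bit_nat_eq_self)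
    have "regs \<sigma>1 3 = S"
      using \<sigma>1 by (simp add: sim_def)
    then have \<sigma>2: "pc ?\<sigma>2 = pc \<sigma> + ?n1 + 3" "sim S s ?\<sigma>2"
      "regs ?\<sigma>2 num_vars = k * S + exp_val e1 s"
      "mem ?\<sigma>2 = mem \<sigma>"
      using \<sigma>1 tb by (simp_all add: sim_def add.commute[of "exp_val e1 s"])
    obtain \<sigma>2 where \<sigma>2_def: "?\<sigma>2 = \<sigma>2"
      by blast
    note st2 = st2[unfolded \<sigma>2_def] and \<sigma>2 = \<sigma>2[unfolded \<sigma>2_def]
    have e2: "exp_safe b S e2 s" "code_at P (pc \<sigma>2) (exp_code (Suc num_vars) e2)"
      using s(1) c(3) \<sigma>2(1) by simp_all
    obtain \<sigma>3 where \<sigma>3: "(step b P ^^ ?n2) \<sigma>2 = \<sigma>3"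
      "pc \<sigma>3 = pc \<sigma>2 + ?n2" "sim S s \<sigma>3"
      "regs \<sigma>3 (Suc num_vars) = exp_val e2 s"
        "\<forall>x < Suc num_vars. regs \<sigma>3 x = regs \<sigma>2 x"
      "mem \<sigma>3 = mem \<sigma>2"
      by (rule run_exp_code[OF assms e2(1) \<sigma>2(2) _ e2(2)]) simp
    then have \<sigma>3': "pc \<sigma>3 = pc \<sigma> + ?n1 + 3 + ?n2"
      "regs \<sigma>3 num_vars = k * S + exp_val e1 s"
      "mem \<sigma>3 = mem \<sigma>"
      using \<sigma>2 by simp_all
    let ?\<sigma>4 = "exec_instr b (Store num_vars (Suc num_vars)) \<sigma>3"
    have "step b P \<sigma>3 = ?\<sigma>4"
      by (rule step_code) (simp_all only: c(4) \<sigma>3'(1), simp)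
    then have "(step b P ^^ Suc (?n2 + (3 + ?n1))) \<sigma> = ?\<sigma>4"
      unfolding funpow.simps(2) funpow_add o_def \<sigma>1(1) st2 \<sigma>3(1) .
    then have eq: "(step b P ^^ code_size (Wr k e1 e2)) \<sigma> = ?\<sigma>4"
      by (simp add: algebra_simps del: funpow.simps)
    have "sim S (fst s, (snd s)(k := (snd s k)(exp_val e1 s := exp_val e2 s))) ?\<sigma>4"
      unfolding sim_def
    proof (intro conjI allI impI)
      fix k' i
      assume i: "k' < num_arrays" "i < S"
      \<comment> \<open>Both indices are below the stride, so division by \<open>S\<close> recovers
        the array, and different cells have different addresses.\<close>
      have "k' * S + i = k * S + exp_val e1 s \<longleftrightarrow> k' = k \<and> i = exp_val e1 s"
        using i k by (metis div_mult_self3 div_less add.right_neutral add_left_cancel mult.commute less_nat_zero_code)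
      then show "mem ?\<sigma>4 (k' * S + i) = snd (fst s, (snd s)(k := (snd s k)(exp_val e1 s := exp_val e2 s))) k' i"
        using i \<sigma>3(3,4) \<sigma>3'(2) by (auto simp: sim_def)
    qed (use \<sigma>3(3) in \<open>simp_all add: sim_def\<close>)
    then show "\<exists>t s'. t \<le> code_size (Wr k e1 e2) \<and> Q s' \<and> sim S s' ((step b P ^^ t) \<sigma>) \<and>
        pc ((step b P ^^ t) \<sigma>) = pc \<sigma> + code_size (Wr k e1 e2)"
      by (intro exI[of _ "code_size (Wr k e1 e2)"] exI[of _ "(fst s, (snd s)(k := (snd s k)(exp_val e1 s := exp_val e2 s)))"],
          unfold eq) (use s(1) \<sigma>3'(1) in simp)
  qed
next
  case (Seq c1 c2)
  have eq: "wp b S (Seq c1 c2) Q = wp b S c1 (wp b S c2 Q)"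
    by (rule ext) simp
  show ?case
    unfolding eq code_size.simps by (rule triple_Seq[OF Seq.IH(1) Seq.IH(2)])
next
  case (Cond e c1 c2)
  show ?case
    unfolding triple_def
  proof (intro allI impI)
    fix P s \<sigma>
    assume s: "wp b S (Cond e c1 c2) Q s" "sim S s \<sigma>"
      "code_at P (pc \<sigma>) (com_code (pc \<sigma>) (Cond e c1 c2))"
    let ?n = "length (exp_code num_vars e)"
    let ?l = "pc \<sigma> + ?n + 1"
    from s(3) have c: "code_at P (pc \<sigma>) (exp_code num_vars e)"
      "code_at P (pc \<sigma> + ?n) [Jump_Zero num_vars (?l + code_size c1 + 1)]"
      "code_at P ?l (com_code ?l c1)"
      "code_at P (?l + code_size c1) [Jump (?l + code_size c1 + 1 + code_size c2)]"
      "code_at P (?l + code_size c1 + 1) (com_code (?l + code_size c1 + 1) c2)"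
      unfolding com_code.simps Let_def code_at_append by (simp_all add: add.assoc)
    with s obtain \<sigma>1 where \<sigma>1: "(step b P ^^ ?n) \<sigma> = \<sigma>1"
      "pc \<sigma>1 = pc \<sigma> + ?n" "sim S s \<sigma>1" "regs \<sigma>1 num_vars = exp_val e s"
      using run_exp_code[OF assms, of e s \<sigma> num_vars P] by auto
    let ?\<sigma>2 = "exec_instr b (Jump_Zero num_vars (?l + code_size c1 + 1)) \<sigma>1"
    have "step b P \<sigma>1 = ?\<sigma>2"
      by (rule step_code) (use c \<sigma>1 in auto)
    then have st2: "(step b P ^^ (?n + 1)) \<sigma> = ?\<sigma>2"
      using \<sigma>1 by simp
    have sim2: "sim S s ?\<sigma>2"
      using \<sigma>1 by (simp add: sim_def)
    show "\<exists>t s'. t \<le> code_size (Cond e c1 c2) \<and> Q s' \<and> sim S s' ((step b P ^^ t) \<sigma>) \<and>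
        pc ((step b P ^^ t) \<sigma>) = pc \<sigma> + code_size (Cond e c1 c2)"
    proof (cases "exp_val e s = 0")
      case True
      then have "wp b S c2 Q s" "pc ?\<sigma>2 = ?l + code_size c1 + 1"
        using s \<sigma>1 by auto
      with Cond.IH(2)[of Q] sim2 c obtain t s' where t: "t \<le> code_size c2" "Q s'"
        "sim S s' ((step b P ^^ t) ?\<sigma>2)"
          "pc ((step b P ^^ t) ?\<sigma>2) = ?l + code_size c1 + 1 + code_size c2"
        unfolding triple_def by metis
      have "(step b P ^^ t) ?\<sigma>2 = (step b P ^^ (t + (?n + 1))) \<sigma>"
        unfolding st2[symmetric] funpow_add[of t] by simp
      with t show ?thesis
        by (intro exI[of _ "t + (?n + 1)"] exI[of _ s']) auto
    next
      case False
      then have "wp b S c1 Q s" "pc ?\<sigma>2 = ?l"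
        using s \<sigma>1 by auto
      with Cond.IH(1)[of Q] sim2 c obtain t s' where t: "t \<le> code_size c1" "Q s'"
        "sim S s' ((step b P ^^ t) ?\<sigma>2)" "pc ((step b P ^^ t) ?\<sigma>2) = ?l + code_size c1"
        unfolding triple_def by metis
      let ?\<sigma>3 = "(step b P ^^ t) ?\<sigma>2"
      have "step b P ?\<sigma>3 = exec_instr b (Jump (?l + code_size c1 + 1 + code_size c2)) ?\<sigma>3"
        by (rule step_code) (use c t in auto)
      moreover have "step b P ?\<sigma>3 = (step b P ^^ (Suc t + (?n + 1))) \<sigma>"
        unfolding st2[symmetric] funpow_add[of "Suc t"] by simp
      ultimately have eq: "(step b P ^^ (Suc t + (?n + 1))) \<sigma> =
          exec_instr b (Jump (?l + code_size c1 + 1 + code_size c2)) ?\<sigma>3"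
        by simp
      show ?thesis
        by (rule exI[of _ "Suc t + (?n + 1)"], rule exI[of _ s'], unfold eq) (use t in \<open>auto simp: sim_def\<close>)
    qed
  qed
next
  case (While e c)
  then show ?case by (simp add: triple_def)
qed

definition while_time :: "exp \<Rightarrow> com \<Rightarrow> nat" where
  "while_time e c = length (exp_code num_vars e) + code_size c + 2"

text \<open>\<open>while_time\<close> covers one test, one run of the body and both jumps; there are
  at most \<open>M\<close> iterations, and the final test accounts for \<open>Suc M\<close>.\<close>

lemma triple_While:
  assumes w: "word_ok b S"
    and I: "\<And>s. I s \<Longrightarrow> exp_safe b S e s"
    and body: "\<And>s. I s \<Longrightarrow> exp_val e s \<noteq> 0 \<Longrightarrow> wp b S c (\<lambda>s'. I s' \<and> \<mu> s' < (\<mu> s :: nat)) s"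
  shows "triple b S (\<lambda>s. I s \<and> \<mu> s \<le> M) (While e c) (while_time e c * Suc M)
    (\<lambda>s. I s \<and> exp_val e s = 0)"
  unfolding triple_def
proof (intro allI impI, elim conjE)
  fix P s \<sigma>
  assume "I s" "\<mu> s \<le> M" "sim S s \<sigma>"
    "code_at P (pc \<sigma>) (com_code (pc \<sigma>) (While e c))"
  then show "\<exists>t s'. t \<le> while_time e c * Suc M \<and> (I s' \<and> exp_val e s' = 0) \<and>
      sim S s' ((step b P ^^ t) \<sigma>) \<and> pc ((step b P ^^ t) \<sigma>) = pc \<sigma> + code_size (While e c)"
  proof (induction M arbitrary: s \<sigma> rule: less_induct)
    case (less M)
    let ?n = "length (exp_code num_vars e)"
    let ?l = "pc \<sigma> + ?n + 1"
    from less.prems(4) have c: "code_at P (pc \<sigma>) (exp_code num_vars e)"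
      "code_at P (pc \<sigma> + ?n) [Jump_Zero num_vars (?l + code_size c + 1)]"
      "code_at P ?l (com_code ?l c)" "code_at P (?l + code_size c) [Jump (pc \<sigma>)]"
      unfolding com_code.simps Let_def code_at_append by (simp_all add: add.assoc)
    with less.prems I obtain \<sigma>1 where \<sigma>1: "(step b P ^^ ?n) \<sigma> = \<sigma>1"
      "pc \<sigma>1 = pc \<sigma> + ?n" "sim S s \<sigma>1" "regs \<sigma>1 num_vars = exp_val e s"
      using run_exp_code[OF w, of e s \<sigma> num_vars P] by auto
    let ?\<sigma>2 = "exec_instr b (Jump_Zero num_vars (?l + code_size c + 1)) \<sigma>1"
    have "step b P \<sigma>1 = ?\<sigma>2"
      by (rule step_code) (use c \<sigma>1 in auto)
    then have st2: "(step b P ^^ (?n + 1)) \<sigma> = ?\<sigma>2"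
      using \<sigma>1 by simp
    have sim2: "sim S s ?\<sigma>2"
      using \<sigma>1 by (simp add: sim_def)
    show ?case
    proof (cases "exp_val e s = 0")
      case True
      have "?n + 1 \<le> while_time e c * Suc M"
        by (simp add: while_time_def)
      then show ?thesis
        by (intro exI[of _ "?n + 1"] exI[of _ s], unfold st2)
          (use True less.prems \<sigma>1 sim2 in auto)
    next
      case False
      have "pc ?\<sigma>2 = ?l"
        using False \<sigma>1 by auto
      with triple_wp[OF w, of c] sim2 c body[OF less.prems(1) False] obtain t s'
        where t: "t \<le> code_size c" "I s'" "\<mu> s' < \<mu> s"
        "sim S s' ((step b P ^^ t) ?\<sigma>2)" "pc ((step b P ^^ t) ?\<sigma>2) = ?l + code_size c"
        unfolding triple_def by (smt (verit, best))
      let ?\<sigma>3 = "(step b P ^^ t) ?\<sigma>2"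
      let ?\<sigma>4 = "exec_instr b (Jump (pc \<sigma>)) ?\<sigma>3"
      have "step b P ?\<sigma>3 = ?\<sigma>4"
        by (rule step_code) (use c t in auto)
      moreover have "step b P ?\<sigma>3 = (step b P ^^ (Suc t + (?n + 1))) \<sigma>"
        unfolding st2[symmetric] funpow_add[of "Suc t"] by simp
      ultimately have st4: "(step b P ^^ (Suc t + (?n + 1))) \<sigma> = ?\<sigma>4"
        by simp
      have 4: "sim S s' ?\<sigma>4" "pc ?\<sigma>4 = pc \<sigma>"
        using t by (simp_all add: sim_def)
      have "\<mu> s' \<le> M - 1" "M - 1 < M"
        using t less.prems by auto
      from less.IH[OF this(2) t(2) this(1) 4(1)] 4(2) less.prems(4)
      obtain t' s'' where t': "t' \<le> while_time e c * Suc (M - 1)" "I s''" "exp_val e s'' = 0"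
        "sim S s'' ((step b P ^^ t') ?\<sigma>4)"
          "pc ((step b P ^^ t') ?\<sigma>4) = pc \<sigma> + code_size (While e c)"
        by auto
      have "Suc t + (?n + 1) \<le> while_time e c"
        using t by (simp add: while_time_def)
      then have "t' + (Suc t + (?n + 1)) \<le> while_time e c * Suc (M - 1) + while_time e c"
        using t' by linarith
      also have "\<dots> = while_time e c * Suc M"
        using \<open>M - 1 < M\<close> by (cases M) auto
      finally have "t' + (Suc t + (?n + 1)) \<le> while_time e c * Suc M" .
      moreover have "(step b P ^^ (t' + (Suc t + (?n + 1)))) \<sigma> = (step b P ^^ t') ?\<sigma>4"
        unfolding funpow_add[of t'] st4[symmetric] by simp
      ultimately show ?thesis
        using t' by (metis (no_types, lifting))
    qed
  qed
qed

section \<open>Labelled graphs\<close>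

definition lword :: "nat \<Rightarrow> nat list" where
  "lword l = (if l = 0 then [] else [l])"

text \<open>The edges are numbered from \<open>1\<close>, so that \<open>0\<close> can end the lists of edges. The label \<open>0\<close> is
  the empty one.\<close>

locale labelled_graph =
  fixes E :: nat and src dst lab :: "nat \<Rightarrow> nat"
begin

inductive walk :: "nat \<Rightarrow> nat list \<Rightarrow> nat \<Rightarrow> bool" where
  walk_Nil: "walk u [] u"
| walk_Cons: "e \<in> {1..E} \<Longrightarrow> src e = u \<Longrightarrow> walk (dst e) xs v \<Longrightarrow> walk u (lword (lab e) @ xs) v"

lemma walk_append: "walk u xs v \<Longrightarrow> walk v ys z \<Longrightarrow> walk u (xs @ ys) z"
  by (induction rule: walk.induct) (auto intro: walk.intros)

lemma walk_edge: "e \<in> {1..E} \<Longrightarrow> walk (src e) (lword (lab e)) (dst e)"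
  using walk_Cons[OF _ _ walk_Nil] by auto

lemma walk_snoc: "walk u xs (src e) \<Longrightarrow> e \<in> {1..E} \<Longrightarrow> walk u (xs @ lword (lab e)) (dst e)"
  using walk_append walk_edge by blast

definition reach :: "nat \<Rightarrow> nat \<Rightarrow> bool" where
  "reach u v \<longleftrightarrow> (\<exists>xs. walk u xs v)"

lemma reach_refl: "reach u u"
  unfolding reach_def using walk_Nil by blast

lemma reach_trans: "reach u v \<Longrightarrow> reach v z \<Longrightarrow> reach u z"
  unfolding reach_def using walk_append by blast

lemma reach_edge: "e \<in> {1..E} \<Longrightarrow> reach (src e) (dst e)"
  unfolding reach_def using walk_edge by blast

text \<open>Following the parent edges from a node spells a word backwards. Nodes are grouped into
  classes \<open>cls\<close>, since all nodes of a strongly connected component have the same parent edge.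
  The first argument of \<open>spells\<close> counts the edges.\<close>

inductive spells :: "(nat \<Rightarrow> nat) \<Rightarrow> (nat \<Rightarrow> nat) \<Rightarrow> nat \<Rightarrow> nat \<Rightarrow> nat list \<Rightarrow> bool" for cls par where
  spells_0: "par j = 0 \<Longrightarrow> spells cls par 0 j []"
| spells_Suc: "par j \<in> {1..E} \<Longrightarrow> spells cls par d (cls (src (par j))) xs \<Longrightarrow>
    spells cls par (Suc d) j (xs @ lword (lab (par j)))"

end

section \<open>Linked lists of edges\<close>

text \<open>The edges \<open>1, \<dots>, E\<close> are grouped by a key \<open>\<kappa>\<close>, and \<open>c k\<close> is a position in the list of the
  edges with key \<open>k\<close>, which is sorted in descending order.\<close>

definition cursor :: "nat \<Rightarrow> (nat \<Rightarrow> nat) \<Rightarrow> (nat \<Rightarrow> nat) \<Rightarrow> (nat \<Rightarrow> nat) \<Rightarrow> bool" where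
  "cursor E \<kappa> nx c \<longleftrightarrow>
     (\<forall>k. c k \<le> E \<and> (c k \<noteq> 0 \<longrightarrow> \<kappa> (c k) = k)) \<and>
     (\<forall>e \<in> {1..E}. nx e < e \<and> (nx e \<noteq> 0 \<longrightarrow> \<kappa> (nx e) = \<kappa> e) \<and>
        (\<forall>e' \<in> {1..<e}. \<kappa> e' = \<kappa> e \<longrightarrow> e' \<le> nx e))"

text \<open>The lists are descending, so the edges still ahead of a cursor are those of its key with
  a number up to the cursor. The links do not enter.\<close>

definition pending :: "nat \<Rightarrow> (nat \<Rightarrow> nat) \<Rightarrow> (nat \<Rightarrow> nat) \<Rightarrow> nat set" where
  "pending E \<kappa> c = {e \<in> {1..E}. e \<le> c (\<kappa> e)}"

lemma pending_subset: "pending E \<kappa> c \<subseteq> {1..E}"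
  by (auto simp: pending_def)

lemma finite_pending [simp]: "finite (pending E \<kappa> c)"
  by (simp add: pending_def)

lemma card_pending: "card (pending E \<kappa> c) \<le> E"
  using card_mono[OF _ pending_subset] by force

lemma cursor_at:
  assumes "cursor E \<kappa> nx c" "c k \<noteq> 0"
  shows "c k \<in> {1..E}" "\<kappa> (c k) = k" "c k \<in> pending E \<kappa> c"
  using assms by (auto simp: cursor_def pending_def Suc_le_eq)

text \<open>\<open>nx\<close> yields the largest smaller edge with the same key. Hence nothing is
  skipped between \<open>c k\<close> and its successor, and exactly one edge leaves
  \<open>pending\<close>.\<close>

lemma cursor_advance:
  assumes "cursor E \<kappa> nx c" "c k \<noteq> 0"
  shows "cursor E \<kappa> nx (c(k := nx (c k)))"
    and "pending E \<kappa> (c(k := nx (c k))) = pending E \<kappa> c - {c k}"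
    and "card (pending E \<kappa> (c(k := nx (c k)))) < card (pending E \<kappa> c)"
proof -
  note k = cursor_at[OF assms]
  have nx: "nx (c k) < c k" "nx (c k) \<noteq> 0 \<longrightarrow> \<kappa> (nx (c k)) = k"
    "\<And>e'. e' \<in> {1..<c k} \<Longrightarrow> \<kappa> e' = k \<Longrightarrow> e' \<le> nx (c k)"
    using assms(1) k unfolding cursor_def by auto
  have "nx (c k) \<le> E"
    using nx(1) k(1) by auto
  then show "cursor E \<kappa> nx (c(k := nx (c k)))"
    using assms(1) nx(1,2) k(1) unfolding cursor_def by (auto intro: less_imp_le less_trans)
  show eq: "pending E \<kappa> (c(k := nx (c k))) = pending E \<kappa> c - {c k}"
  proof (rule set_eqI)
    fix e
    show "e \<in> pending E \<kappa> (c(k := nx (c k))) \<longleftrightarrow> e \<in> pending E \<kappa> c - {c k}"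
      using nx(1) nx(3)[of e] k(2) by (auto simp: pending_def)
  qed
  show "card (pending E \<kappa> (c(k := nx (c k)))) < card (pending E \<kappa> c)"
    unfolding eq using k(3) by (intro card_Diff1_less) auto
qed

lemma cursor_end: "c k = 0 \<Longrightarrow> e \<in> {1..E} \<Longrightarrow> \<kappa> e = k \<Longrightarrow> e \<notin> pending E \<kappa> c"
  by (auto simp: pending_def)

definition linked :: "nat \<Rightarrow> (nat \<Rightarrow> nat) \<Rightarrow> (nat \<Rightarrow> nat) \<Rightarrow> (nat \<Rightarrow> nat) \<Rightarrow> bool" where
  "linked E \<kappa> nx h \<longleftrightarrow> cursor E \<kappa> nx h \<and> pending E \<kappa> h = {1..E}"

lemma linked_0: "linked 0 \<kappa> nx (\<lambda>_. 0)"
  by (simp add: linked_def cursor_def pending_def)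

text \<open>The new edge has the largest number, so the list stays descending when it is put in
  front. The keys \<open>\<kappa>'\<close> are those of an array with one more entry and agree with
  \<open>\<kappa>\<close> on the old edges.\<close>

lemma linked_Suc:
  assumes "linked E \<kappa> nx h"
    and eq: "\<And>e. e \<in> {1..E} \<Longrightarrow> \<kappa>' e = \<kappa> e"
      and k: "\<kappa>' (Suc E) = k"
  shows "linked (Suc E) \<kappa>' (nx(Suc E := h k)) (h(k := Suc E))"
proof -
  have c: "\<And>k. h k \<le> E" "\<And>k. h k \<noteq> 0 \<Longrightarrow> \<kappa> (h k) = k"
    "\<And>e. e \<in> {1..E} \<Longrightarrow> nx e < e \<and> (nx e \<noteq> 0 \<longrightarrow> \<kappa> (nx e) = \<kappa> e) \<and>
        (\<forall>e' \<in> {1..<e}. \<kappa> e' = \<kappa> e \<longrightarrow> e' \<le> nx e)"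
    and p: "\<And>e. e \<in> {1..E} \<Longrightarrow> e \<le> h (\<kappa> e)"
    using assms(1) by (auto simp: linked_def cursor_def pending_def)
  have "cursor (Suc E) \<kappa>' (nx(Suc E := h k)) (h(k := Suc E))"
    unfolding cursor_def
  proof (intro conjI allI ballI)
    fix j
    show "(h(k := Suc E)) j \<le> Suc E"
      using c(1)[of j] by auto
    show "(h(k := Suc E)) j \<noteq> 0 \<longrightarrow> \<kappa>' ((h(k := Suc E)) j) = j"
      using c(1,2)[of j] eq[of "h j"] k by (auto simp: Suc_le_eq)
  next
    fix e
    assume e: "e \<in> {1..Suc E}"
    show "(nx(Suc E := h k)) e < e"
      using c(1)[of k] c(3)[of e] e by (auto simp: less_Suc_eq_le)
    show "(nx(Suc E := h k)) e \<noteq> 0 \<longrightarrow> \<kappa>' ((nx(Suc E := h k)) e) = \<kappa>' e"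
    proof (cases "e = Suc E")
      case True
      then show ?thesis using c(1,2)[of k] eq[of "h k"] k by (auto simp: Suc_le_eq)
    next
      case False
      then have "e \<in> {1..E}" using e by auto
      then show ?thesis using c(3)[of e] eq[of e] eq[of "nx e"] by (auto simp: Suc_le_eq)
    qed
  next
    fix e e'
    assume e: "e \<in> {1..Suc E}" "e' \<in> {1..<e}"
    show "\<kappa>' e' = \<kappa>' e \<longrightarrow> e' \<le> (nx(Suc E := h k)) e"
    proof (cases "e = Suc E")
      case True
      then show ?thesis using p[of e'] eq[of e'] k e by auto
    next
      case False
      then have "e \<in> {1..E}" using e by auto
      then show ?thesis using c(3)[of e] eq[of e] eq[of e'] e by auto
    qed
  qed
  moreover have "e \<in> pending (Suc E) \<kappa>' (h(k := Suc E))" if "e \<in> {1..Suc E}" for e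
    using that p[of e] eq[of e] k by (cases "e = Suc E") (auto simp: pending_def)
  then have "pending (Suc E) \<kappa>' (h(k := Suc E)) = {1..Suc E}"
    using pending_subset by blast
  ultimately show ?thesis
    by (simp add: linked_def)
qed

section \<open>The product of a word and an automaton\<close>

fun loop_at :: "relation \<Rightarrow> nat \<Rightarrow> nat \<Rightarrow> bool" where
  "loop_at Extension n i \<longleftrightarrow> i = 0 \<or> i = n"
| "loop_at Left_Extension n i \<longleftrightarrow> i = 0"
| "loop_at Supersequence n i \<longleftrightarrow> True"
| "loop_at _ n i \<longleftrightarrow> False"

fun start_at :: "relation \<Rightarrow> nat \<Rightarrow> bool" where
  "start_at Infix i \<longleftrightarrow> True"
| "start_at _ i \<longleftrightarrow> i = 0"

fun end_at :: "relation \<Rightarrow> nat \<Rightarrow> nat \<Rightarrow> bool" where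
  "end_at Infix n i \<longleftrightarrow> True"
| "end_at Prefix n i \<longleftrightarrow> True"
| "end_at _ n i \<longleftrightarrow> i = n"

text \<open>\<open>align x w i u j\<close>: reading \<open>u\<close> takes position \<open>i\<close> of \<open>w\<close> to position \<open>j\<close>, where symbols
  of \<open>u\<close> outside of \<open>w\<close> and symbols of \<open>w\<close> outside of \<open>u\<close> are permitted depending on \<open>x\<close>.\<close>

inductive align :: "relation \<Rightarrow> 'a list \<Rightarrow> nat \<Rightarrow> 'a list \<Rightarrow> nat \<Rightarrow> bool" for x w where
  align_Nil: "i \<le> length w \<Longrightarrow> align x w i [] i"
| align_loop: "loop_at x (length w) i \<Longrightarrow> align x w i u j \<Longrightarrow> align x w i (a # u) j"
| align_match: "i < length w \<Longrightarrow> align x w (Suc i) u j \<Longrightarrow> align x w i (w ! i # u) j"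
| align_skip: "x = Subsequence \<Longrightarrow> i < length w \<Longrightarrow> align x w (Suc i) u j \<Longrightarrow> align x w i u j"

section \<open>Alignments characterise the six relations\<close>

lemma align_bounds: "align x w i u j \<Longrightarrow> i \<le> length w \<and> j \<le> length w"
  by (induction rule: align.induct) auto

lemma align_factor: "i + length u \<le> length w \<Longrightarrow> take (length u) (drop i w) = u \<Longrightarrow> align x w i u (i + length u)"
proof (induction u arbitrary: i)
  case Nil
  then show ?case by (auto intro: align.intros)
next
  case (Cons a u)
  then have "i < length w" by simp
  then have d: "drop i w = w ! i # drop (Suc i) w"
    by (simp add: Cons_nth_drop_Suc)
  with Cons.prems have a: "a = w ! i" and "take (length u) (drop (Suc i) w) = u"
    by auto
  with Cons.prems have "align x w (Suc i) u (Suc i + length u)"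
    by (intro Cons.IH) auto
  then show ?case
    using align_match[OF \<open>i < length w\<close>] a by force
qed

lemma align_drop: "i \<le> length w \<Longrightarrow> align x w i (drop i w) (length w)"
  using align_factor[of i "drop i w" w x] by simp

lemma align_loops: "loop_at x (length w) i \<Longrightarrow> align x w i u j \<Longrightarrow> align x w i (v @ u) j"
  by (induction v) (auto intro: align.intros)

lemma align_drop_append:
  assumes "i \<le> length w" "loop_at x (length w) (length w)"
  shows "align x w i (drop i w @ v) (length w)"
  using assms
proof (induction "length w - i" arbitrary: i)
  case 0
  then show ?case
    using align_loops[of x w i "[]" "length w" v] by (auto intro: align.intros)
next
  case (Suc k)
  then have "i < length w" by simp
  moreover have "align x w (Suc i) (drop (Suc i) w @ v) (length w)"
    using Suc by (intro Suc.hyps) auto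
  ultimately have "align x w i (w ! i # (drop (Suc i) w @ v)) (length w)"
    by (rule align_match)
  then show ?case
    using Cons_nth_drop_Suc[OF \<open>i < length w\<close>] by (metis append_Cons)
qed

lemma align_factorD:
  "align x w i u j \<Longrightarrow> x \<in> {Infix, Prefix} \<Longrightarrow> drop i w = u @ drop j w"
proof (induction rule: align.induct)
  case (align_match i u j)
  then show ?case using Cons_nth_drop_Suc[of i w] by simp
qed auto

lemma align_SubsequenceD: "align x w i u j \<Longrightarrow> x = Subsequence \<Longrightarrow> subseq u (drop i w)"
proof (induction rule: align.induct)
  case (align_match i u j)
  then show ?case using Cons_nth_drop_Suc[of i w] by (metis subseq_Cons2)
next
  case (align_skip i u j)
  then show ?case using Cons_nth_drop_Suc[of i w] by (metis list_emb_Cons)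
qed auto

text \<open>Every symbol of \<open>w\<close> that is not taken for \<open>u\<close> is skipped,
  including the tail, so that the alignment ends at \<open>length w\<close>.\<close>

lemma align_SubsequenceI:
  "subseq u (drop i w) \<Longrightarrow> i \<le> length w \<Longrightarrow> align Subsequence w i u (length w)"
proof (induction "length w - i" arbitrary: i u)
  case 0
  then have "i = length w" "u = []" by auto
  then show ?case by (simp add: align_Nil)
next
  case (Suc k)
  then have i: "i < length w" by simp
  then have d: "drop i w = w ! i # drop (Suc i) w"
    by (simp add: Cons_nth_drop_Suc)
  show ?case
  proof (cases "\<exists>u'. u = w ! i # u' \<and> subseq u' (drop (Suc i) w)")
    case True
    then obtain u' where u: "u = w ! i # u'" "subseq u' (drop (Suc i) w)" by blast
    then have "align Subsequence w (Suc i) u' (length w)"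
      using Suc.hyps(2) i by (intro Suc.hyps(1)) auto
    then show ?thesis unfolding u(1) by (rule align_match[OF i])
  next
    case False
    then have "subseq u (drop (Suc i) w)"
      using Suc.prems(1) unfolding d by (cases u) (auto split: if_splits)
    then have "align Subsequence w (Suc i) u (length w)"
      using Suc.hyps(2) i by (intro Suc.hyps(1)) auto
    then show ?thesis by (rule align_skip[OF refl i])
  qed
qed

lemma align_SupersequenceD:
  "align x w i u j \<Longrightarrow> x = Supersequence \<Longrightarrow> j = length w \<Longrightarrow> subseq (drop i w) u"
proof (induction rule: align.induct)
  case (align_match i u j)
  then show ?case using Cons_nth_drop_Suc[of i w] by (metis subseq_Cons2)
qed auto

lemma align_SupersequenceI:
  "subseq (drop i w) u \<Longrightarrow> i \<le> length w \<Longrightarrow> align Supersequence w i u (length w)"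
proof (induction u arbitrary: i)
  case Nil
  then have "i = length w"
    using list_emb_Nil2 by fastforce
  then show ?case by (simp add: align_Nil)
next
  case (Cons a u)
  show ?case
  proof (cases "subseq (drop i w) u")
    case True
    with Cons show ?thesis by (auto intro: align_loop)
  next
    case False
    then have i: "i < length w"
      by (metis drop_all list_emb_Nil not_le_imp_less)
    then have d: "drop i w = w ! i # drop (Suc i) w"
      by (simp add: Cons_nth_drop_Suc)
    with False Cons.prems have a: "a = w ! i" "subseq (drop (Suc i) w) u"
      by (auto split: if_splits)
    then have "align Supersequence w (Suc i) u (length w)"
      using i by (intro Cons.IH) auto
    then show ?thesis unfolding a(1) by (rule align_match[OF i])
  qed
qed

text \<open>Loops occur at position \<open>0\<close> only, so behind it the rest of \<open>u\<close>
  is determined. The matching step from position \<open>0\<close> to \<open>1\<close> relies on this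
  stronger claim for \<open>0 < i\<close>.\<close>

lemma align_Left_ExtensionD:
  "align x w i u j \<Longrightarrow> x = Left_Extension \<Longrightarrow> j = length w \<Longrightarrow>
   suffix (drop i w) u \<and> (0 < i \<longrightarrow> u = drop i w)"
proof (induction rule: align.induct)
  case (align_match i u j)
  then show ?case using Cons_nth_drop_Suc[of i w] by auto
qed (auto intro: suffix_ConsI)

text \<open>Once a symbol has been matched, no symbol can be inserted until \<open>w\<close> is
  finished. This is why the claim is strengthened to a prefix for \<open>0 < i\<close>; at
  \<open>i = length w\<close> the prefix is empty.\<close>

lemma align_ExtensionD:
  "align x w i u j \<Longrightarrow> x = Extension \<Longrightarrow> j = length w \<Longrightarrow>
   sublist (drop i w) u \<and> (0 < i \<longrightarrow> prefix (drop i w) u)"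
proof (induction rule: align.induct)
  case (align_match i u j)
  then have "prefix (drop i w) (w ! i # u)"
    using Cons_nth_drop_Suc[of i w] by (metis Cons_prefix_Cons zero_less_Suc)
  then show ?case
    using prefix_imp_sublist by blast
next
  case (align_loop i u j a)
  then show ?case by (auto intro: sublist_Cons_right[THEN iffD2])
qed auto

theorem related_iff_align:
  "related x u w \<longleftrightarrow> (\<exists>i j. start_at x i \<and> end_at x (length w) j \<and> align x w i u j)"
proof (cases x)
  case Infix
  show ?thesis
  proof
    assume "related x u w"
    then obtain ps ss where "w = ps @ u @ ss"
      using Infix by (auto simp: sublist_def)
    then show "\<exists>i j. start_at x i \<and> end_at x (length w) j \<and> align x w i u j"
      using Infix align_factor[of "length ps" u w x] by auto
  next
    assume "\<exists>i j. start_at x i \<and> end_at x (length w) j \<and> align x w i u j"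
    then obtain i j where "drop i w = u @ drop j w"
      using Infix align_factorD[of x w _ u] by blast
    then show "related x u w"
      using Infix by (metis append_take_drop_id related.simps(1) sublist_appendI)
  qed
next
  case Prefix
  show ?thesis
  proof
    assume "related x u w"
    then obtain ss where "w = u @ ss"
      using Prefix by (auto simp: prefix_def)
    then show "\<exists>i j. start_at x i \<and> end_at x (length w) j \<and> align x w i u j"
      using Prefix align_factor[of 0 u w x] by auto
  next
    assume "\<exists>i j. start_at x i \<and> end_at x (length w) j \<and> align x w i u j"
    then obtain j where "drop 0 w = u @ drop j w"
      using Prefix align_factorD[of x w 0 u] by auto
    then show "related x u w"
      using Prefix by (metis drop0 prefixI related.simps(2))
  qed
next
  case Extension
  show ?thesis
  proof
    assume "related x u w"
    then obtain ps ss where "u = ps @ w @ ss"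
      using Extension by (auto simp: sublist_def)
    then have "align x w 0 u (length w)"
      using Extension align_drop_append[of 0 w x ss] align_loops[of x w 0 "w @ ss" _ ps] by auto
    then show "\<exists>i j. start_at x i \<and> end_at x (length w) j \<and> align x w i u j"
      using Extension by auto
  next
    assume "\<exists>i j. start_at x i \<and> end_at x (length w) j \<and> align x w i u j"
    then show "related x u w"
      using Extension align_ExtensionD[of x w 0 u] by auto
  qed
next
  case Left_Extension
  show ?thesis
  proof
    assume "related x u w"
    then obtain ps where "u = ps @ w"
      using Left_Extension by (auto simp: suffix_def)
    then have "align x w 0 u (length w)"
      using Left_Extension align_drop[of 0 w x] align_loops[of x w 0 w _ ps] by auto
    then show "\<exists>i j. start_at x i \<and> end_at x (length w) j \<and> align x w i u j"
      using Left_Extension by auto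
  next
    assume "\<exists>i j. start_at x i \<and> end_at x (length w) j \<and> align x w i u j"
    then show "related x u w"
      using Left_Extension align_Left_ExtensionD[of x w 0 u] by auto
  qed
next
  case Subsequence
  then show ?thesis
    using align_SubsequenceD[of x w 0 u] align_SubsequenceI[of u 0 w] by auto
next
  case Supersequence
  then show ?thesis
    using align_SupersequenceD[of x w 0 u] align_SupersequenceI[of 0 w u] by auto
qed

subsection \<open>Automaton paths\<close>

lemma enfa_path_states: "enfa A \<Longrightarrow> enfa_path A p ls q \<Longrightarrow> p \<in> states A \<and> q \<in> states A"
  by (rotate_tac, induction rule: enfa_path.induct) (auto simp: enfa_def)

definition erase :: "'a option list \<Rightarrow> 'a list" where
  "erase = List.map_filter id"

lemma erase_simps:
  "erase [] = []" "erase (None # ls) = erase ls" "erase (Some a # ls) = a # erase ls"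
  by (simp_all add: erase_def map_filter_simps)

lemma enfa_lang_erase: "enfa_lang A = {erase ls | ls. enfa_path A (initial A) ls (accepting A)}"
  by (simp add: enfa_lang_def erase_def)

text \<open>Alignments proceed symbol by symbol, while a path interleaves empty transitions. Cutting
  the path at its first nonempty label brings the two into step.\<close>

lemma enfa_path_split:
  assumes "enfa_path A p ls q" "enfa A" "erase ls = a # u"
  shows "\<exists>ls1 p1 p2 ls2. enfa_path A p ls1 p1 \<and> erase ls1 = [] \<and>
    (p1, Some a, p2) \<in> transitions A \<and> enfa_path A p2 ls2 q \<and> erase ls2 = u"
  using assms
proof (induction rule: enfa_path.induct)
  case (path_Nil p)
  then show ?case by (simp add: erase_simps)
next
  case (path_Cons p l q' ls r)
  show ?case
  proof (cases l)
    case None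
    then have "erase ls = a # u"
      using path_Cons.prems by (simp add: erase_simps)
    with path_Cons.IH path_Cons.prems(1)
      obtain ls1 p1 p2 ls2 where *: "enfa_path A q' ls1 p1" "erase ls1 = []"
      "(p1, Some a, p2) \<in> transitions A" "enfa_path A p2 ls2 r" "erase ls2 = u"
      by blast
    then have "enfa_path A p (l # ls1) p1" "erase (l # ls1) = []"
      using path_Cons.hyps None by (auto intro: enfa_path.intros simp: erase_simps)
    with * show ?thesis by blast
  next
    case (Some a')
    then have *: "a' = a" "erase ls = u"
      using path_Cons.prems by (auto simp: erase_simps)
    have "enfa_path A p [] p"
      using path_Cons.hyps(1) path_Cons.prems(1) by (auto intro: enfa_path.intros simp: enfa_def)
    with * Some path_Cons.hyps show ?thesis
      by (metis erase_simps(1))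
  qed
qed

subsection \<open>The product graph\<close>

type_synonym edge = "nat \<times> nat \<times> nat"

text \<open>The product is described as a set of triples, independent of the numbering that the
  edges receive in memory; this is the matching notion of walk.\<close>

inductive twalk :: "edge set \<Rightarrow> nat \<Rightarrow> nat list \<Rightarrow> nat \<Rightarrow> bool" for G where
  twalk_Nil: "twalk G u [] u"
| twalk_Cons: "(u, l, v') \<in> G \<Longrightarrow> twalk G v' xs v \<Longrightarrow> twalk G u (lword l @ xs) v"

lemma twalk_append: "twalk G u xs v \<Longrightarrow> twalk G v ys z \<Longrightarrow> twalk G u (xs @ ys) z"
  by (induction rule: twalk.induct) (auto intro: twalk.intros)

lemma twalk_edge: "(u, l, v) \<in> G \<Longrightarrow> twalk G u (lword l) v"
  using twalk_Cons[OF _ twalk_Nil] by auto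

definition (in labelled_graph) edge_set :: "edge set" where
  "edge_set = (\<lambda>e. (src e, lab e, dst e)) ` {1..E}"

lemma (in labelled_graph) walk_iff_twalk: "walk u xs v \<longleftrightarrow> twalk edge_set u xs v"
proof
  show "walk u xs v \<Longrightarrow> twalk edge_set u xs v"
  proof (induction rule: walk.induct)
    case (walk_Cons e u xs v)
    then have "(u, lab e, dst e) \<in> edge_set"
      unfolding edge_set_def by auto
    with walk_Cons show ?case by (auto intro: twalk_Cons)
  qed (rule twalk_Nil)
  show "twalk edge_set u xs v \<Longrightarrow> walk u xs v"
    by (induction rule: twalk.induct) (auto intro: walk.intros simp: edge_set_def)
qed

text \<open>Layer \<open>i\<close> holds the nodes \<open>i * Q + q\<close> for the states \<open>q < Q\<close>. The source \<open>(n + 1) * Q\<close> and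
  the target \<open>(n + 1) * Q + 1\<close> follow the layers \<open>0, \<dots>, n\<close>.\<close>

definition step_edges :: "relation \<Rightarrow> nat list \<Rightarrow> nat \<Rightarrow> nat \<Rightarrow> nat \<times> nat option \<times> nat \<Rightarrow> edge set" where
  "step_edges x w Q i = (\<lambda>(p, l, q).
     {e. e = (i * Q + p, label_word l, i * Q + q) \<and> (l = None \<or> loop_at x (length w) i)} \<union>
     {e. e = (i * Q + p, label_word l, Suc i * Q + q) \<and> i < length w \<and> l = Some (w ! i)})"

definition boundary_edges :: "relation \<Rightarrow> nat \<Rightarrow> nat \<Rightarrow> nat \<Rightarrow> nat \<Rightarrow> nat \<Rightarrow> edge set" where
  "boundary_edges x n Q q0 qf i =
     {e. e = (Suc n * Q, 0, i * Q + q0) \<and> start_at x i} \<union>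
     {e. e = (i * Q + qf, 0, Suc n * Q + 1) \<and> end_at x n i}"

text \<open>As \<open>u + Q\<close> is the same state as \<open>u\<close> in the next layer, the
  skip edges are given by a range of node numbers and can be produced without regard to layers and
  states.\<close>

definition skip_edges :: "relation \<Rightarrow> nat \<Rightarrow> nat \<Rightarrow> edge set" where
  "skip_edges x n Q = {(u, 0, u + Q) | u. x = Subsequence \<and> u < n * Q}"

definition product_edges :: "relation \<Rightarrow> nat list \<Rightarrow> nat \<Rightarrow> (nat, nat) enfa \<Rightarrow> edge set" where
  "product_edges x w Q A =
     (\<Union>i \<le> length w. (\<Union>t \<in> transitions A. step_edges x w Q i t) \<union>
        boundary_edges x (length w) Q (initial A) (accepting A) i) \<union>
     skip_edges x (length w) Q"

lemma node_eq_iff: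
  fixes Q :: nat
  assumes "p < Q" "p' < Q"
  shows "i * Q + p = i' * Q + p' \<longleftrightarrow> i = i' \<and> p = p'"
proof
  assume "i * Q + p = i' * Q + p'"
  then have "(i * Q + p) div Q = (i' * Q + p') div Q" "(i * Q + p) mod Q = (i' * Q + p') mod Q"
    by simp_all
  then show "i = i' \<and> p = p'"
    using assms by simp
qed simp

lemma node_less:
  fixes Q :: nat
  assumes "p < Q" "i \<le> n"
  shows "i * Q + p < Suc n * Q"
proof -
  have "i * Q + p < Suc i * Q"
    using assms by simp
  also have "\<dots> \<le> Suc n * Q"
    using assms by (intro mult_right_mono) auto
  finally show ?thesis .
qed

section \<open>Walks of the product graph and matches\<close>

context
  fixes A :: "(nat, nat) enfa" and w :: "nat list" and x :: relation and Q :: nat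
  assumes A: "enfa A" and states: "states A = {..<Q}"
begin

abbreviation (input) product_graph where "product_graph \<equiv> product_edges x w Q A"
abbreviation (input) word_length where "word_length \<equiv> length w"

lemma transition_states:
  "(p, l, q) \<in> transitions A \<Longrightarrow> p < Q \<and> q < Q"
  using A states by (auto simp: enfa_def)

lemma initial_accepting: "initial A < Q" "accepting A < Q"
  using A states by (auto simp: enfa_def)

lemma product_edge_cases:
  assumes "(u, l, v) \<in> product_graph"
  obtains (step) p a q i where "(p, a, q) \<in> transitions A" "i \<le> word_length" "u = i * Q + p"
    "v = i * Q + q"
      "l = label_word a" "a = None \<or> loop_at x word_length i"
    | (match) p q i where "(p, Some (w ! i), q) \<in> transitions A" "i < word_length" "u = i * Q + p"
      "v = Suc i * Q + q" "l = Suc (w ! i)"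
    | (source) i where "i \<le> word_length" "start_at x i" "u = Suc word_length * Q" "l = 0"
      "v = i * Q + initial A"
    | (target) i where "i \<le> word_length" "end_at x word_length i" "u = i * Q + accepting A" "l = 0"
      "v = Suc word_length * Q + 1"
    | (skip) i p where "i < word_length" "p < Q" "x = Subsequence" "u = i * Q + p" "l = 0" "v = Suc i * Q + p"
proof -
  from assms consider
      (a) i p a q where "i \<le> word_length" "(p, a, q) \<in> transitions A"
        "(u, l, v) \<in> step_edges x w Q i (p, a, q)"
    | (b) i where "i \<le> word_length"
      "(u, l, v) \<in> boundary_edges x word_length Q (initial A) (accepting A) i"
    | (c) "(u, l, v) \<in> skip_edges x word_length Q"
    unfolding product_edges_def by auto
  then show thesis
  proof cases
    case a
    then show thesis
      using step[OF a(2,1)] match[of p i q] by (auto simp: step_edges_def)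
  next
    case b
    then show thesis
      using source[of i] target[of i] by (auto simp: boundary_edges_def)
  next
    case c
    then have u: "x = Subsequence" "u < word_length * Q" "l = 0" "v = u + Q"
      by (auto simp: skip_edges_def)
    then have "0 < Q" by (cases Q) auto
    then have "u div Q < word_length" "u mod Q < Q" "u = u div Q * Q + u mod Q"
      using u by (auto simp: less_mult_imp_div_less)
    with u skip[of "u div Q" "u mod Q"] show thesis
      by (metis add.assoc add.commute mult_Suc)
  qed
qed

lemma product_edge_layer:
  assumes "(i * Q + p, l, v) \<in> product_graph" "i \<le> word_length" "p < Q"
  shows "(\<exists>a q. (p, a, q) \<in> transitions A \<and> v = i * Q + q \<and> l = label_word a \<and> (a = None \<or> loop_at x word_length i)) \<or>
    (\<exists>q. (p, Some (w ! i), q) \<in> transitions A \<and> i < word_length \<and> v = Suc i * Q + q \<and> l = Suc (w ! i)) \<or>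
    (end_at x word_length i \<and> p = accepting A \<and> l = 0 \<and> v = Suc word_length * Q + 1) \<or>
    (i < word_length \<and> x = Subsequence \<and> l = 0 \<and> v = Suc i * Q + p)"
  using assms(1)
proof (cases rule: product_edge_cases)
  case (step p' a q i')
  then have "i' = i" "p' = p" using node_eq_iff[of p Q p'] transition_states assms by auto
  with step show ?thesis by auto
next
  case (match p' q i')
  then have "i' = i" "p' = p" using node_eq_iff[of p Q p'] transition_states assms by auto
  with match show ?thesis by auto
next
  case (source i')
  then show ?thesis using node_less[OF assms(3,2)] by auto
next
  case (target i')
  then have "i' = i" "p = accepting A" using node_eq_iff[of p Q] initial_accepting assms by auto
  with target show ?thesis by auto
next
  case (skip i' p')
  then have "i' = i" "p' = p" using node_eq_iff[of p Q p'] assms by auto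
  with skip show ?thesis by auto
qed

text \<open>Every edge starts at a node with a number below that of the target.\<close>

lemma twalk_target: "twalk product_graph u xs v \<Longrightarrow> u = Suc word_length * Q + 1 \<Longrightarrow> xs = [] \<and> v = u"
proof (induction rule: twalk.induct)
  case (twalk_Cons u l v' xs v)
  from twalk_Cons(1) have "u < Suc word_length * Q + 1"
  proof (cases rule: product_edge_cases)
    case (step p a q i) then show ?thesis
      using node_less[of p Q i word_length] transition_states[OF step(1)] by auto
  next
    case (match p q i) then show ?thesis
      using node_less[of p Q i word_length] transition_states[OF match(1)] by auto
  next
    case (target i) then show ?thesis
      using node_less[of "accepting A" Q i word_length] initial_accepting by auto
  next
    case (skip i p) then show ?thesis
      using node_less[of p Q i word_length] by auto
  qed auto
  with twalk_Cons show ?case by simp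
qed simp

text \<open>Path and alignment are built from the first edge of the walk on: an empty transition
  advances only the path, a skip edge only the alignment, and an edge with a symbol both.\<close>

lemma twalk_layer:
  "twalk product_graph u xs v \<Longrightarrow> v = Suc word_length * Q + 1 \<Longrightarrow> i \<le> word_length \<Longrightarrow> p < Q \<Longrightarrow> u = i * Q + p \<Longrightarrow>
   \<exists>ls j. enfa_path A p ls (accepting A) \<and> xs = map Suc (erase ls) \<and>
     align x w i (erase ls) j \<and> end_at x word_length j"
proof (induction arbitrary: i p rule: twalk.induct)
  case (twalk_Nil u)
  then show ?case using node_less[of p Q i word_length] by simp
next
  case (twalk_Cons u l v' xs v)
  from twalk_Cons.hyps(1) twalk_Cons.prems have
    "(i * Q + p, l, v') \<in> product_graph" by simp
  from product_edge_layer[OF this twalk_Cons.prems(2,3)] consider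
      (step) a q where "(p, a, q) \<in> transitions A" "v' = i * Q + q" "l = label_word a"
        "a = None \<or> loop_at x word_length i"
    | (match) q where "(p, Some (w ! i), q) \<in> transitions A" "i < word_length" "v' = Suc i * Q + q"
        "l = Suc (w ! i)"
    | (target) "end_at x word_length i" "p = accepting A" "l = 0" "v' = Suc word_length * Q + 1"
    | (skip) "i < word_length" "x = Subsequence" "l = 0" "v' = Suc i * Q + p"
    by blast
  then show ?case
  proof cases
    case a: (step a q)
    with twalk_Cons.IH[of i q] twalk_Cons.prems transition_states[of p a q] obtain ls j where
      ls: "enfa_path A q ls (accepting A)" "xs = map Suc (erase ls)"
        "align x w i (erase ls) j" "end_at x word_length j" by auto
    have "enfa_path A p (a # ls) (accepting A)"
      using a ls by (auto intro: enfa_path.intros)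
    moreover have "lword l @ xs = map Suc (erase (a # ls))"
      using a ls by (cases a) (auto simp: erase_simps lword_def)
    moreover have "align x w i (erase (a # ls)) j"
      using a ls by (cases a) (auto simp: erase_simps intro: align_loop)
    ultimately show ?thesis using ls by blast
  next
    case a: (match q)
    with twalk_Cons.IH[of "Suc i" q] twalk_Cons.prems transition_states[of p "Some (w ! i)" q]
      obtain ls j where
      ls: "enfa_path A q ls (accepting A)" "xs = map Suc (erase ls)"
        "align x w (Suc i) (erase ls) j" "end_at x word_length j" by auto
    have "enfa_path A p (Some (w ! i) # ls) (accepting A)"
      using a ls by (auto intro: enfa_path.intros)
    moreover have "lword l @ xs = map Suc (erase (Some (w ! i) # ls))"
      using a ls by (auto simp: erase_simps lword_def)
    moreover have "align x w i (erase (Some (w ! i) # ls)) j"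
      using a ls by (auto simp: erase_simps intro: align_match)
    ultimately show ?thesis using ls by blast
  next
    case a: target
    then have "xs = []" using twalk_target[OF twalk_Cons.hyps(2)] by simp
    moreover have "enfa_path A p [] p" using twalk_Cons.prems states by (auto intro: enfa_path.intros)
    ultimately show ?thesis
      using a twalk_Cons.prems align_Nil[of i w x]
        by (auto simp: lword_def erase_simps intro!: exI[of _ "[]"] exI[of _ i])
  next
    case a: skip
    with twalk_Cons.IH[of "Suc i" p] twalk_Cons.prems obtain ls j where
      ls: "enfa_path A p ls (accepting A)" "xs = map Suc (erase ls)"
        "align x w (Suc i) (erase ls) j" "end_at x word_length j" by auto
    then have "align x w i (erase ls) j" using a align_skip by blast
    with ls a show ?thesis by (auto simp: lword_def)
  qed
qed

lemma step_edges_subset: "t \<in> transitions A \<Longrightarrow> i \<le> word_length \<Longrightarrow> step_edges x w Q i t \<subseteq> product_graph"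
  unfolding product_edges_def by blast

lemma step_edge:
  assumes "(p, a, q) \<in> transitions A" "i \<le> word_length" "a = None \<or> loop_at x word_length i"
  shows "(i * Q + p, label_word a, i * Q + q) \<in> product_graph"
  using step_edges_subset[OF assms(1,2)] assms(3) by (auto simp: step_edges_def)

lemma match_edge:
  assumes "(p, Some (w ! i), q) \<in> transitions A" "i < word_length"
  shows "(i * Q + p, Suc (w ! i), Suc i * Q + q) \<in> product_graph"
  using step_edges_subset[OF assms(1), of i] assms(2) by (auto simp: step_edges_def)

lemma boundary_edges_subset:
  "i \<le> word_length \<Longrightarrow> boundary_edges x word_length Q (initial A) (accepting A) i \<subseteq> product_graph"
  unfolding product_edges_def by blast

lemma source_edge:
  assumes "start_at x i" "i \<le> word_length"
  shows "(Suc word_length * Q, 0, i * Q + initial A) \<in> product_graph"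
  using boundary_edges_subset[OF assms(2)] assms(1) by (auto simp: boundary_edges_def)

lemma target_edge:
  assumes "end_at x word_length i" "i \<le> word_length"
  shows "(i * Q + accepting A, 0, Suc word_length * Q + 1) \<in> product_graph"
  using boundary_edges_subset[OF assms(2)] assms(1) by (auto simp: boundary_edges_def)

lemma twalk_eps:
  "enfa_path A p ls q \<Longrightarrow> erase ls = [] \<Longrightarrow> i \<le> word_length \<Longrightarrow> twalk product_graph (i * Q + p) [] (i * Q + q)"
proof (induction rule: enfa_path.induct)
  case (path_Nil p)
  then show ?case by (simp add: twalk_Nil)
next
  case (path_Cons p l q ls r)
  then have "l = None" by (cases l) (auto simp: erase_simps)
  then have "twalk product_graph (i * Q + q) [] (i * Q + r)" "(i * Q + p, 0, i * Q + q) \<in> product_graph"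
    using path_Cons step_edge[of p l q i] by (auto simp: erase_simps)
  then show ?case using twalk_Cons[of _ 0] by (force simp: lword_def)
qed

text \<open>The path is generalised in the induction, because each symbol of the alignment consumes
  a whole block of transitions, as provided by \<open>enfa_path_split\<close>.\<close>

lemma align_twalk:
  "align x w i u j \<Longrightarrow> enfa_path A p ls q \<Longrightarrow> erase ls = u \<Longrightarrow>
   twalk product_graph (i * Q + p) (map Suc u) (j * Q + q)"
proof (induction arbitrary: p ls rule: align.induct)
  case (align_Nil i)
  then show ?case using twalk_eps by simp
next
  case (align_loop i u j a)
  from enfa_path_split[OF align_loop.prems(1) A align_loop.prems(2)]
  obtain ls1 p1 p2 ls2 where *: "enfa_path A p ls1 p1" "erase ls1 = []"
    "(p1, Some a, p2) \<in> transitions A" "enfa_path A p2 ls2 q" "erase ls2 = u"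
    by blast
  have i: "i \<le> word_length" using align_bounds align_loop.hyps by blast
  have "twalk product_graph (i * Q + p) ([] @ (lword (Suc a) @ map Suc u)) (j * Q + q)"
    using twalk_eps[OF *(1,2) i] step_edge[OF *(3) i] align_loop.IH[OF *(4,5)] align_loop.hyps(1)
    by (intro twalk_append[OF _ twalk_Cons]) auto
  then show ?case by (simp add: lword_def)
next
  case (align_match i u j)
  from enfa_path_split[OF align_match.prems(1) A align_match.prems(2)]
  obtain ls1 p1 p2 ls2 where *: "enfa_path A p ls1 p1" "erase ls1 = []"
    "(p1, Some (w ! i), p2) \<in> transitions A" "enfa_path A p2 ls2 q" "erase ls2 = u"
    by blast
  have i: "i \<le> word_length" using align_match.hyps by simp
  have "twalk product_graph (i * Q + p) ([] @ (lword (Suc (w ! i)) @ map Suc u)) (j * Q + q)"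
    by (rule twalk_append[OF twalk_eps[OF *(1,2) i] twalk_Cons[OF match_edge[OF *(3) align_match.hyps(1)]]])
      (rule align_match.IH[OF *(4,5)])
  then show ?case by (simp add: lword_def)
next
  case (align_skip i u j)
  have "p < Q" using enfa_path_states[OF A align_skip.prems(1)] states by simp
  then have "i * Q + p < Suc (i) * Q" by simp
  also have "\<dots> \<le> word_length * Q" using align_skip.hyps by (intro mult_right_mono) auto
  finally have "(i * Q + p, 0, i * Q + p + Q) \<in> product_graph"
    using align_skip.hyps unfolding product_edges_def skip_edges_def by blast
  then have "twalk product_graph (i * Q + p) [] (Suc i * Q + p)"
    using twalk_edge[of _ 0] by (simp add: lword_def algebra_simps)
  from twalk_append[OF this align_skip.IH[OF align_skip.prems]] show ?case by simp
qed

text \<open>The \<open>Suc\<close> stems from \<open>label_word\<close>, which reserves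
  \<open>0\<close> for the empty label.\<close>

theorem product_language:
  "twalk product_graph (Suc word_length * Q) xs (Suc word_length * Q + 1) \<longleftrightarrow> xs \<in> map Suc ` matches x w A"
proof
  assume "twalk product_graph (Suc word_length * Q) xs (Suc word_length * Q + 1)"
  then show "xs \<in> map Suc ` matches x w A"
  proof (cases rule: twalk.cases)
    case (twalk_Cons l v' ys)
    from twalk_Cons(2) have "\<exists>i \<le> word_length. start_at x i \<and> l = 0 \<and> v' = i * Q + initial A"
    proof (cases rule: product_edge_cases)
      case (step p a q i) then show ?thesis
        using node_less[of p Q i word_length] transition_states[of p a q] by auto
    next
      case (match p q i) then show ?thesis
        using node_less[of p Q i word_length] transition_states[OF match(1)] by auto
    next
      case (target i) then show ?thesis
        using node_less[of "accepting A" Q i word_length] initial_accepting by auto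
    next
      case (skip i p) then show ?thesis
        using node_less[of p Q i word_length] by auto
    qed auto
    then obtain i where i: "i \<le> word_length" "start_at x i" "l = 0" "v' = i * Q + initial A" by blast
    from twalk_layer[OF twalk_Cons(3) refl i(1) initial_accepting(1) i(4)] obtain ls j where
      "enfa_path A (initial A) ls (accepting A)" "ys = map Suc (erase ls)"
      "align x w i (erase ls) j" "end_at x word_length j" by blast
    then show ?thesis
      using i twalk_Cons(1) unfolding matches_def related_iff_align enfa_lang_erase
      by (auto simp: lword_def)
  qed simp
next
  assume "xs \<in> map Suc ` matches x w A"
  then obtain ls i j where *: "xs = map Suc (erase ls)" "start_at x i" "end_at x word_length j"
    "align x w i (erase ls) j" "enfa_path A (initial A) ls (accepting A)"
    unfolding matches_def related_iff_align enfa_lang_erase by auto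
  have ij: "i \<le> word_length" "j \<le> word_length" using align_bounds[OF *(4)] by auto
  have "twalk product_graph (Suc word_length * Q) (lword 0 @ xs @ lword 0) (Suc word_length * Q + 1)"
    using twalk_edge[OF source_edge[OF *(2) ij(1)]] twalk_edge[OF target_edge[OF *(3) ij(2)]]
      align_twalk[OF *(4,5) refl] *(1) by (blast intro: twalk_append)
  then show "twalk product_graph (Suc word_length * Q) xs (Suc word_length * Q + 1)"
    by (simp add: lword_def)
qed

end

section \<open>Shortest paths\<close>

text \<open>A breadth-first search with a single queue \<open>qs\<close>, in which the edges with empty label are
  followed from position \<open>a\<close> and the others from position \<open>b\<close>. The latter wait until
  \<open>a\<close> has reached the end of the queue, so that nodes enter the queue in the order of their
  distance \<open>D\<close>.\<close>

context labelled_graph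
begin

text \<open>Each node owns two lists, the empty edges under an even key and the others under an odd
  one. Thus the positions \<open>a\<close> and \<open>b\<close> of the queue have cursors of their
  own.\<close>

definition bfs_key :: "nat \<Rightarrow> nat" where
  "bfs_key e = 2 * src e + of_bool (lab e \<noteq> 0)"

definition wt :: "nat \<Rightarrow> nat" where
  "wt e = of_bool (lab e \<noteq> 0)"

lemma length_lword_lab: "length (lword (lab e)) = wt e"
  by (simp add: lword_def wt_def)

text \<open>By the order conditions all entries from \<open>a\<close> on have the maximal distance,
  and no entry exceeds that at \<open>b\<close> by more than one. \<open>D\<close> is stored in no
  array and is never lowered: a scanned edge is relaxed once and for all.\<close>

definition bfs_inv ::
  "(nat \<Rightarrow> nat) \<Rightarrow> nat \<Rightarrow> nat list \<Rightarrow> nat \<Rightarrow> nat \<Rightarrow> (nat \<Rightarrow> nat) \<Rightarrow> (nat \<Rightarrow> nat) \<Rightarrow> (nat \<Rightarrow> nat) \<Rightarrow> bool" where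
  "bfs_inv nx s qs a b c par D \<longleftrightarrow>
     cursor E bfs_key nx c \<and>
     distinct qs \<and> 0 < length qs \<and> qs ! 0 = s \<and> D s = 0 \<and> par s = 0 \<and>
     b \<le> a \<and> a \<le> length qs \<and>
     (\<forall>j < length qs. \<forall>i \<le> j. D (qs ! i) \<le> D (qs ! j)) \<and>
     (a < length qs \<longrightarrow> (\<forall>i < length qs. D (qs ! i) \<le> D (qs ! a))) \<and>
     (b < length qs \<longrightarrow> (\<forall>i < length qs. D (qs ! i) \<le> Suc (D (qs ! b)))) \<and>
     (\<forall>j < length qs. 0 < j \<longrightarrow>
        par (qs ! j) \<in> {1..E} \<and> dst (par (qs ! j)) = qs ! j \<and> 
        (\<exists>i < j. qs ! i = src (par (qs ! j))) \<and>
        D (qs ! j) = D (src (par (qs ! j))) + wt (par (qs ! j))) \<and>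
     (\<forall>e \<in> {1..E}. e \<notin> pending E bfs_key c \<longrightarrow>
        src e \<in> set qs \<and> dst e \<in> set qs \<and> D (dst e) \<le> D (src e) + wt e) \<and>
     (\<forall>j < a. c (2 * qs ! j) = 0) \<and> (\<forall>j < b. c (Suc (2 * qs ! j)) = 0)"

lemma bfs_init:
  assumes "linked E bfs_key nx c"
  shows "bfs_inv nx s [s] 0 0 c (\<lambda>_. 0) (\<lambda>_. 0)"
  using assms by (auto simp: bfs_inv_def linked_def)

lemma bfs_advance_a:
  assumes "bfs_inv nx s qs a b c par D" "a < length qs" "c (2 * qs ! a) = 0"
  shows "bfs_inv nx s qs (Suc a) b c par D"
  unfolding bfs_inv_def
proof (intro conjI)
  show "Suc a < length qs \<longrightarrow> (\<forall>i<length qs. D (qs ! i) \<le> D (qs ! Suc a))"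
    using assms unfolding bfs_inv_def by (meson Suc_lessD le_Suc_eq order_refl order_trans)
  show "\<forall>j < Suc a. c (2 * qs ! j) = 0"
    using assms by (auto simp: bfs_inv_def less_Suc_eq)
qed (use assms in \<open>auto simp: bfs_inv_def\<close>)

lemma bfs_advance_b:
  assumes "bfs_inv nx s qs a b c par D" "a = length qs" "b < length qs" "c (Suc (2 * qs ! b)) = 0"
  shows "bfs_inv nx s qs a (Suc b) c par D"
  unfolding bfs_inv_def
proof (intro conjI)
  have "\<And>i. i < length qs \<Longrightarrow> D (qs ! i) \<le> Suc (D (qs ! b))"
    using assms by (auto simp: bfs_inv_def)
  moreover have "Suc b < length qs \<Longrightarrow> D (qs ! b) \<le> D (qs ! Suc b)"
    using assms by (auto simp: bfs_inv_def)
  ultimately show "Suc b < length qs \<longrightarrow> (\<forall>i<length qs. D (qs ! i) \<le> Suc (D (qs ! Suc b)))"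
    by (meson Suc_le_mono order_trans)
  show "\<forall>j < Suc b. c (Suc (2 * qs ! j)) = 0"
    using assms by (auto simp: bfs_inv_def less_Suc_eq)
qed (use assms in \<open>auto simp: bfs_inv_def\<close>)

definition bfs_current :: "nat list \<Rightarrow> nat \<Rightarrow> nat \<Rightarrow> nat" where
  "bfs_current qs a b = (if a < length qs then 2 * qs ! a else Suc (2 * qs ! b))"

text \<open>The distance offered by the current edge is at least that of every queued node. So a new
  node belongs at the end of the queue, and a node already queued cannot be improved.\<close>

lemma bfs_current_edge:
  assumes "bfs_inv nx s qs a b c par D" "b < length qs" "c (bfs_current qs a b) = p" "p \<noteq> 0"
  shows "p \<in> {1..E}" "src p \<in> set qs"
    "\<And>i. i < length qs \<Longrightarrow> D (qs ! i) \<le> D (src p) + wt p"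
    "D (src p) + wt p \<le> Suc (D (qs ! b))" "a < length qs \<Longrightarrow> D (src p) + wt p = D (qs ! a)"
proof -
  have cu: "cursor E bfs_key nx c"
    using assms by (auto simp: bfs_inv_def)
  from cursor_at[OF cu, of "bfs_current qs a b"] assms
  have p: "p \<in> {1..E}" "bfs_key p = bfs_current qs a b"
    by auto
  show "p \<in> {1..E}" by fact
  \<comment> \<open>A key can be decoded: its parity is the kind of the list, and half of it the
    node.\<close>
  have parity: "x = y \<and> (i \<longleftrightarrow> k)"
    if "2 * x + of_bool i = 2 * y + of_bool k" for x y :: nat and i k
    using that by (cases i; cases k) (auto, presburger+)
  have eq: "src p = (if a < length qs then qs ! a else qs ! b) \<and> (lab p \<noteq> 0 \<longleftrightarrow> \<not> a < length qs)"
    using p(2) parity[of "src p" "lab p \<noteq> 0" "if a < length qs then qs ! a else qs ! b"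
      "\<not> a < length qs"]
    by (auto simp: bfs_key_def bfs_current_def)
  then show "src p \<in> set qs"
    using assms(2) by auto
  have "a < length qs \<longrightarrow> (\<forall>i < length qs. D (qs ! i) \<le> D (qs ! a))"
    "\<forall>i < length qs. D (qs ! i) \<le> Suc (D (qs ! b))"
    using assms by (auto simp: bfs_inv_def)
  with eq assms(2) show "\<And>i. i < length qs \<Longrightarrow> D (qs ! i) \<le> D (src p) + wt p"
    "D (src p) + wt p \<le> Suc (D (qs ! b))" "a < length qs \<Longrightarrow> D (src p) + wt p = D (qs ! a)"
    by (auto simp: wt_def)
qed

lemma bfs_seen:
  assumes inv: "bfs_inv nx s qs a b c par D" and b: "b < length qs"
    and k: "k = bfs_current qs a b" "c k = p" "p \<noteq> 0"
    and seen: "dst p \<in> set qs"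
  shows "bfs_inv nx s qs a b (c(k := nx p)) par D"
proof -
  have cu: "cursor E bfs_key nx c"
    using inv by (auto simp: bfs_inv_def)
  note adv = cursor_advance[OF cu, of k, unfolded k(2), OF k(3)]
  note p = bfs_current_edge[OF inv b k(2)[unfolded k(1)] k(3)]
  have "D (dst p) \<le> D (src p) + wt p"
    using p(3) seen by (metis in_set_conv_nth)
  then have sc: "\<forall>e \<in> {1..E}. e \<notin> pending E bfs_key (c(k := nx p)) \<longrightarrow>
        src e \<in> set qs \<and> dst e \<in> set qs \<and> D (dst e) \<le> D (src e) + wt e"
    using inv p(2) seen unfolding adv(2) by (auto simp: bfs_inv_def)
  have c: "(c(k := nx p)) i = 0" if "c i = 0" for i
    using that k by auto
  show ?thesis
    unfolding bfs_inv_def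
  proof (intro conjI)
    show "\<forall>j < a. (c(k := nx p)) (2 * qs ! j) = 0"
      "\<forall>j < b. (c(k := nx p)) (Suc (2 * qs ! j)) = 0"
      using inv c unfolding bfs_inv_def by metis+
    show "cursor E bfs_key nx (c(k := nx p))"
      by (rule adv)
    show "\<forall>e \<in> {1..E}. e \<notin> pending E bfs_key (c(k := nx p)) \<longrightarrow>
        src e \<in> set qs \<and> dst e \<in> set qs \<and> D (dst e) \<le> D (src e) + wt e"
      by (rule sc)
  qed (use inv in \<open>simp_all add: bfs_inv_def\<close>)
qed

lemma bfs_new:
  assumes inv: "bfs_inv nx s qs a b c par D" and b: "b < length qs"
    and k: "k = bfs_current qs a b" "c k = p" "p \<noteq> 0"
    and new: "v = dst p" "v \<notin> set qs"
  shows "bfs_inv nx s (qs @ [v]) a b (c(k := nx p)) (par(v := p)) (D(v := D (src p) + wt p))"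
proof -
  let ?D = "D(v := D (src p) + wt p)" and ?par = "par(v := p)" and ?qs = "qs @ [v]"
  have cu: "cursor E bfs_key nx c"
    using inv by (auto simp: bfs_inv_def)
  note adv = cursor_advance[OF cu, of k, unfolded k(2), OF k(3)]
  note p = bfs_current_edge[OF inv b k(2)[unfolded k(1)] k(3)]
  have old: "?qs ! i = qs ! i" "?D (qs ! i) = D (qs ! i)" "?par (qs ! i) = par (qs ! i)"
    if "i < length qs" for i
  proof -
    have "qs ! i \<noteq> v"
      using new(2) nth_mem[OF that] by metis
    then show "?qs ! i = qs ! i" "?D (qs ! i) = D (qs ! i)" "?par (qs ! i) = par (qs ! i)"
      using that by (simp_all add: nth_append)
  qed
  have last: "?qs ! length qs = v"
    by simp
  have oldD: "?D u = D u" if "u \<in> set qs" for u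
    using that new by auto
  have s: "s \<in> set qs"
    using inv by (auto simp: bfs_inv_def)
  show ?thesis
    unfolding bfs_inv_def
  proof (intro conjI)
    show "distinct ?qs" "0 < length ?qs" "?qs ! 0 = s" "b \<le> a" "a \<le> length ?qs"
      using inv new by (auto simp: bfs_inv_def nth_append)
    show "?D s = 0" "?par s = 0"
      using inv new s by (auto simp: bfs_inv_def)
    show "cursor E bfs_key nx (c(k := nx p))"
      by (rule adv)
    show "\<forall>j < length ?qs. \<forall>i \<le> j. ?D (?qs ! i) \<le> ?D (?qs ! j)"
    proof (intro allI impI)
      fix i j
      assume ij: "j < length ?qs" "i \<le> j"
      show "?D (?qs ! i) \<le> ?D (?qs ! j)"
      proof (cases "j < length qs")
        case True
        then have "D (qs ! i) \<le> D (qs ! j)"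
          using inv ij unfolding bfs_inv_def by blast
        then show ?thesis using True ij old[of i] old[of j] by simp
      next
        case False
        then have "j = length qs" using ij by auto
        then show ?thesis using ij p(3)[of i] old[of i] last by (cases "i = j") auto
      qed
    qed
    \<comment> \<open>The new node attains the maximum of all distances; the conditions on
      \<open>a\<close> and \<open>b\<close> follow from this.\<close>
    have max: "?D (?qs ! i) \<le> D (src p) + wt p" if "i < length ?qs" for i
      using that p(3)[of i] old[of i] last by (cases "i = length qs") auto
    have "?D (?qs ! a) = D (src p) + wt p" if "a < length ?qs"
    proof (cases "a = length qs")
      case False
      then have "a < length qs" using that by simp
      then show ?thesis using old(1,2)[of a] p(5) by simp
    qed simp
    then show "a < length ?qs \<longrightarrow> (\<forall>i < length ?qs. ?D (?qs ! i) \<le> ?D (?qs ! a))"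
      using max by simp
    show "b < length ?qs \<longrightarrow> (\<forall>i < length ?qs. ?D (?qs ! i) \<le> Suc (?D (?qs ! b)))"
      unfolding old(1)[OF b] old(2)[OF b] using max p(4) order_trans by blast
    show "\<forall>j < length ?qs. 0 < j \<longrightarrow> ?par (?qs ! j) \<in> {1..E} \<and> dst (?par (?qs ! j)) = ?qs ! j \<and> 
        (\<exists>i < j. ?qs ! i = src (?par (?qs ! j))) \<and>
        ?D (?qs ! j) = ?D (src (?par (?qs ! j))) + wt (?par (?qs ! j))"
    proof (intro allI impI)
      fix j
      assume j: "j < length ?qs" "0 < j"
      show "?par (?qs ! j) \<in> {1..E} \<and> dst (?par (?qs ! j)) = ?qs ! j \<and> 
        (\<exists>i < j. ?qs ! i = src (?par (?qs ! j))) \<and>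
        ?D (?qs ! j) = ?D (src (?par (?qs ! j))) + wt (?par (?qs ! j))"
      proof (cases "j < length qs")
        case True
        then have *: "par (qs ! j) \<in> {1..E}" "dst (par (qs ! j)) = qs ! j"
          "\<exists>i < j. qs ! i = src (par (qs ! j))"
          "D (qs ! j) = D (src (par (qs ! j))) + wt (par (qs ! j))"
          using inv j unfolding bfs_inv_def by auto
        then have "src (par (qs ! j)) \<in> set qs"
          using True by (metis less_trans nth_mem)
        with * True show ?thesis
          unfolding old[OF True] using oldD old(1) by (metis (no_types, lifting) less_trans)
      next
        case False
        then have j: "j = length qs" using j by auto
        obtain i where "i < length qs" "qs ! i = src p"
          using p(2) by (auto simp: in_set_conv_nth)
        then have "\<exists>i < length qs. ?qs ! i = src p"
          using old(1) by metis
        then show ?thesis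
          unfolding j last using p(1,2) new(1) oldD by simp
      qed
    qed
    have D: "?D (dst e) \<le> ?D (src e) + wt e"
      if "src e \<in> set qs" "dst e \<in> set qs" "D (dst e) \<le> D (src e) + wt e" for e
      using that oldD by simp
    show "\<forall>e \<in> {1..E}. e \<notin> pending E bfs_key (c(k := nx p)) \<longrightarrow>
        src e \<in> set ?qs \<and> dst e \<in> set ?qs \<and> ?D (dst e) \<le> ?D (src e) + wt e"
    proof (intro ballI impI)
      fix e
      assume e: "e \<in> {1..E}" "e \<notin> pending E bfs_key (c(k := nx p))"
      show "src e \<in> set ?qs \<and> dst e \<in> set ?qs \<and> ?D (dst e) \<le> ?D (src e) + wt e"
      proof (cases "e = p")
        case True
        then show ?thesis using p(2) new oldD by auto
      next
        case False
        then have "src e \<in> set qs \<and> dst e \<in> set qs \<and> D (dst e) \<le> D (src e) + wt e"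
          using inv e unfolding adv(2) bfs_inv_def by blast
        then show ?thesis using D by auto
      qed
    qed
    have c: "(c(k := nx p)) i = 0" if "c i = 0" for i
      using that k by auto
    show "\<forall>j < a. (c(k := nx p)) (2 * ?qs ! j) = 0"
      using inv c old(1) unfolding bfs_inv_def by (metis (no_types, lifting) order_less_le_trans)
    show "\<forall>j < b. (c(k := nx p)) (Suc (2 * ?qs ! j)) = 0"
      using inv c old(1) unfolding bfs_inv_def by (metis (no_types, lifting) order_less_le_trans)
  qed
qed

text \<open>Parents stand earlier in the queue, hence \<open>d \<le> j\<close>. This later bounds
  the number of iterations for spelling the word.\<close>

lemma bfs_spells:
  assumes "bfs_inv nx s qs a b c par D" "j < length qs"
  shows "\<exists>d xs. spells (\<lambda>v. v) par d (qs ! j) xs \<and> d \<le> j \<and> walk s xs (qs ! j) \<and> length xs = D (qs ! j)"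
  using assms(2)
proof (induction j rule: less_induct)
  case (less j)
  show ?case
  proof (cases "j = 0")
    case True
    then have "qs ! j = s" "par s = 0" "D s = 0"
      using assms by (auto simp: bfs_inv_def)
    then show ?thesis
      by (intro exI[of _ 0] exI[of _ "[]"]) (simp add: spells_0 walk_Nil)
  next
    case False
    let ?p = "par (qs ! j)"
    from False less.prems assms(1) obtain i where p: "?p \<in> {1..E}" "dst ?p = qs ! j" "i < j"
      "qs ! i = src ?p" "D (qs ! j) = D (src ?p) + wt ?p"
      unfolding bfs_inv_def by blast
    with less.IH[of i] less.prems obtain d xs where d: "spells (\<lambda>v. v) par d (src ?p) xs" "d \<le> i"
      "walk s xs (src ?p)" "length xs = D (src ?p)"
      by auto
    have "spells (\<lambda>v. v) par (Suc d) (qs ! j) (xs @ lword (lab ?p))"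
      by (rule spells_Suc) (use p d in auto)
    moreover have "walk s (xs @ lword (lab ?p)) (qs ! j)"
      using walk_snoc[OF d(3) p(1)] p(2) by simp
    moreover have "Suc d \<le> j" "length (xs @ lword (lab ?p)) = D (qs ! j)"
      using d p by (simp_all add: length_lword_lab)
    ultimately show ?thesis
      by blast
  qed
qed

text \<open>When all edges at queued nodes are scanned, \<open>D\<close> is a feasible potential
  with \<open>D s = 0\<close>, so it is a lower bound for all walks from \<open>s\<close>; the walk
  along the parent edges attains it.\<close>

lemma bfs_final:
  assumes inv: "bfs_inv nx s qs a b c par D" and b: "b = length qs"
  shows "walk s xs v \<Longrightarrow> v \<in> set qs"
    and "v \<in> set qs \<Longrightarrow> \<exists>d xs. spells (\<lambda>v. v) par d v xs \<and> d \<le> length qs \<and> walk s xs v \<and>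
      (\<forall>ys. walk s ys v \<longrightarrow> length xs \<le> length ys)"
proof -
  have a: "a = length qs" using inv b by (auto simp: bfs_inv_def)
  have e: "dst e \<in> set qs \<and> D (dst e) \<le> D (src e) + wt e"
    if "e \<in> {1..E}" "src e \<in> set qs" for e
  proof -
    obtain j where j: "j < length qs" "qs ! j = src e"
      using \<open>src e \<in> set qs\<close> by (auto simp: in_set_conv_nth)
    then have "c (2 * src e) = 0" "c (Suc (2 * src e)) = 0"
      using inv a b unfolding bfs_inv_def by auto
    then have "c (bfs_key e) = 0"
      by (simp add: bfs_key_def)
    then have "e \<notin> pending E bfs_key c"
      using cursor_end \<open>e \<in> {1..E}\<close> by metis
    then show ?thesis
      using inv \<open>e \<in> {1..E}\<close> unfolding bfs_inv_def by blast
  qed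
  have *: "walk u xs v \<Longrightarrow> u \<in> set qs \<Longrightarrow> v \<in> set qs \<and> D v \<le> D u + length xs" for u xs v
  proof (induction rule: walk.induct)
    case (walk_Cons d u xs v)
    then show ?case using e[of d] by (auto simp: length_lword_lab)
  qed simp
  have s: "s \<in> set qs" "D s = 0"
    using inv by (auto simp: bfs_inv_def)
  show "walk s xs v \<Longrightarrow> v \<in> set qs"
    using * s by blast
  assume "v \<in> set qs"
  then obtain j where "j < length qs" "qs ! j = v"
    by (auto simp: in_set_conv_nth)
  with bfs_spells[OF inv] obtain d xs
    where d: "spells (\<lambda>v. v) par d v xs" "d \<le> j" "walk s xs v" "length xs = D v"
    by blast
  moreover have "\<forall>ys. walk s ys v \<longrightarrow> length xs \<le> length ys"
    using *[of s _ v] s d(4) by (metis add_0)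
  moreover have "d \<le> length qs"
    using d(2) \<open>j < length qs\<close> by simp
  ultimately show "\<exists>d xs. spells (\<lambda>v. v) par d v xs \<and> d \<le> length qs \<and> walk s xs v \<and>
      (\<forall>ys. walk s ys v \<longrightarrow> length xs \<le> length ys)"
    by blast
qed

end

section \<open>Longest paths\<close>

context labelled_graph
begin

subsection \<open>Depth-first search\<close>

text \<open>The top of the stack is the last element of \<open>st\<close>. Reachability along the
  stack and the last conjunct take the place of discovery and finishing times and of the white-path
  theorem.\<close>

definition dfs_inv ::
  "(nat \<Rightarrow> nat) \<Rightarrow> nat \<Rightarrow> nat list \<Rightarrow> nat list \<Rightarrow> (nat \<Rightarrow> nat) \<Rightarrow> bool" where
  "dfs_inv nx s st fs c \<longleftrightarrow>
     cursor E src nx c \<and> distinct (st @ fs) \<and>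
     (if st = [] then fs \<noteq> [] \<and> last fs = s else hd st = s) \<and>
     (\<forall>v \<in> set (st @ fs). reach s v) \<and>
     (\<forall>j < length st. \<forall>i \<le> j. reach (st ! i) (st ! j)) \<and>
     (\<forall>e \<in> {1..E}. e \<notin> pending E src c \<longrightarrow> src e \<in> set (st @ fs) \<and> dst e \<in> set (st @ fs)) \<and>
     (\<forall>v \<in> set fs. c v = 0) \<and>
     (\<forall>k < length fs. \<forall>e \<in> {1..E}. src e \<in> set (take (Suc k) fs) \<longrightarrow>
        dst e \<in> set (take (Suc k) fs) \<or> reach (dst e) (fs ! k))"

lemma dfs_init: "linked E src nx c \<Longrightarrow> dfs_inv nx s [s] [] c"
  by (auto simp: dfs_inv_def linked_def reach_refl)

text \<open>The last conjunct arises here: as \<open>u\<close> and the finished nodes are fully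
  scanned, their edges lead to finished nodes or into the stack, where every node reaches the top
  \<open>u\<close>.\<close>

lemma dfs_pop:
  assumes inv: "dfs_inv nx s (st @ [u]) fs c" and u: "c u = 0"
  shows "dfs_inv nx s st (fs @ [u]) c"
proof -
  have chain: "reach v u" if v: "v \<in> set (st @ [u])" for v
  proof -
    from v obtain i where "i < length (st @ [u])" "(st @ [u]) ! i = v"
      by (metis in_set_conv_nth)
    moreover have "\<forall>j < length (st @ [u]). \<forall>i \<le> j. reach ((st @ [u]) ! i) ((st @ [u]) ! j)"
      using inv unfolding dfs_inv_def by blast
    ultimately show ?thesis
      by (metis length_append_singleton lessI less_Suc_eq_le nth_append_length)
  qed
  have scanned: "dst e \<in> set (st @ [u]) \<union> set fs"
    if "e \<in> {1..E}" "src e \<in> set (fs @ [u])" for e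
  proof -
    have "c (src e) = 0" using that u inv by (auto simp: dfs_inv_def)
    then have "e \<notin> pending E src c" using that cursor_end by blast
    then show ?thesis using inv that unfolding dfs_inv_def by auto
  qed
  have old: "\<forall>k < length fs. \<forall>e \<in> {1..E}. src e \<in> set (take (Suc k) fs) \<longrightarrow>
        dst e \<in> set (take (Suc k) fs) \<or> reach (dst e) (fs ! k)"
    using inv unfolding dfs_inv_def by blast
  show ?thesis
    unfolding dfs_inv_def
  proof (intro conjI)
    show "\<forall>k < length (fs @ [u]). \<forall>e \<in> {1..E}. src e \<in> set (take (Suc k) (fs @ [u])) \<longrightarrow>
        dst e \<in> set (take (Suc k) (fs @ [u])) \<or> reach (dst e) ((fs @ [u]) ! k)"
    proof (intro allI impI ballI)
      fix k e
      assume k: "k < length (fs @ [u])" and e: "e \<in> {1..E}" "src e \<in> set (take (Suc k) (fs @ [u]))"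
      show "dst e \<in> set (take (Suc k) (fs @ [u])) \<or> reach (dst e) ((fs @ [u]) ! k)"
      proof (cases "k < length fs")
        case True
        then show ?thesis using old e by (auto simp: nth_append)
      next
        case False
        then have "k = length fs" using k by simp
        then show ?thesis using scanned[of e] e chain[of "dst e"] by auto
      qed
    qed
    have "\<forall>j < length (st @ [u]). \<forall>i \<le> j. reach ((st @ [u]) ! i) ((st @ [u]) ! j)"
      using inv unfolding dfs_inv_def by blast
    then show "\<forall>j < length st. \<forall>i \<le> j. reach (st ! i) (st ! j)"
      by (metis length_append_singleton less_Suc_eq nth_append order_le_less_trans)
    show "if st = [] then fs @ [u] \<noteq> [] \<and> last (fs @ [u]) = s else hd st = s"
      using inv by (cases st) (auto simp: dfs_inv_def)
    show "\<forall>v \<in> set (fs @ [u]). c v = 0"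
      using inv u by (auto simp: dfs_inv_def)
  qed (use inv in \<open>auto simp: dfs_inv_def\<close>)
qed

lemma dfs_current_edge:
  assumes inv: "dfs_inv nx s (st @ [u]) fs c" and p: "c u = p" "p \<noteq> 0"
  shows "p \<in> {1..E}" "src p = u"
  using cursor_at[of E src nx c u] inv p by (auto simp: dfs_inv_def)

lemma dfs_seen:
  assumes inv: "dfs_inv nx s (st @ [u]) fs c" and p: "c u = p" "p \<noteq> 0"
    and seen: "dst p \<in> set (st @ [u] @ fs)"
  shows "dfs_inv nx s (st @ [u]) fs (c(u := nx p))"
proof -
  have cu: "cursor E src nx c" using inv by (auto simp: dfs_inv_def)
  note adv = cursor_advance[OF cu, of u, unfolded p(1), OF p(2)]
  note e = dfs_current_edge[OF inv p]
  show ?thesis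
    unfolding dfs_inv_def
  proof (intro conjI)
    show "cursor E src nx (c(u := nx p))" by (rule adv)
    show "\<forall>e \<in> {1..E}. e \<notin> pending E src (c(u := nx p)) \<longrightarrow>
        src e \<in> set ((st @ [u]) @ fs) \<and> dst e \<in> set ((st @ [u]) @ fs)"
      using inv e seen unfolding adv(2) by (auto simp: dfs_inv_def)
    show "\<forall>v \<in> set fs. (c(u := nx p)) v = 0"
      using inv by (auto simp: dfs_inv_def)
    show "\<forall>k < length fs. \<forall>e \<in> {1..E}. src e \<in> set (take (Suc k) fs) \<longrightarrow>
        dst e \<in> set (take (Suc k) fs) \<or> reach (dst e) (fs ! k)"
      "\<forall>j < length (st @ [u]). \<forall>i \<le> j. reach ((st @ [u]) ! i) ((st @ [u]) ! j)"
      using inv unfolding dfs_inv_def by blast+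
  qed (use inv in \<open>simp_all add: dfs_inv_def\<close>)
qed

lemma dfs_new:
  assumes inv: "dfs_inv nx s (st @ [u]) fs c" and p: "c u = p" "p \<noteq> 0"
    and new: "v = dst p" "v \<notin> set (st @ [u] @ fs)"
  shows "dfs_inv nx s (st @ [u] @ [v]) fs (c(u := nx p))"
proof -
  have cu: "cursor E src nx c" using inv by (auto simp: dfs_inv_def)
  note adv = cursor_advance[OF cu, of u, unfolded p(1), OF p(2)]
  note e = dfs_current_edge[OF inv p]
  have uv: "reach u v"
    using reach_edge[OF e(1)] e new by simp
  let ?st = "st @ [u]"
  have chain: "\<forall>j < length ?st. \<forall>i \<le> j. reach (?st ! i) (?st ! j)"
    using inv unfolding dfs_inv_def by blast
  show ?thesis
    unfolding dfs_inv_def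
  proof (intro conjI)
    show "cursor E src nx (c(u := nx p))" by (rule adv)
    show "\<forall>e \<in> {1..E}. e \<notin> pending E src (c(u := nx p)) \<longrightarrow>
        src e \<in> set ((st @ [u] @ [v]) @ fs) \<and> dst e \<in> set ((st @ [u] @ [v]) @ fs)"
      using inv e new unfolding adv(2) by (auto simp: dfs_inv_def)
    show "\<forall>v \<in> set fs. (c(u := nx p)) v = 0"
      using inv by (auto simp: dfs_inv_def)
    show "\<forall>k < length fs. \<forall>e \<in> {1..E}. src e \<in> set (take (Suc k) fs) \<longrightarrow>
        dst e \<in> set (take (Suc k) fs) \<or> reach (dst e) (fs ! k)"
      using inv unfolding dfs_inv_def by blast
    have "reach s u"
      using inv by (auto simp: dfs_inv_def)
    then have "reach s v"
      using uv reach_trans by blast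
    then show "\<forall>v \<in> set ((st @ [u] @ [v]) @ fs). reach s v"
      using inv by (auto simp: dfs_inv_def)
    show "\<forall>j < length (st @ [u] @ [v]). \<forall>i \<le> j. reach ((st @ [u] @ [v]) ! i) ((st @ [u] @ [v]) ! j)"
    proof (intro allI impI)
      fix i j
      assume ij: "j < length (st @ [u] @ [v])" "i \<le> j"
      have last: "(?st @ [v]) ! length ?st = v" "?st ! length st = u"
        by (metis nth_append_length)+
      have "reach ((?st @ [v]) ! i) ((?st @ [v]) ! j)"
      proof (cases "j < length ?st")
        case True
        then show ?thesis using chain ij by (metis nth_append order_le_less_trans)
      next
        case False
        then have j: "j = length ?st" using ij by simp
        show ?thesis
        proof (cases "i = j")
          case True
          then show ?thesis using reach_refl by simp
        next
          case False
          then have "i \<le> length st" "i < length ?st" using ij j by auto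
          then have "reach (?st ! i) u"
            using chain last(2) by (metis length_append_singleton lessI)
          then show ?thesis
            using uv reach_trans last(1) j \<open>i < length ?st\<close> by (metis nth_append)
        qed
      qed
      then show "reach ((st @ [u] @ [v]) ! i) ((st @ [u] @ [v]) ! j)" by simp
    qed
    show "if st @ [u] @ [v] = [] then fs \<noteq> [] \<and> last fs = s else hd (st @ [u] @ [v]) = s"
      using inv by (cases st) (auto simp: dfs_inv_def)
  qed (use inv new in \<open>auto simp: dfs_inv_def\<close>)
qed

text \<open>The second pass relies on the last conjunct. It holds since the target of such an edge is still
  on the stack when \<open>fs ! k\<close> is finished.\<close>

definition finish_order :: "nat \<Rightarrow> nat list \<Rightarrow> bool" where
  "finish_order s fs \<longleftrightarrow> distinct fs \<and> fs \<noteq> [] \<and> last fs = s \<and> (\<forall>v \<in> set fs. reach s v) \<and>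
     (\<forall>e \<in> {1..E}. src e \<in> set fs \<longrightarrow> dst e \<in> set fs) \<and>
     (\<forall>k < length fs. \<forall>e \<in> {1..E}. src e \<in> set (take (Suc k) fs) \<longrightarrow>
        dst e \<in> set (take (Suc k) fs) \<or> reach (dst e) (fs ! k))"

lemma dfs_final:
  assumes "dfs_inv nx s [] fs c"
  shows "finish_order s fs"
proof -
  have "dst e \<in> set fs" if "e \<in> {1..E}" "src e \<in> set fs" for e
  proof -
    have "c (src e) = 0" using that assms by (auto simp: dfs_inv_def)
    then have "e \<notin> pending E src c" using that cursor_end by blast
    then show ?thesis using assms that unfolding dfs_inv_def by auto
  qed
  then show ?thesis
    using assms by (auto simp: dfs_inv_def finish_order_def)
qed

section \<open>Components from a finishing order\<close>

lemma walk_exit: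
  assumes "walk u xs v" "u \<in> R" "v \<notin> R"
  obtains e where "e \<in> {1..E}" "src e \<in> R" "dst e \<notin> R" "reach u (src e)" "reach (dst e) v"
  using assms
proof (induction arbitrary: thesis rule: walk.induct)
  case (walk_Cons e u xs v)
  show ?case
  proof (cases "dst e \<in> R")
    case True
    obtain e' where e': "e' \<in> {1..E}" "src e' \<in> R" "dst e' \<notin> R" "reach (dst e) (src e')"
      "reach (dst e') v"
      using walk_Cons.IH[OF _ True walk_Cons.prems(3)] by blast
    have "reach u (src e')"
      using reach_trans[OF reach_edge[OF walk_Cons.hyps(1)] e'(4)] walk_Cons.hyps(2) by simp
    then show ?thesis using e' walk_Cons.prems(1) by blast
  next
    case False
    then show ?thesis
      using walk_Cons reach_refl by (metis reach_def)
  qed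
qed simp

lemma pred_closed_reach:
  assumes "finish_order s fs"
    and Z: "\<And>e. e \<in> {1..E} \<Longrightarrow> src e \<in> set fs \<Longrightarrow> dst e \<in> Z \<Longrightarrow> src e \<in> Z"
  shows "walk u xs v \<Longrightarrow> u \<in> set fs \<Longrightarrow> v \<in> Z \<Longrightarrow> u \<in> Z"
proof (induction rule: walk.induct)
  case (walk_Cons e u xs v)
  then have "dst e \<in> set fs" using assms(1) by (auto simp: finish_order_def)
  then show ?case using walk_Cons Z[of e] by auto
qed simp

text \<open>\<open>Z\<close> will be the set of nodes in completed components. A walk from
  \<open>fs ! i\<close> to \<open>fs ! k\<close> with \<open>i < k\<close> leaves the first
  \<open>i + 1\<close> finished nodes by some edge. Its target reaches \<open>fs ! i\<close> by the
  finishing order. It is not in \<open>Z\<close>, since \<open>Z\<close> is closed under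
  predecessors, so its index is above \<open>i\<close> and at most \<open>k\<close>, and the
  induction shows that \<open>fs ! k\<close> reaches it.\<close>

lemma finish_order_scc:
  assumes fs: "finish_order s fs"
    and Z: "\<And>e. e \<in> {1..E} \<Longrightarrow> src e \<in> set fs \<Longrightarrow> dst e \<in> Z \<Longrightarrow> src e \<in> Z"
    and k: "k < length fs" "\<And>i. k < i \<Longrightarrow> i < length fs \<Longrightarrow> fs ! i \<in> Z"
  shows "i \<le> k \<Longrightarrow> fs ! i \<notin> Z \<Longrightarrow> reach (fs ! i) (fs ! k) \<Longrightarrow> reach (fs ! k) (fs ! i)"
proof (induction "k - i" arbitrary: i rule: less_induct)
  case less
  show ?case
  proof (cases "i = k")
    case True
    then show ?thesis by (simp add: reach_refl)
  next
    case False
    then have i: "i < k" using less.prems by simp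
    let ?R = "set (take (Suc i) fs)"
    have in_R: "fs ! m \<in> ?R \<longleftrightarrow> m \<le> i" if "m < length fs" for m
    proof
      assume "fs ! m \<in> ?R"
      then obtain m' where "m' < Suc i" "m' < length fs" "fs ! m' = fs ! m"
        by (auto simp: in_set_conv_nth)
      then show "m \<le> i"
        using that fs by (auto simp: finish_order_def nth_eq_iff_index_eq)
    next
      assume "m \<le> i"
      then show "fs ! m \<in> ?R"
        using that by (auto simp: in_set_conv_nth intro!: exI[of _ m])
    qed
    have "fs ! i \<in> ?R" "fs ! k \<notin> ?R"
      using in_R[of i] in_R[of k] i k by auto
    with less.prems(3) obtain e where e: "e \<in> {1..E}" "src e \<in> ?R" "dst e \<notin> ?R"
      "reach (fs ! i) (src e)" "reach (dst e) (fs ! k)"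
      unfolding reach_def[of "fs ! i" "fs ! k"] using walk_exit by blast
    have "src e \<in> set fs"
      using e(2) set_take_subset by fastforce
    then have "dst e \<in> set fs"
      using fs e(1) by (auto simp: finish_order_def)
    then obtain m where m: "m < length fs" "fs ! m = dst e"
      by (auto simp: in_set_conv_nth)
    then have "i < m"
      using e(3) in_R[of m] by auto
    have "reach (dst e) (fs ! i)"
      using fs e(1,2,3) i k(1) unfolding finish_order_def by (meson order.strict_trans)
    moreover have "reach (fs ! i) (dst e)"
      using reach_trans[OF e(4) reach_edge[OF e(1)]] .
    then have "dst e \<notin> Z"
      using pred_closed_reach[OF fs Z, of "fs ! i" _ "dst e"] less.prems(2) i k(1)
      unfolding reach_def by (metis less_trans nth_mem)
    then have "m \<le> k"
      using k(2)[of m] m by (metis not_le_imp_less)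
    then have "reach (fs ! k) (fs ! m)"
      using less.hyps[of m] \<open>i < m\<close> i m e(5) \<open>dst e \<notin> Z\<close> by auto
    ultimately show ?thesis
      using m reach_trans by simp
  qed
qed

end

context labelled_graph
begin

subsection \<open>Strongly connected components\<close>

text \<open>The second pass numbers the components in topological order. A component \<open>j\<close> is reached with
  at most \<open>vl j - 1\<close> symbols, unless \<open>il j\<close> signals an unbounded number; \<open>vl j = 0\<close> means that no
  path to it is known yet, and \<open>pr j\<close> is the last edge of a longest path entering it.\<close>

definition scc_edge :: "(nat \<Rightarrow> nat) \<Rightarrow> (nat \<Rightarrow> nat) \<Rightarrow> (nat \<Rightarrow> nat) \<Rightarrow> nat \<Rightarrow> bool" where
  "scc_edge cp vl il e \<longleftrightarrow> cp (src e) \<noteq> 0 \<and> cp (src e) \<le> cp (dst e) \<and>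
     (cp (src e) = cp (dst e) \<longrightarrow> lab e \<noteq> 0 \<longrightarrow> il (cp (dst e)) \<noteq> 0) \<and>
     (cp (src e) < cp (dst e) \<longrightarrow> vl (cp (src e)) + wt e \<le> vl (cp (dst e)) \<and>
        (il (cp (src e)) \<noteq> 0 \<longrightarrow> il (cp (dst e)) \<noteq> 0))"

text \<open>This makes the value attained along the parent edge, while \<open>scc_edge\<close> makes
  it an upper bound. The parent edge comes from a strictly earlier component, so following parents
  terminates.\<close>

definition scc_val :: "(nat \<Rightarrow> nat) \<Rightarrow> (nat \<Rightarrow> nat) \<Rightarrow> (nat \<Rightarrow> nat) \<Rightarrow> nat \<Rightarrow> bool" where
  "scc_val cp vl pr j \<longleftrightarrow>
     pr j = 0 \<and> vl j = of_bool (j = 1) \<or>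
     1 < j \<and> pr j \<in> {1..E} \<and> 0 < cp (src (pr j)) \<and> cp (src (pr j)) < j \<and> cp (dst (pr j)) = j \<and>
       vl j = vl (cp (src (pr j))) + wt (pr j)"

text \<open>A justification for a raised flag. It is well-founded, since the second case refers to
  an earlier component.\<close>

definition scc_inf :: "(nat \<Rightarrow> nat) \<Rightarrow> (nat \<Rightarrow> nat) \<Rightarrow> nat \<Rightarrow> bool" where
  "scc_inf cp il j \<longleftrightarrow>
     (\<exists>e \<in> {1..E}. lab e \<noteq> 0 \<and> cp (src e) = j \<and> cp (dst e) = j) \<or>
     (\<exists>e \<in> {1..E}. 0 < cp (src e) \<and> cp (src e) < j \<and> cp (dst e) = j \<and> il (cp (src e)) \<noteq> 0)"

text \<open>\<open>k\<close> runs downwards through the finishing order, and \<open>cn\<close> is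
  the latest component. Numbered nodes whose incoming edges are not all scanned are on
  \<open>st\<close> and belong to \<open>cn\<close>. The restriction
  \<open>src e \<in> set fs\<close> is due to incoming edges from nodes that \<open>s\<close> does
  not reach.\<close>

definition scc_inv ::
  "(nat \<Rightarrow> nat) \<Rightarrow> nat \<Rightarrow> nat list \<Rightarrow> nat \<Rightarrow> nat list \<Rightarrow> (nat \<Rightarrow> nat) \<Rightarrow> (nat \<Rightarrow> nat) \<Rightarrow> (nat \<Rightarrow> nat) \<Rightarrow>
   (nat \<Rightarrow> nat) \<Rightarrow> (nat \<Rightarrow> nat) \<Rightarrow> nat \<Rightarrow> bool" where
  "scc_inv nx s fs k st cp vl pr il c cn \<longleftrightarrow>
     cursor E dst nx c \<and> k \<le> length fs \<and> distinct st \<and>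
     (\<forall>v. cp v \<noteq> 0 \<longrightarrow> v \<in> set fs \<and> cp v \<le> cn) \<and>
     (\<forall>v \<in> set st. cp v = cn) \<and>
     (\<forall>i. k \<le> i \<longrightarrow> i < length fs \<longrightarrow> cp (fs ! i) \<noteq> 0) \<and>
     (st \<noteq> [] \<longrightarrow> 0 < cn \<and> k < length fs \<and> cp (fs ! k) = cn \<and>
        (\<forall>i. k < i \<longrightarrow> i < length fs \<longrightarrow> cp (fs ! i) < cn)) \<and>
     (\<forall>u v. cp u \<noteq> 0 \<longrightarrow> cp u = cp v \<longrightarrow> reach u v) \<and>
     (if cn = 0 then k = length fs else cp s = 1) \<and>
     (\<forall>e \<in> {1..E}. e \<notin> pending E dst c \<longrightarrow> src e \<in> set fs \<longrightarrow> scc_edge cp vl il e) \<and>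
     (\<forall>v. cp v \<noteq> 0 \<longrightarrow> v \<notin> set st \<longrightarrow> c v = 0) \<and>
     (\<forall>j. scc_val cp vl pr j) \<and>
     (\<forall>j. il j \<noteq> 0 \<longrightarrow> 0 < j \<and> j \<le> cn \<and> scc_inf cp il j)"

lemma scc_inv_conjuncts:
  assumes "scc_inv nx s fs k st cp vl pr il c cn"
  shows "cursor E dst nx c" and "k \<le> length fs" and "distinct st"
    and "\<forall>v. cp v \<noteq> 0 \<longrightarrow> v \<in> set fs \<and> cp v \<le> cn"
    and "\<forall>v \<in> set st. cp v = cn"
    and "\<forall>i. k \<le> i \<longrightarrow> i < length fs \<longrightarrow> cp (fs ! i) \<noteq> 0"
    and "st \<noteq> [] \<longrightarrow> 0 < cn \<and> k < length fs \<and> cp (fs ! k) = cn \<and>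
        (\<forall>i. k < i \<longrightarrow> i < length fs \<longrightarrow> cp (fs ! i) < cn)"
    and "\<forall>u v. cp u \<noteq> 0 \<longrightarrow> cp u = cp v \<longrightarrow> reach u v"
    and "if cn = 0 then k = length fs else cp s = 1"
    and "\<forall>e \<in> {1..E}. e \<notin> pending E dst c \<longrightarrow> src e \<in> set fs \<longrightarrow> scc_edge cp vl il e"
    and "\<forall>v. cp v \<noteq> 0 \<longrightarrow> v \<notin> set st \<longrightarrow> c v = 0"
    and "\<forall>j. scc_val cp vl pr j"
    and "\<forall>j. il j \<noteq> 0 \<longrightarrow> 0 < j \<and> j \<le> cn \<and> scc_inf cp il j"
  using assms unfolding scc_inv_def by - (elim conjE, assumption)+

lemma scc_invD:
  assumes "scc_inv nx s fs k st cp vl pr il c cn"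
  shows "\<And>e. e \<in> {1..E} \<Longrightarrow> e \<notin> pending E dst c \<Longrightarrow> src e \<in> set fs \<Longrightarrow> scc_edge cp vl il e"
    and "\<And>j. scc_val cp vl pr j"
    and "\<And>j. il j \<noteq> 0 \<Longrightarrow> 0 < j \<and> j \<le> cn \<and> scc_inf cp il j"
    and "cursor E dst nx c" and "k \<le> length fs" and "distinct st"
    and "\<And>v. cp v \<noteq> 0 \<Longrightarrow> v \<in> set fs \<and> cp v \<le> cn"
    and "\<And>v. v \<in> set st \<Longrightarrow> cp v = cn"
    and "\<And>i. k \<le> i \<Longrightarrow> i < length fs \<Longrightarrow> cp (fs ! i) \<noteq> 0"
    and "st \<noteq> [] \<Longrightarrow> 0 < cn \<and> k < length fs \<and> cp (fs ! k) = cn \<and>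
        (\<forall>i. k < i \<longrightarrow> i < length fs \<longrightarrow> cp (fs ! i) < cn)"
    and "\<And>u v. cp u \<noteq> 0 \<Longrightarrow> cp u = cp v \<Longrightarrow> reach u v"
    and "if cn = 0 then k = length fs else cp s = 1"
    and "\<And>v. cp v \<noteq> 0 \<Longrightarrow> v \<notin> set st \<Longrightarrow> c v = 0"
  using scc_inv_conjuncts[OF assms] by blast+

lemma scc_init:
  assumes "linked E dst nx c"
  shows "scc_inv nx s fs (length fs) [] (\<lambda>_. 0) ((\<lambda>_. 0)(1 := 1)) (\<lambda>_. 0) (\<lambda>_. 0) c 0"
  using assms by (auto simp: scc_inv_def linked_def scc_val_def)

lemma scc_skip:
  assumes "scc_inv nx s fs (Suc k) [] cp vl pr il c cn" "cp (fs ! k) \<noteq> 0"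
  shows "scc_inv nx s fs k [] cp vl pr il c cn"
proof -
  have "cp (fs ! i) \<noteq> 0" if "k \<le> i" "i < length fs" for i
    using assms that by (cases "i = k") (auto simp: scc_inv_def)
  moreover have "cn \<noteq> 0"
    using assms unfolding scc_inv_def by (metis le_zero_eq)
  ultimately show ?thesis
    using assms(1) unfolding scc_inv_def by auto
qed

text \<open>The established facts speak only of nodes that already have a component, so numbering a
  fresh node leaves them intact.\<close>

lemma scc_edge_assign:
  assumes "scc_edge cp vl il e" "cp x = 0"
  shows "scc_edge (cp(x := j)) vl il e"
proof -
  have "src e \<noteq> x" "dst e \<noteq> x" using assms by (auto simp: scc_edge_def)
  then show ?thesis using assms by (simp add: scc_edge_def)
qed

lemma scc_val_assign:
  assumes "scc_val cp vl pr j" "cp x = 0"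
  shows "scc_val (cp(x := i)) vl pr j"
proof -
  have "pr j = 0 \<or> src (pr j) \<noteq> x \<and> dst (pr j) \<noteq> x"
    using assms by (auto simp: scc_val_def)
  then show ?thesis using assms by (auto simp: scc_val_def)
qed

lemma scc_inf_assign:
  assumes "scc_inf cp il j" "cp x = 0" "0 < j"
  shows "scc_inf (cp(x := i)) il j"
proof -
  have "(cp(x := i)) v = cp v" if "cp v \<noteq> 0" for v
    using that assms by auto
  then show ?thesis using assms(1,3) unfolding scc_inf_def by (metis less_numeral_extra(3))
qed

lemma scc_root:
  assumes fs: "finish_order s fs"
    and inv: "scc_inv nx s fs (Suc k) [] cp vl pr il c cn" and u: "u = fs ! k" "cp u = 0"
  shows "scc_inv nx s fs k [u] (cp(u := Suc cn)) vl pr il c (Suc cn)"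
  unfolding scc_inv_def
proof (intro conjI)
  let ?cp = "cp(u := Suc cn)"
  have k: "k < length fs" using inv by (auto simp: scc_inv_def)
  have le: "cp v \<noteq> 0 \<Longrightarrow> v \<in> set fs \<and> cp v \<le> cn" for v
    using inv by (auto simp: scc_inv_def)
  then have le': "cp v \<noteq> Suc cn" for v
    by (metis Suc_n_not_le_n nat.simps(3))
  show "\<forall>v. ?cp v \<noteq> 0 \<longrightarrow> v \<in> set fs \<and> ?cp v \<le> Suc cn"
    using le k u by (auto simp: le_SucI)
  show "\<forall>i. k \<le> i \<longrightarrow> i < length fs \<longrightarrow> ?cp (fs ! i) \<noteq> 0"
  proof (intro allI impI)
    fix i
    assume "k \<le> i" "i < length fs"
    then show "?cp (fs ! i) \<noteq> 0"
      using inv u by (cases "i = k") (auto simp: scc_inv_def)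
  qed
  show "\<forall>v w. ?cp v \<noteq> 0 \<longrightarrow> ?cp v = ?cp w \<longrightarrow> reach v w"
    using inv le' le'[symmetric] by (auto simp: scc_inv_def reach_refl)
  show "if Suc cn = 0 then k = length fs else ?cp s = 1"
  proof (cases "cn = 0")
    case True
    then have "Suc k = length fs" using inv by (auto simp: scc_inv_def)
    \<comment> \<open>The first root is the node finished last, which is the source; so the source
      gets component \<open>1\<close>.\<close>
    then have "u = s" using fs u by (metis diff_Suc_1 finish_order_def last_conv_nth)
    then show ?thesis using True by simp
  next
    case False
    then have "cp s = 1" using inv by (auto simp: scc_inv_def)
    then show ?thesis using u by auto
  qed
  have nz: "cp (fs ! i) \<noteq> 0" if "k < i" "i < length fs" for i
    using inv that unfolding scc_inv_def by (metis Suc_leI)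
  have "?cp (fs ! i) < Suc cn" if "k < i" "i < length fs" for i
    using nz[OF that] le[of "fs ! i"] u(2) by (auto simp: less_Suc_eq_le)
  then show "[u] \<noteq> [] \<longrightarrow> 0 < Suc cn \<and> k < length fs \<and> ?cp (fs ! k) = Suc cn \<and>
        (\<forall>i. k < i \<longrightarrow> i < length fs \<longrightarrow> ?cp (fs ! i) < Suc cn)"
    using k u(1) by simp
  show "\<forall>e \<in> {1..E}. e \<notin> pending E dst c \<longrightarrow> src e \<in> set fs \<longrightarrow> scc_edge ?cp vl il e"
    using scc_invD(1)[OF inv] scc_edge_assign u(2) by blast
  show "\<forall>v. ?cp v \<noteq> 0 \<longrightarrow> v \<notin> set [u] \<longrightarrow> c v = 0"
    using inv by (auto simp: scc_inv_def)
  show "\<forall>j. scc_val ?cp vl pr j"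
    using scc_invD(2)[OF inv] scc_val_assign u(2) by blast
  show "\<forall>j. il j \<noteq> 0 \<longrightarrow> 0 < j \<and> j \<le> Suc cn \<and> scc_inf ?cp il j"
    using scc_invD(3)[OF inv] scc_inf_assign[of cp il _ u] u(2) le_SucI by blast
qed (use scc_invD(4,5)[OF inv] u in auto)

lemma scc_pop:
  assumes inv: "scc_inv nx s fs k (st @ [u]) cp vl pr il c cn" and u: "c u = 0"
  shows "scc_inv nx s fs k st cp vl pr il c cn"
  unfolding scc_inv_def
proof (intro conjI)
  show "\<forall>v. cp v \<noteq> 0 \<longrightarrow> v \<notin> set st \<longrightarrow> c v = 0"
    using scc_invD(13)[OF inv] u by auto
  show "distinct st"
    using scc_invD(6)[OF inv] by simp
  show "\<forall>v \<in> set st. cp v = cn"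
    using scc_invD(8)[OF inv] by simp
  show "st \<noteq> [] \<longrightarrow> 0 < cn \<and> k < length fs \<and> cp (fs ! k) = cn \<and>
        (\<forall>i. k < i \<longrightarrow> i < length fs \<longrightarrow> cp (fs ! i) < cn)"
    using scc_invD(10)[OF inv] by simp
qed (fact scc_inv_conjuncts[OF inv])+

text \<open>The new node reaches the root through the scanned edge. The converse is
  \<open>finish_order_scc\<close> for the nodes of smaller components, which are closed under
  predecessors because all their incoming edges have been scanned.\<close>

lemma scc_push:
  assumes fs: "finish_order s fs"
    and inv: "scc_inv nx s fs k st cp vl pr il c cn" and u: "u \<in> set st"
    and p: "p \<in> {1..E}" "dst p = u" "x = src p" "x \<in> set fs" "cp x = 0"
  shows "scc_inv nx s fs k (st @ [x]) (cp(x := cn)) vl pr il c cn"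
  unfolding scc_inv_def
proof (intro conjI)
  let ?cp = "cp(x := cn)"
  let ?Z = "{v. cp v \<noteq> 0 \<and> cp v < cn}"
  have st: "0 < cn" "k < length fs" "cp (fs ! k) = cn"
    using scc_invD(10)[OF inv] u by (metis empty_iff list.set(1))+
  have cu: "cp u = cn" using scc_invD(8)[OF inv] u by blast
  have Z: "src e \<in> ?Z" if "e \<in> {1..E}" "src e \<in> set fs" "dst e \<in> ?Z" for e
  proof -
    have "dst e \<notin> set st" using that scc_invD(8)[OF inv] by auto
    then have "c (dst e) = 0" using that scc_invD(13)[OF inv] by auto
    then have "e \<notin> pending E dst c" using that cursor_end by blast
    then have "scc_edge cp vl il e" using that scc_invD(1)[OF inv] by blast
    then show ?thesis using that by (auto simp: scc_edge_def)
  qed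
  have same: "\<And>v w. cp v \<noteq> 0 \<Longrightarrow> cp v = cp w \<Longrightarrow> reach v w"
    by (rule scc_invD(11)[OF inv])
  have "reach x u" using reach_edge[OF p(1)] p by simp
  then have xr: "reach x (fs ! k)" using same[of u "fs ! k"] st cu reach_trans by simp
  obtain i where i: "i < length fs" "fs ! i = x" using p(4) by (auto simp: in_set_conv_nth)
  have "i \<le> k"
    using scc_invD(9)[OF inv, of i] i p(5) by (metis le_cases)
  have below: "cp (fs ! n) \<noteq> 0 \<and> cp (fs ! n) < cn" if "k < n" "n < length fs" for n
    using scc_invD(9)[OF inv, of n] scc_invD(10)[OF inv] u that by (cases st) auto
  have "reach (fs ! k) (fs ! i)"
    by (rule finish_order_scc[OF fs Z st(2)]) (use below i p(5) xr \<open>i \<le> k\<close> in auto)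
  then have rx: "reach (fs ! k) x" using i by simp
  have to_x: "reach v x \<and> reach x v" if "cp v = cn" for v
    using same[of v "fs ! k"] same[of "fs ! k" v] that st xr rx reach_trans by (metis less_numeral_extra(3))
  show "\<forall>v w. ?cp v \<noteq> 0 \<longrightarrow> ?cp v = ?cp w \<longrightarrow> reach v w"
  proof (intro allI impI)
    fix v w
    assume vw: "?cp v \<noteq> 0" "?cp v = ?cp w"
    show "reach v w"
    proof (cases "v = x \<or> w = x")
      case True
      then show ?thesis using vw to_x reach_refl by (auto split: if_splits)
    next
      case False
      then show ?thesis using same vw by auto
    qed
  qed
  show "\<forall>e \<in> {1..E}. e \<notin> pending E dst c \<longrightarrow> src e \<in> set fs \<longrightarrow> scc_edge ?cp vl il e"
    using scc_invD(1)[OF inv] scc_edge_assign p(5) by blast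
  show "\<forall>j. scc_val ?cp vl pr j"
    using scc_invD(2)[OF inv] scc_val_assign p(5) by blast
  show "\<forall>j. il j \<noteq> 0 \<longrightarrow> 0 < j \<and> j \<le> cn \<and> scc_inf ?cp il j"
    using scc_invD(3)[OF inv] scc_inf_assign[of cp il _ x] p(5) by blast
  show "\<forall>i. k \<le> i \<longrightarrow> i < length fs \<longrightarrow> ?cp (fs ! i) \<noteq> 0"
    using scc_invD(9)[OF inv] st(1) by auto
  show "distinct (st @ [x])"
    using scc_invD(6,8)[OF inv] p(5) st(1) by auto
  show "if cn = 0 then k = length fs else ?cp s = 1"
    using scc_invD(12)[OF inv] p(5) st by auto
  show "st @ [x] \<noteq> [] \<longrightarrow> 0 < cn \<and> k < length fs \<and> ?cp (fs ! k) = cn \<and>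
        (\<forall>i. k < i \<longrightarrow> i < length fs \<longrightarrow> ?cp (fs ! i) < cn)"
  proof -
    have "?cp (fs ! i) < cn" if "k < i" "i < length fs" for i
      using below[OF that] p(5) by (cases "fs ! i = x") auto
    then show ?thesis using st by simp
  qed
qed (use scc_invD(4,5,7,8,13)[OF inv] p in auto)

lemma scc_current_edge:
  assumes inv: "scc_inv nx s fs k st cp vl pr il c cn" and u: "u \<in> set st"
    and p: "c u = p" "p \<noteq> 0"
  shows "p \<in> {1..E}" "dst p = u" "cp u = cn" "0 < cn"
proof -
  have "st \<noteq> []" using u by auto
  then show "0 < cn" using scc_invD(10)[OF inv] by simp
  show "p \<in> {1..E}" "dst p = u" using cursor_at[OF scc_invD(4)[OF inv], of u] p by auto
  show "cp u = cn" by (rule scc_invD(8)[OF inv u])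
qed

lemma scc_outside:
  assumes inv: "scc_inv nx s fs k st cp vl pr il c cn" and u: "u \<in> set st"
    and p: "c u = p" "p \<noteq> 0" and x: "src p \<notin> set fs"
  shows "scc_inv nx s fs k st cp vl pr il (c(u := nx p)) cn"
proof -
  have cu: "cursor E dst nx c" by (rule scc_invD(4)[OF inv])
  note adv = cursor_advance[OF cu, of u, unfolded p(1), OF p(2)]
  show ?thesis
    unfolding scc_inv_def
  proof (intro conjI)
    show "cursor E dst nx (c(u := nx p))"
      by (rule adv)
    show "\<forall>e \<in> {1..E}. e \<notin> pending E dst (c(u := nx p)) \<longrightarrow> src e \<in> set fs \<longrightarrow> scc_edge cp vl il e"
      using scc_invD(1)[OF inv] x unfolding adv(2) by blast
    show "\<forall>v. cp v \<noteq> 0 \<longrightarrow> v \<notin> set st \<longrightarrow> (c(u := nx p)) v = 0"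
      using scc_invD(13)[OF inv] u by auto
  qed (fact scc_inv_conjuncts[OF inv])+
qed

lemma scc_inside:
  assumes inv: "scc_inv nx s fs k st cp vl pr il c cn" and u: "u \<in> set st"
    and p: "c u = p" "p \<noteq> 0" and x: "cp (src p) = cn"
    and il': "il' = (if lab p = 0 then il else il(cn := 1))"
  shows "scc_inv nx s fs k st cp vl pr il' (c(u := nx p)) cn"
  unfolding scc_inv_def
proof (intro conjI)
  have cu: "cursor E dst nx c" by (rule scc_invD(4)[OF inv])
  note adv = cursor_advance[OF cu, of u, unfolded p(1), OF p(2)]
  note e = scc_current_edge[OF inv u p]
  show "cursor E dst nx (c(u := nx p))" by (rule adv)
  have le: "cp v \<le> cn" for v
    using scc_invD(7)[OF inv, of v] by (cases "cp v = 0") auto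
  have mono: "il j \<noteq> 0 \<Longrightarrow> il' j \<noteq> 0"
    "j \<noteq> cn \<Longrightarrow> il' j = il j" for j
    using il' by auto
  show "\<forall>e \<in> {1..E}. e \<notin> pending E dst (c(u := nx p)) \<longrightarrow> src e \<in> set fs \<longrightarrow> scc_edge cp vl il' e"
  proof (intro ballI impI)
    fix d
    assume d: "d \<in> {1..E}" "d \<notin> pending E dst (c(u := nx p))" "src d \<in> set fs"
    show "scc_edge cp vl il' d"
    proof (cases "d = p")
      case True
      then show ?thesis using e x il' by (simp add: scc_edge_def)
    next
      case False
      then have "scc_edge cp vl il d"
        using scc_invD(1)[OF inv] d unfolding adv(2) by blast
      then show ?thesis
        using mono le[of "dst d"] unfolding scc_edge_def by (metis not_le)
    qed
  qed
  show "\<forall>v. cp v \<noteq> 0 \<longrightarrow> v \<notin> set st \<longrightarrow> (c(u := nx p)) v = 0"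
    using scc_invD(13)[OF inv] u by auto
  show "\<forall>j. il' j \<noteq> 0 \<longrightarrow> 0 < j \<and> j \<le> cn \<and> scc_inf cp il' j"
  proof (intro allI impI)
    fix j
    assume j: "il' j \<noteq> 0"
    show "0 < j \<and> j \<le> cn \<and> scc_inf cp il' j"
    proof (cases "il j \<noteq> 0")
      case True
      then have "0 < j" "j \<le> cn" "scc_inf cp il j" using scc_invD(3)[OF inv] by blast+
      then show ?thesis using mono(1) unfolding scc_inf_def by blast
    next
      case False
      then have "j = cn" "lab p \<noteq> 0" using j il' by (auto split: if_splits)
      then show ?thesis using e x unfolding scc_inf_def by auto
    qed
  qed
qed (fact scc_inv_conjuncts[OF inv])+

text \<open>Only the entries at \<open>cn\<close> change. The source of the edge lies in a smaller,
  hence completed component, and the conditions on edges into smaller components do not involve the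
  entries at \<open>cn\<close>.\<close>

lemma scc_earlier:
  assumes inv: "scc_inv nx s fs k st cp vl pr il c cn" and u: "u \<in> set st"
    and p: "c u = p" "p \<noteq> 0" and x: "cp (src p) \<noteq> 0" "cp (src p) \<noteq> cn"
    and new: "vl (cp (src p)) + wt p = z"
      "vl' = (if vl cn < z then vl(cn := z) else vl)" "pr' = (if vl cn < z then pr(cn := p) else pr)"
      "il' = (if il (cp (src p)) = 0 then il else il(cn := 1))"
  shows "scc_inv nx s fs k st cp vl' pr' il' (c(u := nx p)) cn"
  unfolding scc_inv_def
proof (intro conjI)
  have cu: "cursor E dst nx c" by (rule scc_invD(4)[OF inv])
  note adv = cursor_advance[OF cu, of u, unfolded p(1), OF p(2)]
  note e = scc_current_edge[OF inv u p]
  show "cursor E dst nx (c(u := nx p))" by (rule adv)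
  have le: "cp v \<le> cn" for v
    using scc_invD(7)[OF inv, of v] by (cases "cp v = 0") auto
  then have lt: "cp (src p) < cn" using x(2) by (metis le_neq_implies_less)
  have mono: "il j \<noteq> 0 \<Longrightarrow> il' j \<noteq> 0" "vl j \<le> vl' j"
    "j \<noteq> cn \<Longrightarrow> il' j = il j" "j \<noteq> cn \<Longrightarrow> vl' j = vl j"
      "j \<noteq> cn \<Longrightarrow> pr' j = pr j" for j
    using new by auto
  show "\<forall>e \<in> {1..E}. e \<notin> pending E dst (c(u := nx p)) \<longrightarrow> src e \<in> set fs \<longrightarrow> scc_edge cp vl' il' e"
  proof (intro ballI impI)
    fix d
    assume d: "d \<in> {1..E}" "d \<notin> pending E dst (c(u := nx p))" "src d \<in> set fs"
    show "scc_edge cp vl' il' d"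
    proof (cases "d = p")
      case True
      have "z \<le> vl' cn" using new by auto
      then show ?thesis using True e x(1) lt new mono(4)[of "cp (src p)"] mono(3)[of "cp (src p)"]
        by (auto simp: scc_edge_def)
    next
      case False
      then have *: "scc_edge cp vl il d"
        using scc_invD(1)[OF inv] d unfolding adv(2) by blast
      have "il' (cp (src d)) = il (cp (src d)) \<and> vl' (cp (src d)) = vl (cp (src d))"
        if "cp (src d) < cp (dst d)"
        using that le[of "dst d"] mono(3,4)[of "cp (src d)"] by auto
      then show ?thesis
        using * mono(1)[of "cp (dst d)"] mono(2)[of "cp (dst d)"] unfolding scc_edge_def
        by (auto intro: order_trans)
    qed
  qed
  show "\<forall>v. cp v \<noteq> 0 \<longrightarrow> v \<notin> set st \<longrightarrow> (c(u := nx p)) v = 0"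
    using scc_invD(13)[OF inv] u by auto
  show "\<forall>j. il' j \<noteq> 0 \<longrightarrow> 0 < j \<and> j \<le> cn \<and> scc_inf cp il' j"
  proof (intro allI impI)
    fix j
    assume j: "il' j \<noteq> 0"
    show "0 < j \<and> j \<le> cn \<and> scc_inf cp il' j"
    proof (cases "il j \<noteq> 0")
      case True
      then have "0 < j" "j \<le> cn" "scc_inf cp il j" using scc_invD(3)[OF inv] by blast+
      then show ?thesis using mono(1) unfolding scc_inf_def by blast
    next
      case False
      then have "j = cn" "il (cp (src p)) \<noteq> 0" using j new by (auto split: if_splits)
      then show ?thesis using e x(1) lt mono(1) unfolding scc_inf_def by blast
    qed
  qed
  show "\<forall>j. scc_val cp vl' pr' j"
  proof
    fix j
    have j: "scc_val cp vl pr j" by (rule scc_invD(2)[OF inv])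
    show "scc_val cp vl' pr' j"
    proof (cases "j = cn \<and> vl cn < z")
      case True
      then show ?thesis using new e x(1) lt mono(4)[of "cp (src p)"] unfolding scc_val_def by auto
    next
      case False
      then have "vl' j = vl j" "pr' j = pr j" using new mono by (auto split: if_splits)
      moreover have "pr j \<noteq> 0 \<Longrightarrow> vl' (cp (src (pr j))) = vl (cp (src (pr j)))"
        using j le[of "dst (pr j)"] mono(4) unfolding scc_val_def by auto
      ultimately show ?thesis using j unfolding scc_val_def by auto
    qed
  qed
qed (fact scc_inv_conjuncts[OF inv])+

text \<open>Each component on the way contributes at most one symbol. The bound excludes an overflow
  when values are added.\<close>

lemma scc_val_bound:
  assumes "\<And>j. scc_val cp vl pr j"
  shows "vl j \<le> Suc j"
proof (induction j rule: less_induct)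
  case (less j)
  show ?case
  proof (cases "pr j = 0")
    case True
    then show ?thesis using assms[of j] by (auto simp: scc_val_def)
  next
    case False
    then have "cp (src (pr j)) < j" "vl j = vl (cp (src (pr j))) + wt (pr j)"
      using assms[of j] by (auto simp: scc_val_def)
    moreover have "wt (pr j) \<le> 1" by (simp add: wt_def)
    ultimately show ?thesis using less.IH[of "cp (src (pr j))"] by linarith
  qed
qed

lemma walk_append_loop:
  assumes "walk v xs v" "xs \<noteq> []"
  shows "\<exists>ys. walk v ys v \<and> n \<le> length ys"
proof (induction n)
  case 0
  then show ?case using walk_Nil by blast
next
  case (Suc n)
  then obtain ys where "walk v ys v" "n \<le> length ys" by blast
  then have "walk v (xs @ ys) v" "Suc n \<le> length (xs @ ys)"
    using walk_append[OF assms(1)] assms(2) by (cases xs, auto)+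
  then show ?case by blast
qed

section \<open>Longest labels from the completed components\<close>

context
  fixes nx s fs cp vl pr il c cn
  assumes fs: "finish_order s fs" and inv: "scc_inv nx s fs 0 [] cp vl pr il c cn"
begin

lemma scc_final_edge:
  assumes "e \<in> {1..E}" "src e \<in> set fs"
  shows "dst e \<in> set fs" "scc_edge cp vl il e"
proof -
  show d: "dst e \<in> set fs" using fs assms by (auto simp: finish_order_def)
  then obtain i where "i < length fs" "fs ! i = dst e" by (auto simp: in_set_conv_nth)
  then have "cp (dst e) \<noteq> 0" using scc_invD(9)[OF inv, of i] by simp
  then have "c (dst e) = 0" using scc_invD(13)[OF inv] by simp
  then have "e \<notin> pending E dst c" using assms cursor_end by blast
  then show "scc_edge cp vl il e" using scc_invD(1)[OF inv] assms by blast
qed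

lemma scc_final_node: "v \<in> set fs \<longleftrightarrow> cp v \<noteq> 0"
  using scc_invD(7,9)[OF inv] by (metis in_set_conv_nth le0)

lemma scc_source: "s \<in> set fs" "cp s = 1" "vl 1 = 1" "pr 1 = 0"
proof -
  show s: "s \<in> set fs" using fs unfolding finish_order_def by (metis last_in_set)
  then have "cp s \<noteq> 0" using scc_final_node by simp
  then show "cp s = 1" using scc_invD(7,12)[OF inv] by (metis le_zero_eq)
  have "scc_val cp vl pr 1" by (rule scc_invD(2)[OF inv])
  then show "vl 1 = 1" "pr 1 = 0" by (auto simp: scc_val_def)
qed

text \<open>Flags propagate forwards. If \<open>v\<close> is not flagged, then no component on the
  walk is, so inner edges are empty and only the relaxed edges between components contribute
  symbols.\<close>

lemma scc_walk:
  "walk u xs v \<Longrightarrow> u \<in> set fs \<Longrightarrow> v \<in> set fs \<and> cp u \<le> cp v \<and> (il (cp u) \<noteq> 0 \<longrightarrow> il (cp v) \<noteq> 0) \<and>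
     (il (cp v) = 0 \<longrightarrow> vl (cp u) + length xs \<le> vl (cp v))"
proof (induction rule: walk.induct)
  case (walk_Cons e u xs v)
  with scc_final_edge[of e] have e: "dst e \<in> set fs" "scc_edge cp vl il e" by auto
  with walk_Cons have IH: "v \<in> set fs" "cp (dst e) \<le> cp v"
    "il (cp (dst e)) \<noteq> 0 \<longrightarrow> il (cp v) \<noteq> 0"
     "il (cp v) = 0 \<longrightarrow> vl (cp (dst e)) + length xs \<le> vl (cp v)" by auto
  have "il (cp (dst e)) = 0 \<longrightarrow> vl (cp u) + wt e \<le> vl (cp (dst e))"
    using e(2) walk_Cons.hyps(2) unfolding scc_edge_def wt_def
    by (cases "cp (src e) = cp (dst e)") auto
  moreover have "cp u \<le> cp (dst e)" "il (cp u) \<noteq> 0 \<longrightarrow> il (cp (dst e)) \<noteq> 0"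
    using e(2) walk_Cons.hyps(2) unfolding scc_edge_def by (auto simp: le_less)
  ultimately show ?case
    using IH by (auto simp: length_lword_lab)
qed simp

lemma scc_walk_source: "walk s xs v \<Longrightarrow> v \<in> set fs"
  using scc_walk scc_source by blast

text \<open>Either a cycle with a symbol inside the component is repeated, or long walks are
  inherited from an earlier flagged component; strong connectivity carries them to every node of the
  component.\<close>

lemma scc_unbounded:
  "il j \<noteq> 0 \<Longrightarrow> cp v = j \<Longrightarrow> \<exists>xs. walk s xs v \<and> n \<le> length xs"
proof (induction j arbitrary: v rule: less_induct)
  case (less j)
  have j: "0 < j" "scc_inf cp il j" using scc_invD(3)[OF inv] less.prems by blast+
  have same: "\<And>u v. cp u \<noteq> 0 \<Longrightarrow> cp u = cp v \<Longrightarrow> reach u v"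
    by (rule scc_invD(11)[OF inv])
  from j(2) show ?case
    unfolding scc_inf_def
  proof (elim disjE bexE conjE)
    fix e
    assume e: "e \<in> {1..E}" "lab e \<noteq> 0" "cp (src e) = j" "cp (dst e) = j"
    then have "src e \<in> set fs" using j scc_final_node by simp
    then have "reach s (src e)" using fs by (auto simp: finish_order_def)
    then obtain xs where xs: "walk s xs (src e)" unfolding reach_def by blast
    obtain ys where ys: "walk (dst e) ys (src e)"
      using same[of "dst e" "src e"] e j unfolding reach_def by auto
    have "walk (src e) (lword (lab e) @ ys) (src e)" "lword (lab e) @ ys \<noteq> []"
      using walk_append[OF walk_edge[OF e(1)] ys] e(2) by (auto simp: lword_def)
    from walk_append_loop[OF this] obtain zs where zs: "walk (src e) zs (src e)" "n \<le> length zs"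
      by blast
    obtain us where us: "walk (src e) us v"
      using same[of "src e" v] e j less.prems unfolding reach_def by auto
    have "walk s (xs @ zs @ us) v" using walk_append xs zs(1) us by blast
    then show ?thesis using zs(2) by (intro exI[of _ "xs @ zs @ us"]) auto
  next
    fix e
    assume e: "e \<in> {1..E}" "0 < cp (src e)" "cp (src e) < j" "cp (dst e) = j" "il (cp (src e)) \<noteq> 0"
    then obtain xs where xs: "walk s xs (src e)" "n \<le> length xs"
      using less.IH[of "cp (src e)" "src e"] by auto
    obtain us where us: "walk (dst e) us v"
      using same[of "dst e" v] e j less.prems unfolding reach_def by auto
    have "walk s (xs @ lword (lab e) @ us) v"
      using walk_append[OF xs(1) walk_append[OF walk_edge[OF e(1)] us]] .
    then show ?thesis using xs(2) by (intro exI[of _ "xs @ lword (lab e) @ us"]) auto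
  qed
qed

lemma scc_spells:
  "il j = 0 \<Longrightarrow> v \<in> set fs \<Longrightarrow> cp v = j \<Longrightarrow>
   \<exists>d xs. spells cp pr d j xs \<and> d \<le> j \<and> walk s xs v \<and> Suc (length xs) = vl j"
proof (induction j arbitrary: v rule: less_induct)
  case (less j)
  \<comment> \<open>In a component without flag, the inequality of \<open>scc_walk\<close> leaves no
    room for a symbol between two of its nodes.\<close>
  have same: "walk u [] v" if "cp u = j" for u
  proof -
    have j: "cp u \<noteq> 0" using that less.prems scc_final_node by auto
    then have "reach u v" using scc_invD(11)[OF inv, of u v] that less.prems by simp
    then obtain xs where xs: "walk u xs v" unfolding reach_def by blast
    then have "xs = []" using scc_walk[OF xs] j scc_final_node that less.prems by auto
    then show ?thesis using xs by simp
  qed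
  show ?case
  proof (cases "j = 1")
    case True
    then have "walk s [] v" using same scc_source by simp
    then show ?thesis
      using True scc_source by (intro exI[of _ 0] exI[of _ "[]"]) (simp add: spells_0)
  next
    case False
    have "reach s v" using fs less.prems by (auto simp: finish_order_def)
    then obtain ys where "walk s ys v" unfolding reach_def by blast
    \<comment> \<open>A reachable component has a positive value, which rules out the case
      \<open>pr j = 0\<close> of \<open>scc_val\<close>.\<close>
    from scc_walk[OF this scc_source(1)] have "0 < vl j" using scc_source less.prems by auto
    moreover have "scc_val cp vl pr j" by (rule scc_invD(2)[OF inv])
    ultimately have p: "pr j \<in> {1..E}" "0 < cp (src (pr j))" "cp (src (pr j)) < j" "cp (dst (pr j)) = j"
       "vl j = vl (cp (src (pr j))) + wt (pr j)"
      using False unfolding scc_val_def by auto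
    have src: "src (pr j) \<in> set fs" using p scc_final_node by simp
    have "il (cp (src (pr j))) = 0"
      using scc_final_edge(2)[OF p(1) src] p less.prems unfolding scc_edge_def by auto
    from less.IH[OF p(3) this src refl] obtain d xs where d: "spells cp pr d (cp (src (pr j))) xs"
      "d \<le> cp (src (pr j))" "walk s xs (src (pr j))" "Suc (length xs) = vl (cp (src (pr j)))"
      by blast
    have "spells cp pr (Suc d) j (xs @ lword (lab (pr j)))"
      by (rule spells_Suc[OF p(1) d(1)])
    moreover have "walk s (xs @ lword (lab (pr j))) v"
      using walk_append[OF walk_snoc[OF d(3) p(1)] same[OF p(4)]] by simp
    moreover have "Suc d \<le> j" "Suc (length (xs @ lword (lab (pr j)))) = vl j"
      using d p by (simp_all add: length_lword_lab)
    ultimately show ?thesis by blast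
  qed
qed

lemma scc_final:
  assumes "v \<in> set fs" "il (cp v) = 0"
  shows "\<exists>d xs. spells cp pr d (cp v) xs \<and> d \<le> cp v \<and> walk s xs v \<and>
    (\<forall>ys. walk s ys v \<longrightarrow> length ys \<le> length xs)"
proof -
  from scc_spells[OF assms(2,1) refl] obtain d xs where
    xs: "spells cp pr d (cp v) xs" "d \<le> cp v" "walk s xs v" "Suc (length xs) = vl (cp v)"
    by blast
  moreover have "length ys \<le> length xs" if "walk s ys v" for ys
    using scc_walk[OF that scc_source(1)] scc_source assms(2) xs(4) by auto
  ultimately show ?thesis by blast
qed

end

end

section \<open>The programs\<close>

abbreviation (input) seq :: "com \<Rightarrow> com \<Rightarrow> com" (infixr ";;" 60)
  where "c ;; d \<equiv> Seq c d"

text \<open>Scalar variables: \<open>0\<close>--\<open>2\<close> the result; \<open>3\<close> the stride; \<open>4\<close>--\<open>8\<close> the length of the word, the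
  numbers of transitions and of states, the initial and the accepting state; \<open>9\<close> the number of
  edges; \<open>10\<close> the source, which the target succeeds; \<open>11\<close>--\<open>14\<close> layer, index and address of a
  transition, and first node of the layer; \<open>15\<close>--\<open>17\<close> source, target and label of the next edge;
  \<open>20\<close>--\<open>22\<close> the two positions in the queue and its length; \<open>24\<close> the current edge; \<open>26\<close> and \<open>27\<close> the
  lengths of the stack and of the finishing order; \<open>29\<close> the position in this order; \<open>30\<close> the number
  of components; \<open>33\<close> a bound for the length of the word to be spelled.

  Arrays: \<open>0\<close> the input; \<open>1\<close>--\<open>3\<close> source, target and label of the edges; \<open>4\<close>/\<open>5\<close>, \<open>6\<close>/\<open>7\<close> and
  \<open>8\<close>/\<open>9\<close> the links and the heads of the lists of edges by source, by target and by \<open>bfs_key\<close>; \<open>10\<close>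
  visited nodes; \<open>11\<close> queue or stack; \<open>12\<close> the finishing order; \<open>13\<close> the components of the nodes;
  \<open>14\<close> parent edges; \<open>15\<close> and \<open>16\<close> the values and the unboundedness flags of the components; \<open>17\<close>
  the output.\<close>

definition bfs_fetch :: com where
  "bfs_fetch =
     Cond (Op Less (V 20) (V 22))
       (Assign 23 (Op Add (Rd 11 (V 20)) (Rd 11 (V 20))))
       (Assign 23 (Op Add (Op Add (Rd 11 (V 21)) (Rd 11 (V 21))) (N 1)))"

definition bfs_body :: com where
  "bfs_body =
     bfs_fetch ;;
     Assign 24 (Rd 9 (V 23)) ;;
     Cond (V 24)
       (Wr 9 (V 23) (Rd 8 (V 24)) ;;
        Assign 25 (Rd 2 (V 24)) ;;
        Cond (Rd 10 (V 25)) Skip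
          (Wr 10 (V 25) (N 1) ;;
           Wr 14 (V 25) (V 24) ;;
           Wr 11 (V 22) (V 25) ;;
           Assign 22 (Op Add (V 22) (N 1))))
       (Cond (Op Less (V 20) (V 22))
          (Assign 20 (Op Add (V 20) (N 1)))
          (Assign 21 (Op Add (V 21) (N 1))))"

definition dfs_body :: com where
  "dfs_body =
     Assign 28 (Rd 11 (Op Subtract (V 26) (N 1))) ;;
     Assign 24 (Rd 5 (V 28)) ;;
     Cond (V 24)
       (Wr 5 (V 28) (Rd 4 (V 24)) ;;
        Assign 25 (Rd 2 (V 24)) ;;
        Cond (Rd 10 (V 25)) Skip
          (Wr 10 (V 25) (N 1) ;;
           Wr 11 (V 26) (V 25) ;;
           Assign 26 (Op Add (V 26) (N 1))))
       (Assign 26 (Op Subtract (V 26) (N 1)) ;;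
        Wr 12 (V 27) (V 28) ;;
        Assign 27 (Op Add (V 27) (N 1)))"

definition scc_push_code :: com where
  "scc_push_code =
     Cond (Rd 13 (V 25)) Skip
       (Wr 13 (V 25) (V 30) ;;
        Wr 11 (V 26) (V 25) ;;
        Assign 26 (Op Add (V 26) (N 1)))"

definition scc_relax_code :: com where
  "scc_relax_code =
     Assign 31 (Rd 13 (V 25)) ;;
     Cond (Op Equal (V 31) (V 30))
       (Cond (Rd 3 (V 24)) (Wr 16 (V 30) (N 1)) Skip)
       (Assign 32 (Op Add (Rd 15 (V 31)) (Op Less (N 0) (Rd 3 (V 24)))) ;;
        Cond (Op Less (Rd 15 (V 30)) (V 32)) (Wr 15 (V 30) (V 32) ;; Wr 14 (V 30) (V 24)) Skip ;;
        Cond (Rd 16 (V 31)) (Wr 16 (V 30) (N 1)) Skip) ;;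
     Wr 7 (V 28) (Rd 6 (V 24))"

text \<open>One iteration scans an edge, pops a node or moves to the next position of the finishing
  order. This flattens the loops over roots, stack and edges into one.\<close>

definition scc_body :: com where
  "scc_body =
     Cond (V 26)
       (Assign 28 (Rd 11 (Op Subtract (V 26) (N 1))) ;;
        Assign 24 (Rd 7 (V 28)) ;;
        Cond (V 24)
          (Assign 25 (Rd 1 (V 24)) ;;
           Cond (Rd 10 (V 25))
             (scc_push_code ;; scc_relax_code)
             (Wr 7 (V 28) (Rd 6 (V 24))))
          (Assign 26 (Op Subtract (V 26) (N 1))))
       (Assign 29 (Op Subtract (V 29) (N 1)) ;;
        Assign 28 (Rd 12 (V 29)) ;;
        Cond (Rd 13 (V 28)) Skip
          (Assign 30 (Op Add (V 30) (N 1)) ;;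
           Wr 13 (V 28) (V 30) ;;
           Wr 11 (N 0) (V 28) ;;
           Assign 26 (N 1)))"

text \<open>The word is written backwards, since its last symbol is found first.\<close>

definition spell_body :: "exp \<Rightarrow> com" where
  "spell_body cls =
     Cond (Rd 3 (V 24))
       (Assign 1 (Op Subtract (V 1) (N 1)) ;;
        Wr 17 (V 1) (Rd 3 (V 24)) ;;
        Assign 2 (Op Add (V 2) (N 1)))
       Skip ;;
     Assign 24 (Rd 14 cls) ;;
     Assign 33 (Op Subtract (V 33) (N 1))"

text \<open>The bound on \<open>s\<close> leaves room for the keys \<open>bfs_key\<close>, which are
  at most \<open>2 * s + 3\<close>. The links \<open>nxo\<close>, \<open>nxi\<close> and
  \<open>nxc\<close> are parameters because a search moves only the heads of the lists.\<close>

locale graph_program = labelled_graph E src dst lab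
  for E :: nat and src dst lab :: "nat \<Rightarrow> nat" +
  fixes b S s :: nat and nxo nxi nxc :: "nat \<Rightarrow> nat"
  assumes word: "word_ok b S"
    and size: "2 * s + 6 < S" "Suc E < S"
    and nodes: "\<And>e. e \<in> {1..E} \<Longrightarrow> src e < s + 2 \<and> dst e < s + 2"
begin

lemma word_bounds: "S < 2 ^ b" "20 < (2::nat) ^ b" "0 < (2::nat) ^ b"
proof -
  show "S < 2 ^ b" "20 < (2::nat) ^ b"
    using word size by (auto simp: word_ok_def)
  then show "0 < (2::nat) ^ b" by simp
qed

definition graph_store :: "(nat \<Rightarrow> nat) \<Rightarrow> (nat \<Rightarrow> nat \<Rightarrow> nat) \<Rightarrow> bool" where
  "graph_store v a \<longleftrightarrow> v 3 = S \<and> v 9 = E \<and> v 10 = s \<and>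
     a 1 = src \<and> a 2 = dst \<and> a 3 = lab \<and> a 4 = nxo \<and> a 6 = nxi \<and> a 8 = nxc"

section \<open>Breadth-first search on the machine\<close>

definition bfs_store where
  "bfs_store qs D v a \<longleftrightarrow> graph_store v a \<and> v 22 = length qs \<and>
     (\<forall>j < length qs. a 11 j = qs ! j) \<and> (\<forall>u. a 10 u \<noteq> 0 \<longleftrightarrow> u \<in> set qs) \<and>
     (\<forall>u \<in> set qs. u < s + 2) \<and> bfs_inv nxc s qs (v 20) (v 21) (a 9) (a 14) D"

text \<open>An iteration either scans an edge or advances one of the two positions.\<close>

definition bfs_measure :: "store \<Rightarrow> nat" where
  "bfs_measure = (\<lambda>(v, a). (s + 2 - v 20) + (s + 2 - v 21) + card (pending E bfs_key (a 9)))"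

lemma length_nodes:
  assumes "distinct xs" "\<forall>u \<in> set xs. u < s + 2"
  shows "length xs \<le> s + 2"
proof -
  have "set xs \<subseteq> {..<s + 2}" using assms by auto
  then have "card (set xs) \<le> s + 2" using card_mono[of "{..<s + 2}"] by force
  then show ?thesis using distinct_card[OF assms(1)] by simp
qed

text \<open>For each branch, a local fact concluding \<open>R (v', a')\<close> lists the relevant
  entries of the final store. Symbolic execution by \<open>simp\<close> then only has to provide
  these entries. The other loop bodies are treated in the same way.\<close>

lemma wp_bfs_body:
  assumes st: "bfs_store qs D v a" and lt: "v 21 < v 22"
    and post: "\<And>qs D v' a'. bfs_store qs D v' a' \<Longrightarrow> bfs_measure (v', a') < bfs_measure (v, a) \<Longrightarrow>
      R (v', a')"
  shows "wp b S bfs_body R (v, a)"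
proof -
  note d = st[unfolded bfs_store_def graph_store_def]
  have inv: "bfs_inv nxc s qs (v 20) (v 21) (a 9) (a 14) D" using d by blast
  have cu: "cursor E bfs_key nxc (a 9)" and len: "v 21 \<le> v 20" "v 20 \<le> length qs" "distinct qs"
    using inv unfolding bfs_inv_def by blast+
  have NV: "length qs \<le> s + 2"
    using length_nodes len d by blast
  define k where "k = bfs_current qs (v 20) (v 21)"
  have q: "qs ! i < s + 2" if "i < length qs" for i
    using d that by auto
  have qA: "v 20 < length qs \<Longrightarrow> qs ! v 20 < s + 2" and qB: "qs ! v 21 < s + 2"
    using q d lt by auto
  have k_alt: "k = (if v 20 < length qs then qs ! v 20 + qs ! v 20 else qs ! v 21 + qs ! v 21 + 1)"
    by (auto simp: k_def bfs_current_def)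
  have k_lt: "k < S"
    using qA qB size unfolding k_alt by auto
  have fetch: "wp b S bfs_fetch R' (v, a)" if "R' (v(23 := k), a)" for R'
  proof (cases "v 20 < length qs")
    case True
    then have "qs ! v 20 + qs ! v 20 < 2 ^ b" "v 20 < S"
      using qA NV size word_bounds by linarith+
    then show ?thesis
      using that d True by (simp add: bfs_fetch_def k_alt)
  next
    case False
    have "Suc (qs ! v 21 + qs ! v 21) < 2 ^ b" "v 21 < S"
      using qB lt d NV size word_bounds by linarith+
    then show ?thesis
      using that d lt False word_bounds by (simp add: bfs_fetch_def k_alt)
  qed
  let ?p = "a 9 k"
  have p_le: "?p \<le> E"
    using cu by (auto simp: cursor_def)
  show ?thesis
  proof (cases "?p = 0")
    case True
    have advance: "R (v', a')"
      if "\<forall>x \<in> {3, 9, 10, 22}. v' x = v x" "a' = a"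
        "v' 20 = (if v 20 < v 22 then Suc (v 20) else v 20)"
        "v' 21 = (if v 20 < v 22 then v 21 else Suc (v 21))" for v' a'
    proof (cases "v 20 < v 22")
      case T: True
      have "bfs_inv nxc s qs (Suc (v 20)) (v 21) (a 9) (a 14) D"
        using bfs_advance_a[OF inv] True T d by (auto simp: k_def bfs_current_def)
      then have "bfs_store qs D v' a'"
        using that T d by (simp add: bfs_store_def graph_store_def)
      then show ?thesis
        by (rule post) (use that T d NV in \<open>auto simp: bfs_measure_def\<close>)
    next
      case F: False
      then have "v 20 = length qs" using d len by auto
      then have "bfs_inv nxc s qs (v 20) (Suc (v 21)) (a 9) (a 14) D"
        using bfs_advance_b[OF inv] True F d lt by (auto simp: k_def bfs_current_def)
      then have "bfs_store qs D v' a'"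
        using that F d by (simp add: bfs_store_def graph_store_def)
      then show ?thesis
        by (rule post) (use that F d NV lt in \<open>auto simp: bfs_measure_def\<close>)
    qed
    show ?thesis
      unfolding bfs_body_def wp.simps(4)
      by (rule fetch) (insert True lt size word_bounds k_lt d NV, (simp; (intro conjI impI)?; (rule advance)?; simp))
  next
    case False
    note p = cursor_at[OF cu False]
    have dst: "dst ?p < s + 2" using nodes[OF p(1)] by simp
    then have dst_S: "dst ?p < S" "?p < S" "length qs < S" "Suc (length qs) < 2 ^ b"
      using size p_le NV word_bounds by linarith+
    have eqs: "v 22 = length qs" "a 2 = dst" "a 8 = nxc"
      using d by blast+
    note adv = cursor_advance(3)[OF cu False]
    have b: "v 21 < length qs" using d lt by simp
    show ?thesis
    proof (cases "dst ?p \<in> set qs")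
      case True
      then have vis: "a 10 (dst ?p) \<noteq> 0" using d by blast
      have seen: "R (v', a')"
        if "\<forall>x \<in> {3, 9, 10, 20, 21, 22}. v' x = v x"
          "\<forall>j \<in> {1, 2, 3, 4, 6, 8, 10, 11, 14}. a' j = a j"
          "a' 9 = (a 9)(k := nxc ?p)" for v' a'
      proof -
        have "bfs_inv nxc s qs (v 20) (v 21) (a' 9) (a 14) D"
          unfolding that by (rule bfs_seen[OF inv b k_def refl False True])
        then have "bfs_store qs D v' a'"
          using that d by (simp add: bfs_store_def graph_store_def)
        then show ?thesis
          by (rule post) (use that adv in \<open>auto simp: bfs_measure_def\<close>)
      qed
      show ?thesis
        unfolding bfs_body_def wp.simps(4)
        by (rule fetch) (insert False vis eqs word_bounds k_lt dst_S, (simp; (intro conjI impI)?; (rule seen)?; simp))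
    next
      case new: False
      have vis: "a 10 (dst ?p) = 0" using d new by blast
      have new_node: "R (v', a')"
        if "\<forall>x \<in> {3, 9, 10, 20, 21}. v' x = v x" "\<forall>j \<in> {1, 2, 3, 4, 6, 8}. a' j = a j"
          "a' 9 = (a 9)(k := nxc ?p)" "a' 10 = (a 10)(dst ?p := 1)" "a' 14 = (a 14)(dst ?p := ?p)"
          "a' 11 = (a 11)(v 22 := dst ?p)" "v' 22 = Suc (v 22)" for v' a'
      proof -
        have "bfs_inv nxc s (qs @ [dst ?p]) (v 20) (v 21) (a' 9) (a' 14)
            (D(dst ?p := D (src ?p) + wt ?p))"
          unfolding that by (rule bfs_new[OF inv b k_def refl False refl new])
        then have "bfs_store (qs @ [dst ?p]) (D(dst ?p := D (src ?p) + wt ?p)) v' a'"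
          using that d dst by (auto simp: bfs_store_def graph_store_def nth_append less_Suc_eq)
        then show ?thesis
          by (rule post) (use that adv in \<open>auto simp: bfs_measure_def\<close>)
      qed
      show ?thesis
        unfolding bfs_body_def wp.simps(4)
        by (rule fetch) (insert False vis eqs word_bounds k_lt dst_S, (simp; (intro conjI impI)?; (rule new_node)?; simp))
    qed
  qed
qed

lemma bfs_loop:
  "triple b S (\<lambda>(v, a). (\<exists>qs D. bfs_store qs D v a) \<and> bfs_measure (v, a) \<le> M)
     (While (Op Less (V 21) (V 22)) bfs_body) (while_time (Op Less (V 21) (V 22)) bfs_body * Suc M)
     (\<lambda>(v, a). \<exists>qs D. bfs_store qs D v a \<and> v 21 = length qs)"
proof -
  let ?I = "\<lambda>(v, a). \<exists>qs D. bfs_store qs D v a"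
  have "triple b S (\<lambda>s. ?I s \<and> bfs_measure s \<le> M) (While (Op Less (V 21) (V 22)) bfs_body)
      (while_time (Op Less (V 21) (V 22)) bfs_body * Suc M)
      (\<lambda>s. ?I s \<and> exp_val (Op Less (V 21) (V 22)) s = 0)"
  proof (rule triple_While[OF word])
    fix t :: store
    obtain v a where t: "t = (v, a)" by (cases t)
    show "exp_safe b S (Op Less (V 21) (V 22)) t" by simp
    assume "?I t" "exp_val (Op Less (V 21) (V 22)) t \<noteq> 0"
    then obtain qs D where "bfs_store qs D v a" "v 21 < v 22"
      using t by (auto split: if_splits)
    then show "wp b S bfs_body (\<lambda>t'. ?I t' \<and> bfs_measure t' < bfs_measure t) t"
      unfolding t by (rule wp_bfs_body) blast
  qed
  then show ?thesis
  proof (rule triple_conseq)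
    fix t :: store
    assume t: "?I t \<and> exp_val (Op Less (V 21) (V 22)) t = 0"
    obtain v a where va: "t = (v, a)" by (cases t)
    with t obtain qs D where st: "bfs_store qs D v a" "v 22 \<le> v 21"
      by auto
    then have "v 22 = length qs" "v 21 \<le> v 20" "v 20 \<le> length qs"
      unfolding bfs_store_def bfs_inv_def by blast+
    then have "v 21 = length qs"
      using st(2) by simp
    then show "case t of (v, a) \<Rightarrow> \<exists>qs D. bfs_store qs D v a \<and> v 21 = length qs"
      using st(1) va by auto
  qed auto
qed

section \<open>Depth-first search on the machine\<close>

definition dfs_store where
  "dfs_store st fs v a \<longleftrightarrow> graph_store v a \<and> v 26 = length st \<and> v 27 = length fs \<and>
     (\<forall>j < length st. a 11 j = st ! j) \<and> (\<forall>j < length fs. a 12 j = fs ! j) \<and>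
     (\<forall>u. a 10 u \<noteq> 0 \<longleftrightarrow> u \<in> set (st @ fs)) \<and> (\<forall>u \<in> set (st @ fs). u < s + 2) \<and>
     dfs_inv nxo s st fs (a 5) \<and> linked E dst nxi (a 7) \<and>
     a 13 = (\<lambda>_. 0) \<and> a 14 = (\<lambda>_. 0) \<and> a 15 = (\<lambda>_. 0) \<and> a 16 = (\<lambda>_. 0)"

text \<open>Scanning an edge may push one node, hence edges weigh two.\<close>

definition dfs_measure :: "store \<Rightarrow> nat" where
  "dfs_measure = (\<lambda>(v, a). 2 * card (pending E src (a 5)) + v 26)"

lemma wp_dfs_body:
  assumes st: "dfs_store st fs v a" and lt: "v 26 \<noteq> 0"
    and post: "\<And>st fs v' a'. dfs_store st fs v' a' \<Longrightarrow> dfs_measure (v', a') < dfs_measure (v, a) \<Longrightarrow>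
      R (v', a')"
  shows "wp b S dfs_body R (v, a)"
proof -
  note d = st[unfolded dfs_store_def graph_store_def]
  obtain st' u where st': "st = st' @ [u]"
    using lt d by (cases st rule: rev_cases) auto
  have inv: "dfs_inv nxo s (st' @ [u]) fs (a 5)" using d st' by blast
  have cu: "cursor E src nxo (a 5)" and dist: "distinct (st @ fs)"
    using inv unfolding dfs_inv_def st' by blast+
  have NV: "length st + length fs \<le> s + 2"
    using length_nodes[OF dist] d by simp
  have u: "a 11 (length st') = u" "u < s + 2" "v 26 = Suc (length st')"
    using d st' by auto
  let ?p = "a 5 u"
  have p_le: "?p \<le> E"
    using cu by (auto simp: cursor_def)
  have bnd: "u < S" "?p < S" "length st' < S" "Suc (length st') < 2 ^ b" "Suc (Suc (length st')) < 2 ^ b"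
     "Suc (length st') < S"
     "length fs < S" "Suc (length fs) < 2 ^ b"
    using u p_le size word_bounds NV st' by auto
  have eqs: "v 27 = length fs" "a 2 = dst" "a 4 = nxo"
    using d by blast+
  show ?thesis
  proof (cases "?p = 0")
    case True
    have pop: "R (v', a')"
      if "\<forall>x \<in> {3, 9, 10}. v' x = v x"
        "\<forall>j \<in> {1, 2, 3, 4, 5, 6, 7, 8, 10, 11, 13, 14, 15, 16}. a' j = a j"
        "v' 26 = length st'" "v' 27 = Suc (length fs)" "a' 12 = (a 12)(length fs := u)" for v' a'
    proof -
      have "dfs_inv nxo s st' (fs @ [u]) (a 5)"
        by (rule dfs_pop[OF inv True])
      then have "dfs_store st' (fs @ [u]) v' a'"
        using that d st' by (auto simp: dfs_store_def graph_store_def nth_append less_Suc_eq)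
      then show ?thesis
        by (rule post) (use that u in \<open>auto simp: dfs_measure_def\<close>)
    qed
    show ?thesis
      unfolding dfs_body_def
      by (insert True eqs word_bounds bnd u(1,3), (simp; (intro conjI impI)?; (rule pop)?; simp))
  next
    case False
    note p = cursor_at[OF cu False]
    have dst: "dst ?p < s + 2" using nodes[OF p(1)] by simp
    then have dst_S: "dst ?p < S" using size by linarith
    note adv = cursor_advance(3)[OF cu False]
    show ?thesis
    proof (cases "dst ?p \<in> set (st @ fs)")
      case True
      then have vis: "a 10 (dst ?p) \<noteq> 0" using d by blast
      have seen: "R (v', a')"
        if "\<forall>x \<in> {3, 9, 10, 26, 27}. v' x = v x"
          "\<forall>j \<in> {1, 2, 3, 4, 6, 7, 8, 10, 11, 12, 13, 14, 15, 16}. a' j = a j"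
          "a' 5 = (a 5)(u := nxo ?p)" for v' a'
      proof -
        have "dfs_inv nxo s st fs (a' 5)"
          unfolding that st' by (rule dfs_seen[OF inv refl False]) (use True st' in auto)
        then have "dfs_store st fs v' a'"
          using that d by (simp add: dfs_store_def graph_store_def)
        then show ?thesis
          by (rule post) (use that adv in \<open>auto simp: dfs_measure_def\<close>)
      qed
      show ?thesis
        unfolding dfs_body_def
        by (insert False vis eqs word_bounds bnd dst_S u(1,3), (simp; (intro conjI impI)?; (rule seen)?; simp))
    next
      case new: False
      then have vis: "a 10 (dst ?p) = 0" using d by blast
      have new_node: "R (v', a')"
        if "\<forall>x \<in> {3, 9, 10, 27}. v' x = v x"
          "\<forall>j \<in> {1, 2, 3, 4, 6, 7, 8, 12, 13, 14, 15, 16}. a' j = a j"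
          "a' 5 = (a 5)(u := nxo ?p)" "a' 10 = (a 10)(dst ?p := 1)"
          "a' 11 = (a 11)(Suc (length st') := dst ?p)" "v' 26 = Suc (v 26)" for v' a'
      proof -
        have "dfs_inv nxo s (st' @ [u] @ [dst ?p]) fs (a' 5)"
          unfolding that by (rule dfs_new[OF inv refl False refl]) (use new st' in auto)
        then have "dfs_store (st @ [dst ?p]) fs v' a'"
          using that d dst u st' by (auto simp: dfs_store_def graph_store_def nth_append less_Suc_eq)
        then show ?thesis
          by (rule post) (use that adv in \<open>auto simp: dfs_measure_def\<close>)
      qed
      show ?thesis
        unfolding dfs_body_def
        by (insert False vis eqs word_bounds bnd dst_S u(1,3), (simp; (intro conjI impI)?; (rule new_node)?; simp))
    qed
  qed
qed

lemma dfs_loop: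
  "triple b S (\<lambda>(v, a). (\<exists>st fs. dfs_store st fs v a) \<and> dfs_measure (v, a) \<le> M)
     (While (V 26) dfs_body) (while_time (V 26) dfs_body * Suc M)
     (\<lambda>(v, a). \<exists>fs. dfs_store [] fs v a)"
proof -
  let ?I = "\<lambda>(v, a). \<exists>st fs. dfs_store st fs v a"
  have "triple b S (\<lambda>s. ?I s \<and> dfs_measure s \<le> M) (While (V 26) dfs_body)
      (while_time (V 26) dfs_body * Suc M) (\<lambda>s. ?I s \<and> exp_val (V 26) s = 0)"
  proof (rule triple_While[OF word])
    fix t :: store
    obtain v a where t: "t = (v, a)" by (cases t)
    show "exp_safe b S (V 26) t" by simp
    assume "?I t" "exp_val (V 26) t \<noteq> 0"
    then obtain st fs where "dfs_store st fs v a" "v 26 \<noteq> 0"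
      using t by auto
    then show "wp b S dfs_body (\<lambda>t'. ?I t' \<and> dfs_measure t' < dfs_measure t) t"
      unfolding t by (rule wp_dfs_body) blast
  qed
  then show ?thesis
  proof (rule triple_conseq)
    fix t :: store
    assume t: "?I t \<and> exp_val (V 26) t = 0"
    obtain v a where va: "t = (v, a)" by (cases t)
    with t obtain st fs where st: "dfs_store st fs v a" "v 26 = 0"
      by auto
    then have "st = []"
      by (auto simp: dfs_store_def)
    then show "case t of (v, a) \<Rightarrow> \<exists>fs. dfs_store [] fs v a"
      using st(1) va by auto
  qed auto
qed

end

section \<open>Strongly connected components on the machine\<close>

context graph_program
begin

text \<open>Each component uses up a position of the finishing order as its root, whence the bound
  on \<open>v 30 + v 29\<close>; it keeps the component numbers within the arrays.\<close>

definition scc_store where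
  "scc_store fs st v a \<longleftrightarrow> graph_store v a \<and> v 26 = length st \<and>
     (\<forall>j < length st. a 11 j = st ! j) \<and> (\<forall>j < length fs. a 12 j = fs ! j) \<and>
     (\<forall>u. a 10 u \<noteq> 0 \<longleftrightarrow> u \<in> set fs) \<and> (\<forall>u \<in> set fs. u < s + 2) \<and>
     v 30 + v 29 \<le> length fs \<and> finish_order s fs \<and>
     scc_inv nxi s fs (v 29) st (a 13) (a 15) (a 14) (a 16) (a 7) (v 30)"

text \<open>An edge and a new root may each push one node, so pending edges and remaining positions
  weigh two.\<close>

definition scc_measure :: "store \<Rightarrow> nat" where
  "scc_measure = (\<lambda>(v, a). 2 * card (pending E dst (a 7)) + v 26 + 2 * v 29)"

lemma scc_store_bounds:
  assumes st: "scc_store fs st v a"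
  shows "length fs \<le> s + 2" "v 30 + v 29 \<le> s + 2" "st \<noteq> [] \<Longrightarrow> v 29 < length fs"
    "length st \<le> s + 2" "a 13 u \<le> v 30" "a 15 j \<le> Suc j"
    "u \<in> set st \<Longrightarrow> u < s + 2" "u \<notin> set fs \<Longrightarrow> a 13 u = 0"
proof -
  note d = st[unfolded scc_store_def]
  have inv: "scc_inv nxi s fs (v 29) st (a 13) (a 15) (a 14) (a 16) (a 7) (v 30)" using d by blast
  have "distinct fs" using d by (simp add: finish_order_def)
  then show len: "length fs \<le> s + 2" using length_nodes d by blast
  then show "v 30 + v 29 \<le> s + 2" using d by simp
  show "v 29 < length fs" if "st \<noteq> []" using scc_invD(10)[OF inv that] by simp
  have st_fs: "w \<in> set fs" if "w \<in> set st" for w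
  proof -
    have "st \<noteq> []" using that by auto
    then have "a 13 w \<noteq> 0"
      using scc_invD(8)[OF inv that] scc_invD(10)[OF inv] by simp
    then show ?thesis using scc_invD(7)[OF inv] by blast
  qed
  then show "u < s + 2" if "u \<in> set st" using d that by blast
  show "length st \<le> s + 2"
    using length_nodes[OF scc_invD(6)[OF inv]] st_fs d by blast
  show "a 13 u \<le> v 30" using scc_invD(7)[OF inv, of u] by (cases "a 13 u = 0") auto
  show "a 15 j \<le> Suc j" using scc_val_bound[OF scc_invD(2)[OF inv]] .
  show "a 13 u = 0" if "u \<notin> set fs" using scc_invD(7)[OF inv, of u] that by auto
qed

lemma wp_scc_relax_code:
  assumes st: "scc_store fs st v a" and u: "u \<in> set st" "v 28 = u"
    and p: "a 7 u = p" "p \<noteq> 0" "v 24 = p" "v 25 = src p" and x: "a 13 (src p) \<noteq> 0"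
    and post: "\<And>v' a'. scc_store fs st v' a' \<Longrightarrow> v' 26 = v 26 \<Longrightarrow> v' 29 = v 29 \<Longrightarrow>
      card (pending E dst (a' 7)) < card (pending E dst (a 7)) \<Longrightarrow> R (v', a')"
  shows "wp b S scc_relax_code R (v, a)"
proof -
  note d = st[unfolded scc_store_def graph_store_def]
  have inv: "scc_inv nxi s fs (v 29) st (a 13) (a 15) (a 14) (a 16) (a 7) (v 30)" using d by blast
  have eqs: "a 1 = src" "a 2 = dst" "a 3 = lab" "a 6 = nxi"
    using d by blast+
  note e = scc_current_edge[OF inv u(1) p(1,2)]
  have adv: "card (pending E dst ((a 7)(u := nxi p))) < card (pending E dst (a 7))"
    using cursor_advance(3)[OF scc_invD(4)[OF inv], of u] p by simp
  note bs = scc_store_bounds[OF st]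
  let ?cx = "a 13 (src p)" and ?cn = "v 30"
  let ?z = "a 15 ?cx + wt p"
  have src: "src p < s + 2" using nodes[OF e(1)] by simp
  have z: "?z \<le> s + 4"
    using bs(6)[of ?cx] bs(5)[of "src p"] bs(2) by (simp add: wt_def)
  have bnd: "?cx < S" "?cn < S" "src p < S" "p < S" "u < S" "?z < 2 ^ b"
    using bs(2) bs(5)[of "src p"] size src e(1) bs(7)[OF u(1)] z word_bounds by auto
  have wt: "of_bool (0 < lab p) = wt p" by (simp_all add: wt_def)
  show ?thesis
  proof (cases "?cx = ?cn")
    case True
    have inside: "R (v', a')"
      if "\<forall>y \<in> {3, 9, 10, 26, 29, 30}. v' y = v y"
        "\<forall>j \<in> {1, 2, 3, 4, 6, 8, 10, 11, 12, 13, 14, 15}. a' j = a j"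
        "a' 16 = (if lab p = 0 then a 16 else (a 16)(?cn := 1))" "a' 7 = (a 7)(u := nxi p)" for v' a'
    proof -
      have "scc_inv nxi s fs (v 29) st (a 13) (a 15) (a 14) (a' 16) (a' 7) (v 30)"
        unfolding that by (rule scc_inside[OF inv u(1) p(1,2) True refl])
      then have "scc_store fs st v' a'"
        using that d by (simp add: scc_store_def graph_store_def)
      then show ?thesis
        by (rule post) (use that adv in simp_all)
    qed
    show ?thesis
      unfolding scc_relax_code_def
      by (insert True p u(2) eqs word_bounds bnd,
          (simp; (intro conjI impI)?; (rule inside)?; simp))
  next
    case False
    have earlier: "R (v', a')"
      if "\<forall>y \<in> {3, 9, 10, 26, 29, 30}. v' y = v y"
        "\<forall>j \<in> {1, 2, 3, 4, 6, 8, 10, 11, 12, 13}. a' j = a j"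
        "a' 15 = (if a 15 ?cn < ?z then (a 15)(?cn := ?z) else a 15)"
        "a' 14 = (if a 15 ?cn < ?z then (a 14)(?cn := p) else a 14)"
        "a' 16 = (if a 16 ?cx = 0 then a 16 else (a 16)(?cn := 1))" "a' 7 = (a 7)(u := nxi p)" for v' a'
    proof -
      have "scc_inv nxi s fs (v 29) st (a 13) (a' 15) (a' 14) (a' 16) (a' 7) (v 30)"
        unfolding that by (rule scc_earlier[OF inv u(1) p(1,2) x False refl refl refl refl])
      then have "scc_store fs st v' a'"
        using that d by (simp add: scc_store_def graph_store_def)
      then show ?thesis
        by (rule post) (use that adv in simp_all)
    qed
    show ?thesis
      unfolding scc_relax_code_def
      by (cases "a 15 ?cn < ?z"; cases "a 16 ?cx = 0"; insert False p u(2) eqs word_bounds bnd wt,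
          (simp; (intro conjI impI)?; (rule earlier)?; simp))
  qed
qed

lemma wp_scc_push_code:
  assumes st: "scc_store fs st v a" and u: "u \<in> set st" "v 28 = u"
    and p: "a 7 u = p" "p \<noteq> 0" "v 24 = p" "v 25 = src p" and x: "src p \<in> set fs"
    and post: "\<And>st' v' a'. scc_store fs st' v' a' \<Longrightarrow> u \<in> set st' \<Longrightarrow> a' 7 = a 7 \<Longrightarrow> a' 13 (src p) \<noteq> 0 \<Longrightarrow>
      \<forall>y \<in> {24, 25, 28, 29, 30}. v' y = v y \<Longrightarrow> v' 26 \<le> Suc (v 26) \<Longrightarrow> R (v', a')"
  shows "wp b S scc_push_code R (v, a)"
proof -
  note d = st[unfolded scc_store_def graph_store_def]
  have inv: "scc_inv nxi s fs (v 29) st (a 13) (a 15) (a 14) (a 16) (a 7) (v 30)" using d by blast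
  note e = scc_current_edge[OF inv u(1) p(1,2)]
  note bs = scc_store_bounds[OF st]
  have src: "src p < s + 2" using nodes[OF e(1)] by simp
  have bnd: "src p < S" "length st < S" "Suc (length st) < 2 ^ b"
    using bs(4) size src word_bounds by auto
  show ?thesis
  proof (cases "a 13 (src p) = 0")
    case True
    have push: "R (v', a')"
      if "\<forall>y \<in> {3, 9, 10, 24, 25, 28, 29, 30}. v' y = v y"
        "\<forall>j \<in> {1, 2, 3, 4, 6, 7, 8, 10, 12, 14, 15, 16}. a' j = a j"
        "a' 13 = (a 13)(src p := v 30)" "a' 11 = (a 11)(length st := src p)" "v' 26 = Suc (v 26)" for v' a'
    proof -
      have "finish_order s fs" using d by blast
      from scc_push[OF this inv u(1) e(1,2) refl x True]
      have "scc_inv nxi s fs (v 29) (st @ [src p]) (a' 13) (a 15) (a 14) (a 16) (a 7) (v 30)"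
        unfolding that .
      then have "scc_store fs (st @ [src p]) v' a'"
        using that d by (auto simp: scc_store_def graph_store_def nth_append less_Suc_eq)
      then show ?thesis
        by (rule post) (use that u e in simp_all)
    qed
    have v26: "v 26 = length st" using d by blast
    show ?thesis
      unfolding scc_push_code_def
      by (insert True p bnd word_bounds v26,
          (simp; (intro conjI impI)?; (rule push)?; simp))
  next
    case False
    have "R (v, a)"
      by (rule post[OF st u(1) refl False]) simp_all
    then show ?thesis
      unfolding scc_push_code_def using False p bnd by simp
  qed
qed

lemma wp_scc_body:
  assumes st: "scc_store fs st v a" and lt: "v 29 + v 26 \<noteq> 0"
    and post: "\<And>st v' a'. scc_store fs st v' a' \<Longrightarrow> scc_measure (v', a') < scc_measure (v, a) \<Longrightarrow>
      R (v', a')"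
  shows "wp b S scc_body R (v, a)"
proof -
  note d = st[unfolded scc_store_def graph_store_def]
  have inv: "scc_inv nxi s fs (v 29) st (a 13) (a 15) (a 14) (a 16) (a 7) (v 30)" using d by blast
  have fs: "finish_order s fs" using d by blast
  have eqs: "a 1 = src" "a 2 = dst" "a 3 = lab" "a 6 = nxi"
    using d by blast+
  note bs = scc_store_bounds[OF st]
  show ?thesis
  proof (cases "st = []")
    case False
    then obtain st' u where st': "st = st' @ [u]"
      by (cases st rule: rev_cases) auto
    have u: "a 11 (length st') = u" "v 26 = Suc (length st')" "u \<in> set st"
      using d st' by auto
    let ?p = "a 7 u"
    have bnd: "u < S" "length st' < S" "Suc (length st') < 2 ^ b" "?p < S"
      using bs(4) bs(7)[OF u(3)] size word_bounds st' scc_invD(4)[OF inv]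
      by (auto simp: cursor_def intro: le_less_trans)
    show ?thesis
    proof (cases "?p = 0")
      case True
      have pop: "R (v', a')"
        if "\<forall>y \<in> {3, 9, 10, 29, 30}. v' y = v y" "a' = a" "v' 26 = length st'" for v' a'
      proof -
        have "scc_inv nxi s fs (v 29) st' (a 13) (a 15) (a 14) (a 16) (a 7) (v 30)"
          using scc_pop[OF inv[unfolded st'] True] .
        then have "scc_store fs st' v' a'"
          using that d st' by (auto simp: scc_store_def graph_store_def nth_append)
        then show ?thesis
          by (rule post) (use that u in \<open>simp add: scc_measure_def\<close>)
      qed
      show ?thesis
        unfolding scc_body_def
        by (insert True u(1,2) bnd word_bounds, (simp; (intro conjI impI)?; (rule pop)?; simp))
    next
      case p: False
      note e = scc_current_edge[OF inv u(3) refl p]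
      have src: "src ?p < S" using nodes[OF e(1)] size by auto
      have adv: "card (pending E dst ((a 7)(u := nxi ?p))) < card (pending E dst (a 7))"
        using cursor_advance(3)[OF scc_invD(4)[OF inv] p] by simp
      show ?thesis
      proof (cases "src ?p \<in> set fs")
        case True
        then have vis: "a 10 (src ?p) \<noteq> 0" using d by blast
        \<comment> \<open>Pushing adds one to the measure; the edge scanned by the relaxation that
          follows takes off two.\<close>
        have "wp b S scc_push_code (wp b S scc_relax_code R) (v(28 := u, 24 := ?p, 25 := src ?p), a)"
        proof (rule wp_scc_push_code)
          show "scc_store fs st (v(28 := u, 24 := ?p, 25 := src ?p)) a"
            using st by (simp add: scc_store_def graph_store_def)
        next
          fix st1 v1 a1
          assume 1: "scc_store fs st1 v1 a1" "u \<in> set st1" "a1 7 = a 7" "a1 13 (src ?p) \<noteq> 0"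
            "\<forall>y \<in> {24, 25, 28, 29, 30}. v1 y = (v(28 := u, 24 := ?p, 25 := src ?p)) y"
            "v1 26 \<le> Suc ((v(28 := u, 24 := ?p, 25 := src ?p)) 26)"
          show "wp b S scc_relax_code R (v1, a1)"
          proof (rule wp_scc_relax_code[OF 1(1,2)])
            fix v' a'
            assume "scc_store fs st1 v' a'" "v' 26 = v1 26" "v' 29 = v1 29"
              "card (pending E dst (a' 7)) < card (pending E dst (a1 7))"
            then show "R (v', a')"
              by (intro post) (use 1 in \<open>auto simp: scc_measure_def\<close>)
          qed (use 1 p in simp_all)
        qed (use u p True in simp_all)
        then show ?thesis
          unfolding scc_body_def
          using p vis eqs u(1,2) bnd word_bounds src by simp
      next
        case False
        then have vis: "a 10 (src ?p) = 0" using d by blast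
        have outside: "R (v', a')"
          if "\<forall>y \<in> {3, 9, 10, 26, 29, 30}. v' y = v y"
            "\<forall>j \<in> {1, 2, 3, 4, 6, 8, 10, 11, 12, 13, 14, 15, 16}. a' j = a j"
            "a' 7 = (a 7)(u := nxi ?p)" for v' a'
        proof -
          have "scc_inv nxi s fs (v 29) st (a 13) (a 15) (a 14) (a 16) (a' 7) (v 30)"
            unfolding that by (rule scc_outside[OF inv u(3) refl p False])
          then have "scc_store fs st v' a'"
            using that d by (simp add: scc_store_def graph_store_def)
          then show ?thesis
            by (rule post) (use that adv in \<open>simp add: scc_measure_def\<close>)
        qed
        show ?thesis
          unfolding scc_body_def
          by (insert p vis eqs u(1,2) bnd word_bounds src, (simp; (intro conjI impI)?; (rule outside)?; simp))
      qed
    qed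
  next
    case True
    then have v26: "v 26 = 0" and k: "0 < v 29" using d lt by auto
    define k where "k = v 29 - 1"
    have k: "v 29 = Suc k" "k < length fs"
      using k d scc_invD(5)[OF inv] by (auto simp: k_def)
    define u where "u = fs ! k"
    have u: "a 12 k = u" "u < s + 2"
      using d k by (auto simp: u_def)
    have bnd: "u < S" "k < S" "Suc k < 2 ^ b" "Suc (v 30) < 2 ^ b" "0 < S"
      using u bs(1,2) k size word_bounds by auto
    show ?thesis
    proof (cases "a 13 u = 0")
      case False
      have skip: "R (v', a')"
        if "\<forall>y \<in> {3, 9, 10, 26, 30}. v' y = v y" "a' = a" "v' 29 = k" for v' a'
      proof -
        have "scc_inv nxi s fs k [] (a 13) (a 15) (a 14) (a 16) (a 7) (v 30)"
          by (rule scc_skip) (use inv True k False u_def in auto)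
        then have "scc_store fs [] v' a'"
          using that d k True by (simp add: scc_store_def graph_store_def)
        then show ?thesis
          by (rule post) (use that k in \<open>simp add: scc_measure_def\<close>)
      qed
      show ?thesis
        unfolding scc_body_def
        by (insert v26 k(1) False u(1) bnd word_bounds, (simp; (intro conjI impI)?; (rule skip)?; simp))
    next
      case new: True
      have root: "R (v', a')"
        if "\<forall>y \<in> {3, 9, 10}. v' y = v y"
          "\<forall>j \<in> {1, 2, 3, 4, 6, 7, 8, 10, 12, 14, 15, 16}. a' j = a j"
          "a' 13 = (a 13)(u := Suc (v 30))" "a' 11 = (a 11)(0 := u)"
          "v' 29 = k" "v' 30 = Suc (v 30)" "v' 26 = 1" for v' a'
      proof -
        have "scc_inv nxi s fs k [u] ((a 13)(u := Suc (v 30))) (a 15) (a 14) (a 16) (a 7) (Suc (v 30))"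
          by (rule scc_root[where cp = "a 13" and u = u, OF fs _ u_def new]) (use inv True k in simp)
        then have "scc_store fs [u] v' a'"
          using that d k by (simp add: scc_store_def graph_store_def)
        then show ?thesis
          by (rule post) (use that k v26 in \<open>simp add: scc_measure_def\<close>)
      qed
      show ?thesis
        unfolding scc_body_def
        by (insert v26 k(1) new u(1) bnd word_bounds, (simp; (intro conjI impI)?; (rule root)?; simp))
    qed
  qed
qed

lemma scc_loop:
  "triple b S (\<lambda>(v, a). (\<exists>fs st. scc_store fs st v a) \<and> scc_measure (v, a) \<le> M)
     (While (Op Add (V 29) (V 26)) scc_body) (while_time (Op Add (V 29) (V 26)) scc_body * Suc M)
     (\<lambda>(v, a). \<exists>fs. scc_store fs [] v a \<and> v 29 = 0)"
proof -
  let ?I = "\<lambda>(v, a). \<exists>fs st. scc_store fs st v a"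
  have "triple b S (\<lambda>s. ?I s \<and> scc_measure s \<le> M) (While (Op Add (V 29) (V 26)) scc_body)
      (while_time (Op Add (V 29) (V 26)) scc_body * Suc M)
      (\<lambda>s. ?I s \<and> exp_val (Op Add (V 29) (V 26)) s = 0)"
  proof (rule triple_While[OF word])
    fix t :: store
    assume I: "?I t"
    obtain v a where t: "t = (v, a)" by (cases t)
    obtain fs st where st: "scc_store fs st v a" using I t by auto
    have "v 26 = length st" using st by (simp add: scc_store_def)
    then have "v 29 + v 26 < 2 ^ b"
      using scc_store_bounds(2,4)[OF st] size word_bounds by linarith
    then show "exp_safe b S (Op Add (V 29) (V 26)) t" using t by simp
    assume "exp_val (Op Add (V 29) (V 26)) t \<noteq> 0"
    then have "v 29 + v 26 \<noteq> 0" using t by simp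
    with st show "wp b S scc_body (\<lambda>t'. ?I t' \<and> scc_measure t' < scc_measure t) t"
      unfolding t by (rule wp_scc_body) blast
  qed
  then show ?thesis
  proof (rule triple_conseq)
    fix t :: store
    assume t: "?I t \<and> exp_val (Op Add (V 29) (V 26)) t = 0"
    obtain v a where va: "t = (v, a)" by (cases t)
    with t obtain fs st where st: "scc_store fs st v a" "v 26 = 0" "v 29 = 0"
      by auto
    then have "st = []"
      by (auto simp: scc_store_def)
    then show "case t of (v, a) \<Rightarrow> \<exists>fs. scc_store fs [] v a \<and> v 29 = 0"
      using st va by auto
  qed auto
qed

section \<open>Spelling the word along parent edges\<close>

definition spell_store where
  "spell_store cls W v a \<longleftrightarrow> v 3 = S \<and> v 0 = 2 \<and> a 1 = src \<and> a 3 = lab \<and>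
     (\<exists>d j pre suf. spells cls (a 14) d j pre \<and> v 24 = a 14 j \<and> W = pre @ suf \<and>
        v 2 = length suf \<and> v 1 + length suf = s + 2 \<and> d \<le> v 1 \<and> d \<le> v 33 \<and>
        (\<forall>i < length suf. a 17 (v 1 + i) = suf ! i))"

text \<open>The output ends before index \<open>s + 2\<close> and grows downwards. The number
  \<open>d\<close> of parent edges still to be followed bounds the symbols to come, so the write
  position never drops below zero, as well as the remaining iterations.\<close>

lemma wp_spell_body:
  assumes st: "spell_store cls W v a" and lt: "v 24 \<noteq> 0" and v33: "v 33 \<le> s + 2"
    and ce_safe: "\<And>v' a'. v' 24 = v 24 \<Longrightarrow> \<forall>j \<in> {1, 13}. a' j = a j \<Longrightarrow> exp_safe b S ce (v', a')"
    and ce_val: "\<And>v' a'. v' 24 = v 24 \<Longrightarrow> \<forall>j \<in> {1, 13}. a' j = a j \<Longrightarrow>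
      exp_val ce (v', a') = cls (src (v 24))"
    and cls_S: "\<And>u. u < s + 2 \<Longrightarrow> cls u < S"
    and post: "\<And>v' a'. spell_store cls W v' a' \<Longrightarrow> v' 33 < v 33 \<Longrightarrow> v' 33 \<le> s + 2 \<Longrightarrow> a' 13 = a 13 \<Longrightarrow>
      R (v', a')"
  shows "wp b S (spell_body ce) R (v, a)"
proof -
  obtain d j pre suf where w: "spells cls (a 14) d j pre" "v 24 = a 14 j" "W = pre @ suf"
      "v 2 = length suf" "v 1 + length suf = s + 2" "d \<le> v 1" "d \<le> v 33"
      "\<forall>i < length suf. a 17 (v 1 + i) = suf ! i"
    and eqs: "v 3 = S" "v 0 = 2" "a 1 = src" "a 3 = lab"
    using st unfolding spell_store_def by blast
  let ?p = "v 24"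
  from w(1) lt w(2) obtain d' pre' where p: "d = Suc d'" "pre = pre' @ lword (lab ?p)" "?p \<in> {1..E}"
    "spells cls (a 14) d' (cls (src ?p)) pre'"
    by (cases rule: spells.cases) auto
  have bnd: "?p < S" "v 1 < S" "v 1 < 2 ^ b" "Suc (v 2) < 2 ^ b" "v 33 < 2 ^ b" "0 < v 1" "0 < v 33"
    "cls (src ?p) < S"
    using p w size word_bounds v33 cls_S nodes[OF p(3)] by auto
  have step: "R (v', a')"
    if "\<forall>x \<in> {0, 3}. v' x = v x" "\<forall>j \<in> {1, 3, 13, 14}. a' j = a j"
      "v' 24 = a 14 (cls (src ?p))" "v' 33 = v 33 - 1"
      "v' 2 = v 2 + wt ?p" "v' 1 = v 1 - wt ?p"
      "a' 17 = (if lab ?p = 0 then a 17 else (a 17)(v 1 - 1 := lab ?p))" for v' a'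
  proof -
    have len: "length (lword (lab ?p)) = wt ?p" by (simp add: length_lword_lab)
    have "\<forall>i < length (lword (lab ?p) @ suf). a' 17 (v' 1 + i) = (lword (lab ?p) @ suf) ! i"
    proof (cases "lab ?p = 0")
      case True
      then show ?thesis using that w by (simp add: lword_def wt_def)
    next
      case False
      then have v1: "v' 1 = v 1 - 1" "v 1 - 1 + Suc i = v 1 + i" for i
        using that(6) bnd by (auto simp: wt_def)
      show ?thesis
      proof (intro allI impI)
        fix i
        assume i: "i < length (lword (lab ?p) @ suf)"
        show "a' 17 (v' 1 + i) = (lword (lab ?p) @ suf) ! i"
        proof (cases i)
          case 0
          then show ?thesis using that(7) v1 False by (simp add: lword_def)
        next
          case (Suc i')
          then have "i' < length suf" using i False by (simp add: lword_def)
          then have "a 17 (v 1 + i') = suf ! i'" using w(8) by blast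
          moreover have "v 1 + i' \<noteq> v 1 - 1" using bnd by simp
          ultimately show ?thesis
            unfolding Suc v1 that(7) using False by (simp add: lword_def)
        qed
      qed
    qed
    moreover have "W = pre' @ (lword (lab ?p) @ suf)"
      using w p by simp
    moreover have "v' 2 = length (lword (lab ?p) @ suf)" "v' 1 + length (lword (lab ?p) @ suf) = s + 2"
      "d' \<le> v' 1" "d' \<le> v' 33" "wt ?p \<le> 1"
      using that w p len bnd by (auto simp: wt_def)
    ultimately have "spell_store cls W v' a'"
      unfolding spell_store_def using that eqs p(4)
      by (intro conjI exI[of _ d'] exI[of _ "cls (src ?p)"] exI[of _ pre'] exI[of _ "lword (lab ?p) @ suf"]) auto
    then show ?thesis
      by (rule post) (use that bnd v33 in auto)
  qed
  show ?thesis
  proof (cases "lab ?p = 0")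
    case True
    have "wt ?p = 0" using True by (simp add: wt_def)
    show ?thesis
      unfolding spell_body_def
      by (insert \<open>wt ?p = 0\<close> True ce_safe ce_val eqs bnd word_bounds,
          (simp; (intro conjI impI)?; (rule step)?; simp))
  next
    case False
    have "wt ?p = 1" using False by (simp add: wt_def)
    show ?thesis
      unfolding spell_body_def
      by (insert \<open>wt ?p = 1\<close> False ce_safe ce_val eqs bnd word_bounds,
          (simp; (intro conjI impI)?; (rule step)?; simp))
  qed
qed

text \<open>\<open>ce\<close> depends on variable \<open>24\<close> and the arrays \<open>1\<close>
  and \<open>13\<close> only, none of which the body changes before evaluating \<open>ce\<close>.
  \<open>P\<close> carries the knowledge about the component array through the loop.\<close>

lemma spell_loop:
  assumes ce: "\<And>v' a'. spell_store cls W v' a' \<Longrightarrow> P (a' 13) \<Longrightarrow> v' 24 \<noteq> 0 \<Longrightarrow>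
      exp_safe b S ce (v', a') \<and> exp_val ce (v', a') = cls (src (v' 24))"
    and ce_cong: "\<And>v' a' v a. v' 24 = v 24 \<Longrightarrow> \<forall>j \<in> {1, 13}. a' j = a j \<Longrightarrow>
      exp_safe b S ce (v', a') = exp_safe b S ce (v, a) \<and> exp_val ce (v', a') = exp_val ce (v, a)"
    and cls_S: "\<And>u. u < s + 2 \<Longrightarrow> cls u < S"
  shows "triple b S (\<lambda>(v, a). spell_store cls W v a \<and> v 33 \<le> s + 2 \<and> P (a 13))
     (While (V 24) (spell_body ce)) (while_time (V 24) (spell_body ce) * Suc (s + 2))
     (\<lambda>(v, a). spell_store cls W v a \<and> v 24 = 0)"
proof -
  let ?I = "\<lambda>(v, a). spell_store cls W v a \<and> v 33 \<le> s + 2 \<and> P (a 13)"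
  have "triple b S (\<lambda>t. ?I t \<and> fst t 33 \<le> s + 2) (While (V 24) (spell_body ce))
      (while_time (V 24) (spell_body ce) * Suc (s + 2)) (\<lambda>t. ?I t \<and> exp_val (V 24) t = 0)"
  proof (rule triple_While[OF word])
    fix t :: store
    assume I: "?I t"
    obtain v a where t: "t = (v, a)" by (cases t)
    have st: "spell_store cls W v a" "v 33 \<le> s + 2" "P (a 13)" using I t by auto
    show "exp_safe b S (V 24) t" by simp
    assume "exp_val (V 24) t \<noteq> 0"
    then have lt: "v 24 \<noteq> 0" using t by simp
    note c = ce[OF st(1,3) lt]
    show "wp b S (spell_body ce) (\<lambda>t'. ?I t' \<and> fst t' 33 < fst t 33) t"
      unfolding t
    proof (rule wp_spell_body[OF st(1) lt st(2)])
      show "exp_safe b S ce (v', a')" "exp_val ce (v', a') = cls (src (v 24))"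
        if "v' 24 = v 24" "\<forall>j \<in> {1, 13}. a' j = a j" for v' a'
        using c ce_cong[of v' v a' a, OF that] by auto
    qed (use cls_S st(3) in auto)
  qed
  then show ?thesis
    by (rule triple_conseq) auto
qed

end

section \<open>The complete search programs\<close>

lemma triple_ex:
  "(\<And>y. triple b S (\<lambda>s. pre y s) c T (\<lambda>s. post y s)) \<Longrightarrow>
   triple b S (\<lambda>s. \<exists>y. pre y s) c T (\<lambda>s. \<exists>y. post y s)"
  unfolding triple_def by meson

definition min_init :: com where
  "min_init =
     Wr 10 (V 10) (N 1) ;; Wr 11 (N 0) (V 10) ;;
     Assign 20 (N 0) ;; Assign 21 (N 0) ;; Assign 22 (N 1)"

definition spell_init :: com where
  "spell_init =
     Assign 2 (N 0) ;; Assign 1 (Op Add (V 10) (N 2)) ;; Assign 33 (Op Add (V 10) (N 2)) ;;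
     Assign 25 (Op Add (V 10) (N 1))"

definition min_final :: com where
  "min_final =
     Cond (Rd 10 (V 25))
       (Assign 0 (N 2) ;; Assign 24 (Rd 14 (V 25)))
       (Assign 0 (N 0) ;; Assign 24 (N 0))"

definition spell_code :: "exp \<Rightarrow> com" where
  "spell_code cls =
     While (V 24) (spell_body cls) ;;
     Assign 1 (Op Add (Op Mult (N 17) (V 3)) (V 1))"

definition min_code :: com where
  "min_code =
     min_init ;; While (Op Less (V 21) (V 22)) bfs_body ;;
     (spell_init ;; min_final) ;; spell_code (Rd 1 (V 24))"

definition max_init :: com where
  "max_init =
     Wr 10 (V 10) (N 1) ;; Wr 11 (N 0) (V 10) ;; Assign 26 (N 1) ;; Assign 27 (N 0)"

definition scc_init_code :: com where
  "scc_init_code = Wr 15 (N 1) (N 1) ;; Assign 29 (V 27) ;; Assign 30 (N 0)"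

definition max_final :: com where
  "max_final =
     Cond (Rd 10 (V 25))
       (Cond (Rd 16 (Rd 13 (V 25)))
          (Assign 0 (N 1) ;; Assign 24 (N 0))
          (Assign 0 (N 2) ;; Assign 24 (Rd 14 (Rd 13 (V 25)))))
       (Assign 0 (N 0) ;; Assign 24 (N 0))"

definition max_code :: com where
  "max_code =
     max_init ;; While (V 26) dfs_body ;;
     scc_init_code ;; While (Op Add (V 29) (V 26)) scc_body ;;
     (spell_init ;; max_final) ;; spell_code (Rd 13 (Rd 1 (V 24)))"

text \<open>The output is array \<open>17\<close>, so the absolute address in variable
  \<open>1\<close> has the form \<open>17 * S + i\<close>.\<close>

fun stored :: "nat \<Rightarrow> nat answer \<Rightarrow> store \<Rightarrow> bool" where
  "stored S No_Match s \<longleftrightarrow> fst s 0 = 0"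
| "stored S Arbitrarily_Long s \<longleftrightarrow> fst s 0 = 1"
| "stored S (Match u) s \<longleftrightarrow> fst s 0 = 2 \<and> fst s 2 = length u \<and>
     (\<exists>i. fst s 1 = 17 * S + i \<and> i + length u \<le> S \<and> (\<forall>j < length u. snd s 17 (i + j) = u ! j))"

context graph_program
begin

fun walk_answer :: "variant \<Rightarrow> nat answer \<Rightarrow> bool" where
  "walk_answer _ No_Match \<longleftrightarrow> (\<nexists>u. walk s u (s + 1))"
| "walk_answer Min_Variant Arbitrarily_Long \<longleftrightarrow> False"
| "walk_answer Max_Variant Arbitrarily_Long \<longleftrightarrow> (\<forall>n. \<exists>u. walk s u (s + 1) \<and> n \<le> length u)"
| "walk_answer Min_Variant (Match u) \<longleftrightarrow>
     walk s u (s + 1) \<and> (\<forall>y. walk s y (s + 1) \<longrightarrow> length u \<le> length y)"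
| "walk_answer Max_Variant (Match u) \<longleftrightarrow>
     walk s u (s + 1) \<and> (\<forall>y. walk s y (s + 1) \<longrightarrow> length y \<le> length u)"

definition graph_ready :: "store \<Rightarrow> bool" where
  "graph_ready = (\<lambda>(v, a). graph_store v a \<and> linked E src nxo (a 5) \<and> linked E dst nxi (a 7) \<and>
     linked E bfs_key nxc (a 9) \<and> (\<forall>k \<ge> 10. a k = (\<lambda>_. 0)))"

lemma min_init: "triple b S graph_ready min_init (code_size min_init)
    (\<lambda>(v, a). (\<exists>qs D. bfs_store qs D v a) \<and> bfs_measure (v, a) \<le> 2 * s + 4 + E)"
proof (rule triple_conseq[OF triple_wp[OF word]])
  fix t :: store
  assume t: "graph_ready t"
  obtain v a where va: "t = (v, a)" by (cases t)
  note d = t[unfolded va graph_ready_def graph_store_def, simplified]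
  have post: "\<exists>qs D. bfs_store qs D v' a'" "bfs_measure (v', a') \<le> 2 * s + 4 + E"
    if "\<forall>x \<in> {3, 9, 10}. v' x = v x" "\<forall>j \<in> {1, 2, 3, 4, 6, 8, 9, 14}. a' j = a j"
      "v' 20 = 0" "v' 21 = 0" "v' 22 = 1" "a' 10 = (\<lambda>_. 0)(s := 1)"
        "a' 11 = (\<lambda>_. 0)(0 := s)" for v' a'
  proof -
    have "bfs_inv nxc s [s] 0 0 (a 9) (\<lambda>_. 0) (\<lambda>_. 0)"
      by (rule bfs_init) (use d in blast)
    then have "bfs_store [s] (\<lambda>_. 0) v' a'"
      using that d by (simp add: bfs_store_def graph_store_def)
    then show "\<exists>qs D. bfs_store qs D v' a'" by blast
    show "bfs_measure (v', a') \<le> 2 * s + 4 + E"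
      using card_pending[of E bfs_key "a' 9"] that by (simp add: bfs_measure_def)
  qed
  show "wp b S min_init (\<lambda>(v, a). (\<exists>qs D. bfs_store qs D v a) \<and> bfs_measure (v, a) \<le> 2 * s + 4 + E) t"
    unfolding va min_init_def
    using d size word_bounds
    by (simp, intro conjI post; simp)
qed auto

text \<open>With \<open>v 24 = 0\<close> the spelling loop ends at once, so answers without a word
  can share the code. The value of \<open>v 1\<close> makes the final address computation safe in
  these cases, too.\<close>

definition spell_pre :: "(nat \<Rightarrow> nat) \<Rightarrow> nat answer \<Rightarrow> store \<Rightarrow> bool" where
  "spell_pre cls ans = (\<lambda>(v, a). case ans of
      Match W \<Rightarrow> spell_store cls W v a \<and> v 33 \<le> s + 2
    | No_Match \<Rightarrow> v 0 = 0 \<and> v 24 = 0 \<and> v 3 = S \<and> v 1 = s + 2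
    | Arbitrarily_Long \<Rightarrow> v 0 = 1 \<and> v 24 = 0 \<and> v 3 = S \<and> v 1 = s + 2)"

lemma spell_store_edge:
  assumes "spell_store cls W v a" "v 24 \<noteq> 0"
  shows "v 24 \<in> {1..E}"
proof -
  from assms(1) obtain d j pre where "spells cls (a 14) d j pre" "v 24 = a 14 j"
    unfolding spell_store_def by blast
  then show ?thesis using assms(2) by (cases rule: spells.cases) auto
qed

lemma spell_code:
  assumes ce: "\<And>W v' a'. spell_store cls W v' a' \<Longrightarrow> P (a' 13) \<Longrightarrow> v' 24 \<noteq> 0 \<Longrightarrow>
      exp_safe b S ce (v', a') \<and> exp_val ce (v', a') = cls (src (v' 24))"
    and ce_cong: "\<And>v' a' v a. v' 24 = v 24 \<Longrightarrow> \<forall>j \<in> {1, 13}. a' j = a j \<Longrightarrow>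
      exp_safe b S ce (v', a') = exp_safe b S ce (v, a) \<and> exp_val ce (v', a') = exp_val ce (v, a)"
    and cls_S: "\<And>u. u < s + 2 \<Longrightarrow> cls u < S"
  shows "triple b S (\<lambda>(v, a). spell_pre cls ans (v, a) \<and> P (a 13)) (spell_code ce)
     (while_time (V 24) (spell_body ce) * Suc (s + 2) +
      code_size (Assign 1 (Op Add (Op Mult (N 17) (V 3)) (V 1)))) (stored S ans)"
  unfolding spell_code_def
proof (rule triple_Seq)
  let ?mid = "\<lambda>(v, a). case ans of
      Match W \<Rightarrow> spell_store cls W v a \<and> v 24 = 0
    | No_Match \<Rightarrow> v 0 = 0 \<and> v 24 = 0 \<and> v 3 = S \<and> v 1 = s + 2
    | Arbitrarily_Long \<Rightarrow> v 0 = 1 \<and> v 24 = 0 \<and> v 3 = S \<and> v 1 = s + 2"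
  have no_loop: "triple b S (\<lambda>(v, a). v 0 = r \<and> v 24 = 0 \<and> v 3 = S \<and> v 1 = s + 2)
      (While (V 24) (spell_body ce)) (while_time (V 24) (spell_body ce) * Suc (s + 2))
      (\<lambda>(v, a). v 0 = r \<and> v 24 = 0 \<and> v 3 = S \<and> v 1 = s + 2)" for r
  proof (rule triple_conseq)
    let ?I = "\<lambda>(v, a). v 0 = r \<and> v 24 = 0 \<and> v 3 = S \<and> v 1 = s + 2"
    show "triple b S (\<lambda>t. ?I t \<and> (\<lambda>_. 0 :: nat) t \<le> s + 2) (While (V 24) (spell_body ce))
        (while_time (V 24) (spell_body ce) * Suc (s + 2)) (\<lambda>t. ?I t \<and> exp_val (V 24) t = 0)"
      by (rule triple_While[OF word]) auto
  qed auto
  show "triple b S (\<lambda>(v, a). spell_pre cls ans (v, a) \<and> P (a 13)) (While (V 24) (spell_body ce))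
      (while_time (V 24) (spell_body ce) * Suc (s + 2)) ?mid"
  proof (cases ans)
    case No_Match
    show ?thesis by (rule triple_conseq[OF no_loop[of 0]]) (auto simp: spell_pre_def No_Match)
  next
    case Arbitrarily_Long
    show ?thesis by (rule triple_conseq[OF no_loop[of 1]]) (auto simp: spell_pre_def Arbitrarily_Long)
  next
    case (Match W)
    show ?thesis
      by (rule triple_conseq[OF spell_loop[where cls = cls and W = W and P = P, OF ce ce_cong cls_S]])
        (auto simp: spell_pre_def Match)
  qed
  show "triple b S ?mid (Assign 1 (Op Add (Op Mult (N 17) (V 3)) (V 1)))
      (code_size (Assign 1 (Op Add (Op Mult (N 17) (V 3)) (V 1)))) (stored S ans)"
  proof (rule triple_conseq[OF triple_wp[OF word]])
    fix t :: store
    assume t: "?mid t"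
    obtain v a where va: "t = (v, a)" by (cases t)
    have v1: "v 3 = S" "v 1 \<le> s + 2"
      using t by (auto simp: va spell_store_def split: answer.splits)
    have "17 * S + v 1 < 2 ^ b"
      using word v1 size by (simp add: word_ok_def)
    moreover from this have "17 * S < 2 ^ b" by simp
    moreover have "stored S ans (v(1 := 17 * S + v 1), a)"
    proof (cases ans)
      case (Match W)
      then obtain d j pre where p: "spells cls (a 14) d j pre" "v 24 = a 14 j" "v 24 = 0" "v 0 = 2"
        and suf: "\<exists>suf. W = pre @ suf \<and> v 2 = length suf \<and> v 1 + length suf = s + 2 \<and>
          (\<forall>i < length suf. a 17 (v 1 + i) = suf ! i)"
        using t va unfolding spell_store_def by auto
      from p have "pre = []" by (cases rule: spells.cases) auto
      then show ?thesis using suf p(4) size Match by auto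
    qed (use t va in auto)
    ultimately show "wp b S (Assign 1 (Op Add (Op Mult (N 17) (V 3)) (V 1))) (stored S ans) t"
      using va v1 word_bounds by simp
  qed auto
qed

lemma min_final:
  "triple b S (\<lambda>(v, a). \<exists>qs D. bfs_store qs D v a \<and> v 21 = length qs)
     (spell_init ;; min_final) (code_size (spell_init ;; min_final))
     (\<lambda>t. \<exists>ans. walk_answer Min_Variant ans \<and> spell_pre (\<lambda>u. u) ans t)"
proof (rule triple_conseq[OF triple_wp[OF word]])
  fix t :: store
  assume t: "case t of (v, a) \<Rightarrow> \<exists>qs D. bfs_store qs D v a \<and> v 21 = length qs"
  obtain v a where va: "t = (v, a)" by (cases t)
  obtain qs D where st: "bfs_store qs D v a" "v 21 = length qs" using t va by auto
  note d = st(1)[unfolded bfs_store_def graph_store_def]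
  have inv: "bfs_inv nxc s qs (v 20) (v 21) (a 9) (a 14) D" using d by blast
  then have "distinct qs" by (simp add: bfs_inv_def)
  then have len: "length qs \<le> s + 2" using length_nodes d by blast
  note fin = bfs_final[OF inv st(2)]
  let ?R = "\<lambda>t. \<exists>ans. walk_answer Min_Variant ans \<and> spell_pre (\<lambda>u. u) ans t"
  have eqs: "v 3 = S" "v 10 = s" using d by blast+
  have bnd: "Suc s < S" "Suc (Suc s) < 2 ^ b"
    using size word_bounds by auto
  show "wp b S (spell_init ;; min_final) ?R t"
  proof (cases "s + 1 \<in> set qs")
    case True
    then obtain e xs where xs: "spells (\<lambda>v. v) (a 14) e (s + 1) xs" "e \<le> length qs"
      "walk s xs (s + 1)"
      "\<forall>ys. walk s ys (s + 1) \<longrightarrow> length xs \<le> length ys"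
      using fin(2) by blast
    have vis: "a 10 (Suc s) \<noteq> 0" using True d by auto
    have post: "?R (v', a')"
      if "v' 3 = S" "v' 0 = 2" "a' = a" "v' 2 = 0" "v' 1 = Suc (Suc s)" "v' 33 = Suc (Suc s)"
        "v' 24 = a 14 (Suc s)" for v' a'
    proof -
      have "spell_store (\<lambda>u. u) xs v' a'"
        unfolding spell_store_def using that xs len d
        by (intro conjI exI[of _ e] exI[of _ "s + 1"] exI[of _ xs] exI[of _ "[]"]) auto
      then have "spell_pre (\<lambda>u. u) (Match xs) (v', a')"
        using that by (simp add: spell_pre_def)
      then show ?thesis using xs by (intro exI[of _ "Match xs"]) simp
    qed
    show ?thesis
      unfolding va spell_init_def min_final_def
      by (insert vis eqs bnd word_bounds, (simp del: split_paired_Ex; (intro conjI impI)?; (rule post)?; simp))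
  next
    case False
    have vis: "a 10 (Suc s) = 0" using False d by auto
    have post: "?R (v', a')"
      if "v' 3 = S" "v' 0 = 0" "v' 24 = 0" "v' 1 = Suc (Suc s)" for v' a'
      using that fin(1) False by (intro exI[of _ No_Match]) (auto simp: spell_pre_def)
    show ?thesis
      unfolding va spell_init_def min_final_def
      by (insert vis eqs bnd word_bounds, (simp del: split_paired_Ex; (intro conjI impI)?; (rule post)?; simp))
  qed
qed auto

definition min_time :: nat where
  "min_time = code_size min_init + (while_time (Op Less (V 21) (V 22)) bfs_body * Suc (2 * s + 4 + E) +
     (code_size (spell_init ;; min_final) +
      (while_time (V 24) (spell_body (Rd 1 (V 24))) * Suc (s + 2) +
       code_size (Assign 1 (Op Add (Op Mult (N 17) (V 3)) (V 1))))))"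

lemma min_code:
  "triple b S graph_ready min_code min_time
     (\<lambda>t. \<exists>ans. walk_answer Min_Variant ans \<and> stored S ans t)"
  unfolding min_code_def min_time_def
proof (intro triple_Seq)
  show "triple b S (\<lambda>t. \<exists>ans. walk_answer Min_Variant ans \<and> spell_pre (\<lambda>u. u) ans t)
      (spell_code (Rd 1 (V 24)))
      (while_time (V 24) (spell_body (Rd 1 (V 24))) * Suc (s + 2) +
       code_size (Assign 1 (Op Add (Op Mult (N 17) (V 3)) (V 1))))
      (\<lambda>t. \<exists>ans. walk_answer Min_Variant ans \<and> stored S ans t)"
  proof (rule triple_ex, rule triple_pre_store)
    fix ans t
    assume t: "walk_answer Min_Variant ans \<and> spell_pre (\<lambda>u. u) ans t"
    have "triple b S (\<lambda>(v, a). spell_pre (\<lambda>u. u) ans (v, a) \<and> (\<lambda>_. True) (a 13)) (spell_code (Rd 1 (V 24)))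
      (while_time (V 24) (spell_body (Rd 1 (V 24))) * Suc (s + 2) +
       code_size (Assign 1 (Op Add (Op Mult (N 17) (V 3)) (V 1)))) (stored S ans)"
    proof (rule spell_code)
      fix W and v' :: "nat \<Rightarrow> nat" and a' :: "nat \<Rightarrow> nat \<Rightarrow> nat"
      assume st: "spell_store (\<lambda>u. u) W v' a'" "v' 24 \<noteq> 0"
      then have "v' 24 < S" using spell_store_edge size by force
      then show "exp_safe b S (Rd 1 (V 24)) (v', a') \<and> exp_val (Rd 1 (V 24)) (v', a') = src (v' 24)"
        using st by (simp add: spell_store_def)
    next
      fix u
      assume "u < s + 2"
      then show "u < S" using size by simp
    qed simp
    then show "triple b S (\<lambda>s'. s' = t) (spell_code (Rd 1 (V 24)))
      (while_time (V 24) (spell_body (Rd 1 (V 24))) * Suc (s + 2) +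
       code_size (Assign 1 (Op Add (Op Mult (N 17) (V 3)) (V 1))))
      (\<lambda>t. walk_answer Min_Variant ans \<and> stored S ans t)"
      by (rule triple_conseq) (use t in auto)
  qed
qed (rule min_init bfs_loop min_final)+

lemma max_init: "triple b S graph_ready max_init (code_size max_init)
    (\<lambda>(v, a). (\<exists>st fs. dfs_store st fs v a) \<and> dfs_measure (v, a) \<le> Suc (2 * E))"
proof (rule triple_conseq[OF triple_wp[OF word]])
  fix t :: store
  assume t: "graph_ready t"
  obtain v a where va: "t = (v, a)" by (cases t)
  note d = t[unfolded va graph_ready_def graph_store_def, simplified]
  have post: "\<exists>st fs. dfs_store st fs v' a'" "dfs_measure (v', a') \<le> Suc (2 * E)"
    if "\<forall>x \<in> {3, 9, 10}. v' x = v x"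
      "\<forall>j \<in> {1, 2, 3, 4, 5, 6, 7, 8, 13, 14, 15, 16}. a' j = a j"
      "v' 26 = 1" "v' 27 = 0" "a' 10 = (\<lambda>_. 0)(s := 1)" "a' 11 = (\<lambda>_. 0)(0 := s)" for v' a'
  proof -
    have "dfs_inv nxo s [s] [] (a 5)"
      by (rule dfs_init) (use d in blast)
    then have "dfs_store [s] [] v' a'"
      using that d by (simp add: dfs_store_def graph_store_def)
    then show "\<exists>st fs. dfs_store st fs v' a'" by blast
    show "dfs_measure (v', a') \<le> Suc (2 * E)"
      using card_pending[of E src "a' 5"] that by (simp add: dfs_measure_def)
  qed
  show "wp b S max_init (\<lambda>(v, a). (\<exists>st fs. dfs_store st fs v a) \<and> dfs_measure (v, a) \<le> Suc (2 * E)) t"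
    unfolding va max_init_def
    using d size word_bounds
    by (simp, intro conjI post; simp)
qed auto

lemma scc_init_code: "triple b S (\<lambda>(v, a). \<exists>fs. dfs_store [] fs v a) scc_init_code (code_size scc_init_code)
    (\<lambda>(v, a). (\<exists>fs st. scc_store fs st v a) \<and> scc_measure (v, a) \<le> 2 * E + 2 * s + 4)"
proof (rule triple_conseq[OF triple_wp[OF word]])
  fix t :: store
  assume t: "case t of (v, a) \<Rightarrow> \<exists>fs. dfs_store [] fs v a"
  obtain v a where va: "t = (v, a)" by (cases t)
  obtain fs where st: "dfs_store [] fs v a" using t va by auto
  note d = st[unfolded dfs_store_def graph_store_def, simplified]
  have fs: "finish_order s fs" by (rule dfs_final[of nxo _ _ "a 5"]) (use d in blast)
  then have len: "length fs \<le> s + 2"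
    using length_nodes[of fs] d by (simp add: finish_order_def)
  have post: "\<exists>fs st. scc_store fs st v' a'" "scc_measure (v', a') \<le> 2 * E + 2 * s + 4"
    if "\<forall>x \<in> {3, 9, 10, 26}. v' x = v x"
      "\<forall>j \<in> {1, 2, 3, 4, 6, 7, 8, 10, 11, 12, 13, 14, 16}. a' j = a j"
      "v' 29 = length fs" "v' 30 = 0" "a' 15 = (\<lambda>_. 0)(1 := 1)" for v' a'
  proof -
    have "scc_inv nxi s fs (length fs) [] (\<lambda>_. 0) ((\<lambda>_. 0)(1 := 1)) (\<lambda>_. 0) (\<lambda>_. 0) (a 7) 0"
      by (rule scc_init) (use d in blast)
    then have "scc_store fs [] v' a'"
      using that d fs by (simp add: scc_store_def graph_store_def)
    then show "\<exists>fs st. scc_store fs st v' a'" by blast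
    show "scc_measure (v', a') \<le> 2 * E + 2 * s + 4"
      using card_pending[of E dst "a' 7"] that len d by (simp add: scc_measure_def)
  qed
  have eqs: "v 27 = length fs" "a 15 = (\<lambda>_. 0)" "1 < S"
    using d size by simp_all
  show "wp b S scc_init_code (\<lambda>(v, a). (\<exists>fs st. scc_store fs st v a) \<and>
      scc_measure (v, a) \<le> 2 * E + 2 * s + 4) t"
    unfolding va scc_init_code_def
    using eqs word_bounds
    by (simp, intro conjI post; simp)
qed auto

definition comp_pre :: "nat answer \<Rightarrow> store \<Rightarrow> bool" where
  "comp_pre ans = (\<lambda>(v, a). spell_pre (a 13) ans (v, a) \<and> (\<forall>u. a 13 u \<le> s + 2))"

lemma max_final:
  "triple b S (\<lambda>(v, a). \<exists>fs. scc_store fs [] v a \<and> v 29 = 0)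
     (spell_init ;; max_final) (code_size (spell_init ;; max_final))
     (\<lambda>t. \<exists>ans. walk_answer Max_Variant ans \<and> comp_pre ans t)"
proof (rule triple_conseq[OF triple_wp[OF word]])
  fix t :: store
  assume t: "case t of (v, a) \<Rightarrow> \<exists>fs. scc_store fs [] v a \<and> v 29 = 0"
  obtain v a where va: "t = (v, a)" by (cases t)
  obtain fs where st: "scc_store fs [] v a" "v 29 = 0" using t va by auto
  note d = st(1)[unfolded scc_store_def graph_store_def]
  have inv: "scc_inv nxi s fs 0 [] (a 13) (a 15) (a 14) (a 16) (a 7) (v 30)" and fs: "finish_order s fs"
    using d st(2) by auto
  have cp: "a 13 u \<le> s + 2" for u
    using scc_store_bounds(2,5)[OF st(1)] by (meson add_leD1 order_trans)
  let ?R = "\<lambda>t. \<exists>ans. walk_answer Max_Variant ans \<and> comp_pre ans t"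
  have eqs: "v 3 = S" "v 10 = s" using d by blast+
  have bnd: "Suc s < S" "Suc (Suc s) < 2 ^ b" "a 13 (Suc s) < S"
    using size word_bounds cp[of "Suc s"] by auto
  show "wp b S (spell_init ;; max_final) ?R t"
  proof (cases "s + 1 \<in> set fs")
    case True
    then have vis: "a 10 (Suc s) \<noteq> 0" using d by auto
    show ?thesis
    proof (cases "a 16 (a 13 (s + 1)) = 0")
      case il: True
      obtain e xs where xs: "spells (a 13) (a 14) e (a 13 (s + 1)) xs" "e \<le> a 13 (s + 1)"
        "walk s xs (s + 1)"
        "\<forall>ys. walk s ys (s + 1) \<longrightarrow> length ys \<le> length xs"
        using scc_final[OF fs inv True il] by blast
      have post: "?R (v', a')"
        if "v' 3 = S" "v' 0 = 2" "a' = a" "v' 2 = 0" "v' 1 = Suc (Suc s)" "v' 33 = Suc (Suc s)"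
          "v' 24 = a 14 (a 13 (Suc s))" for v' a'
      proof -
        have "spell_store (a 13) xs v' a'"
          unfolding spell_store_def using that xs d cp[of "s + 1"]
          by (intro conjI exI[of _ e] exI[of _ "a 13 (s + 1)"] exI[of _ xs] exI[of _ "[]"]) auto
        then have "comp_pre (Match xs) (v', a')"
          using that cp by (simp add: spell_pre_def comp_pre_def)
        then show ?thesis using xs by (intro exI[of _ "Match xs"]) simp
      qed
      have il': "a 16 (a 13 (Suc s)) = 0" using il by simp
      show ?thesis
        unfolding va spell_init_def max_final_def
        by (insert vis il' eqs bnd word_bounds, (simp del: split_paired_Ex; (intro conjI impI)?; (rule post)?; simp))
    next
      case il: False
      have "\<forall>n. \<exists>xs. walk s xs (s + 1) \<and> n \<le> length xs"
        using scc_unbounded[OF fs inv il refl] by blast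
      then have post: "?R (v', a')"
        if "v' 3 = S" "v' 0 = 1" "v' 24 = 0" "v' 1 = Suc (Suc s)" "a' = a" for v' a'
        using that cp by (intro exI[of _ Arbitrarily_Long]) (auto simp: spell_pre_def comp_pre_def)
      have il': "a 16 (a 13 (Suc s)) \<noteq> 0" using il by simp
      show ?thesis
        unfolding va spell_init_def max_final_def
        by (insert vis il' eqs bnd word_bounds, (simp del: split_paired_Ex; (intro conjI impI)?; (rule post)?; simp))
    qed
  next
    case False
    have vis: "a 10 (Suc s) = 0" using False d by auto
    have post: "?R (v', a')"
      if "v' 3 = S" "v' 0 = 0" "v' 24 = 0" "v' 1 = Suc (Suc s)" "a' = a" for v' a'
      using that scc_walk_source[OF fs inv] False cp
      by (intro exI[of _ No_Match]) (auto simp: spell_pre_def comp_pre_def)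
    show ?thesis
      unfolding va spell_init_def max_final_def
      by (insert vis eqs bnd word_bounds, (simp del: split_paired_Ex; (intro conjI impI)?; (rule post)?; simp))
  qed
qed auto

definition max_time :: nat where
  "max_time = code_size max_init + (while_time (V 26) dfs_body * Suc (Suc (2 * E)) +
     (code_size scc_init_code + (while_time (Op Add (V 29) (V 26)) scc_body * Suc (2 * E + 2 * s + 4) +
     (code_size (spell_init ;; max_final) +
      (while_time (V 24) (spell_body (Rd 13 (Rd 1 (V 24)))) * Suc (s + 2) +
       code_size (Assign 1 (Op Add (Op Mult (N 17) (V 3)) (V 1))))))))"

lemma max_code:
  "triple b S graph_ready max_code max_time
     (\<lambda>t. \<exists>ans. walk_answer Max_Variant ans \<and> stored S ans t)"
  unfolding max_code_def max_time_def
proof (intro triple_Seq)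
  let ?ce = "Rd 13 (Rd 1 (V 24))"
  show "triple b S (\<lambda>t. \<exists>ans. walk_answer Max_Variant ans \<and> comp_pre ans t)
      (spell_code ?ce)
      (while_time (V 24) (spell_body ?ce) * Suc (s + 2) +
       code_size (Assign 1 (Op Add (Op Mult (N 17) (V 3)) (V 1))))
      (\<lambda>t. \<exists>ans. walk_answer Max_Variant ans \<and> stored S ans t)"
  \<comment> \<open>The class function is the content of array \<open>13\<close>; it becomes a fixed
    function once the store is fixed.\<close>
  proof (rule triple_ex, rule triple_pre_store)
    fix ans t
    assume t: "walk_answer Max_Variant ans \<and> comp_pre ans t"
    obtain v a where va: "t = (v, a)" by (cases t)
    have cp: "a 13 u < S" for u
      using t va size by (auto simp: comp_pre_def intro: le_less_trans)
    have "triple b S (\<lambda>(v', a'). spell_pre (a 13) ans (v', a') \<and> (\<lambda>f. f = a 13) (a' 13)) (spell_code ?ce)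
      (while_time (V 24) (spell_body ?ce) * Suc (s + 2) +
       code_size (Assign 1 (Op Add (Op Mult (N 17) (V 3)) (V 1)))) (stored S ans)"
    proof (rule spell_code)
      fix W and v' :: "nat \<Rightarrow> nat" and a' :: "nat \<Rightarrow> nat \<Rightarrow> nat"
      assume st: "spell_store (a 13) W v' a'" "a' 13 = a 13" "v' 24 \<noteq> 0"
      then have e: "v' 24 \<in> {1..E}" using spell_store_edge by blast
      then have "v' 24 < S" "src (v' 24) < S" using size nodes[OF e] by auto
      then show "exp_safe b S ?ce (v', a') \<and> exp_val ?ce (v', a') = a 13 (src (v' 24))"
        using st by (simp add: spell_store_def)
    qed (use cp in simp_all)
    then show "triple b S (\<lambda>s'. s' = t) (spell_code ?ce)
      (while_time (V 24) (spell_body ?ce) * Suc (s + 2) +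
       code_size (Assign 1 (Op Add (Op Mult (N 17) (V 3)) (V 1))))
      (\<lambda>t. walk_answer Max_Variant ans \<and> stored S ans t)"
      by (rule triple_conseq) (use t va in \<open>auto simp: comp_pre_def\<close>)
  qed
qed (rule max_init dfs_loop scc_init_code scc_loop max_final)+

end

section \<open>Building the product graph\<close>

definition emit_code :: com where
  "emit_code =
     Assign 9 (Op Add (V 9) (N 1)) ;;
     Wr 1 (V 9) (V 15) ;; Wr 2 (V 9) (V 16) ;; Wr 3 (V 9) (V 17) ;;
     Wr 4 (V 9) (Rd 5 (V 15)) ;; Wr 5 (V 15) (V 9) ;;
     Wr 6 (V 9) (Rd 7 (V 16)) ;; Wr 7 (V 16) (V 9) ;;
     Assign 18 (Op Add (Op Add (V 15) (V 15)) (Op Less (N 0) (V 17))) ;;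
     Wr 8 (V 9) (Rd 9 (V 18)) ;; Wr 9 (V 18) (V 9)"

lemma wp_Seq: "wp b S (Seq c1 c2) R = wp b S c1 (wp b S c2 R)"
  by (rule ext) simp

definition emit_if :: "exp \<Rightarrow> com" where
  "emit_if c = Cond c emit_code Skip"

text \<open>Walks depend on the set of triples alone, so order and repetitions of the stored edges
  need not be tracked. The arrays from \<open>10\<close> on stay zero for the searches.\<close>

definition edges_inv :: "nat \<Rightarrow> edge set \<Rightarrow> (nat \<Rightarrow> nat) \<Rightarrow> (nat \<Rightarrow> nat \<Rightarrow> nat) \<Rightarrow> bool" where
  "edges_inv M T v a \<longleftrightarrow>
     linked (v 9) (a 1) (a 4) (a 5) \<and> linked (v 9) (a 2) (a 6) (a 7) \<and>
     linked (v 9) (labelled_graph.bfs_key (a 1) (a 3)) (a 8) (a 9) \<and>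
     labelled_graph.edge_set (v 9) (a 1) (a 2) (a 3) = T \<and>
     (\<forall>e \<in> {1..v 9}. a 1 e < M \<and> a 2 e < M) \<and> (\<forall>k \<ge> 10. a k = (\<lambda>_. 0))"

lemma edges_inv_cong:
  "edges_inv M T v a \<Longrightarrow> v' 9 = v 9 \<Longrightarrow> edges_inv M T v' a"
  by (simp add: edges_inv_def)

text \<open>A failed test contributes the empty set. Thus both outcomes share one postcondition, in
  the shape of the comprehensions in \<open>step_edges\<close> and
  \<open>boundary_edges\<close>.\<close>

lemma wp_emit_if:
  assumes inv: "edges_inv M T v a" and c: "exp_safe b S c (v, a)"
    and nodes: "exp_val c (v, a) \<noteq> 0 \<Longrightarrow> v 15 < M \<and> v 16 < M"
    and size: "2 * M + 2 < S" "Suc (v 9) < S" and b: "S < 2 ^ b" "20 < (2::nat) ^ b"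
    and post: "\<And>v' a'. edges_inv M (T \<union> {e. e = (v 15, v 17, v 16) \<and> exp_val c (v, a) \<noteq> 0}) v' a' \<Longrightarrow>
      v' 9 \<le> Suc (v 9) \<Longrightarrow> \<forall>y. y \<noteq> 9 \<and> y \<noteq> 18 \<longrightarrow> v' y = v y \<Longrightarrow> a' 0 = a 0 \<Longrightarrow> R (v', a')"
  shows "wp b S (emit_if c) R (v, a)"
proof (cases "exp_val c (v, a) = 0")
  case True
  then show ?thesis
    unfolding emit_if_def using c post[of v a] inv by simp
next
  case False
  note node = nodes[OF False] size
  let ?E = "v 9" and ?u = "v 15" and ?w = "v 16" and ?l = "v 17"
  let ?k = "?u + ?u + of_bool (0 < ?l)"
  note d = inv[unfolded edges_inv_def]
  have emit: "R (v', a')"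
    if "v' 9 = Suc ?E" "\<forall>y. y \<noteq> 9 \<and> y \<noteq> 18 \<longrightarrow> v' y = v y"
      "a' 0 = a 0" "a' 1 = (a 1)(Suc ?E := ?u)" "a' 2 = (a 2)(Suc ?E := ?w)" "a' 3 = (a 3)(Suc ?E := ?l)"
      "a' 4 = (a 4)(Suc ?E := a 5 ?u)" "a' 5 = (a 5)(?u := Suc ?E)"
      "a' 6 = (a 6)(Suc ?E := a 7 ?w)" "a' 7 = (a 7)(?w := Suc ?E)"
      "a' 8 = (a 8)(Suc ?E := a 9 ?k)" "a' 9 = (a 9)(?k := Suc ?E)"
        "\<forall>k \<ge> 10. a' k = a k" for v' a'
  proof -
    have l1: "linked (v' 9) (a' 1) (a' 4) (a' 5)"
      unfolding that by (rule linked_Suc[where \<kappa> = "a 1"]) (use d in auto)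
    have l2: "linked (v' 9) (a' 2) (a' 6) (a' 7)"
      unfolding that by (rule linked_Suc[where \<kappa> = "a 2"]) (use d in auto)
    have l3: "linked (v' 9) (labelled_graph.bfs_key (a' 1) (a' 3)) (a' 8) (a' 9)"
      unfolding that(1,11,12)
    proof (rule linked_Suc[where \<kappa> = "labelled_graph.bfs_key (a 1) (a 3)"])
      show "linked (v 9) (labelled_graph.bfs_key (a 1) (a 3)) (a 8) (a 9)"
        using d by blast
    qed (use that in \<open>auto simp: labelled_graph.bfs_key_def\<close>)
    have "labelled_graph.edge_set (v' 9) (a' 1) (a' 2) (a' 3) = insert (?u, ?l, ?w) T"
    proof -
      have "(\<lambda>e. (a' 1 e, a' 3 e, a' 2 e)) ` {1..?E} = (\<lambda>e. (a 1 e, a 3 e, a 2 e)) ` {1..?E}"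
        by (rule image_cong) (use that in auto)
      moreover have "{1..Suc ?E} = insert (Suc ?E) {1..?E}" by auto
      ultimately show ?thesis
        using d that by (simp add: labelled_graph.edge_set_def)
    qed
    moreover have "\<forall>e \<in> {1..v' 9}. a' 1 e < M \<and> a' 2 e < M"
      using d that node by (auto simp: le_Suc_eq)
    moreover have "\<forall>k \<ge> 10. a' k = (\<lambda>_. 0)"
      using d that by auto
    ultimately have "edges_inv M (insert (?u, ?l, ?w) T) v' a'"
      unfolding edges_inv_def using l1 l2 l3 by blast
    moreover have "insert (?u, ?l, ?w) T = T \<union> {e. e = (?u, ?l, ?w) \<and> exp_val c (v, a) \<noteq> 0}"
      using False by auto
    ultimately show ?thesis
      using that by (intro post) auto
  qed
  have bnd: "?u < S" "?w < S" "Suc ?E < 2 ^ b" "?k < S" "?k < 2 ^ b" "?u + ?u < 2 ^ b"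
    using node b by auto
  show ?thesis
    unfolding emit_if_def emit_code_def
    by (insert False c bnd size(2) b, (simp; (intro conjI impI)?; (rule emit)?; simp))
qed

text \<open>Every nonzero number counts as true, so a sum expresses a disjunction. For the empty
  word both summands of an extension are \<open>1\<close>.\<close>

fun loop_exp :: "relation \<Rightarrow> exp" where
  "loop_exp Extension = Op Add (Op Equal (V 11) (N 0)) (Op Equal (V 11) (V 4))"
| "loop_exp Left_Extension = Op Equal (V 11) (N 0)"
| "loop_exp Supersequence = N 1"
| "loop_exp _ = N 0"

fun start_exp :: "relation \<Rightarrow> exp" where
  "start_exp Infix = N 1"
| "start_exp _ = Op Equal (V 11) (N 0)"

fun end_exp :: "relation \<Rightarrow> exp" where
  "end_exp Infix = N 1"
| "end_exp Prefix = N 1"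
| "end_exp _ = Op Equal (V 11) (V 4)"

lemma flag_exps:
  assumes "20 < (2::nat) ^ b"
  shows "exp_safe b S (loop_exp x) s" "exp_safe b S (start_exp x) s" "exp_safe b S (end_exp x) s"
    and "exp_val (loop_exp x) s \<le> 2"
    and "exp_val (loop_exp x) s \<noteq> 0 \<longleftrightarrow> loop_at x (fst s 4) (fst s 11)"
    and "exp_val (start_exp x) s \<noteq> 0 \<longleftrightarrow> start_at x (fst s 11)"
    and "exp_val (end_exp x) s \<noteq> 0 \<longleftrightarrow> end_at x (fst s 4) (fst s 11)"
  using assms by (cases x; auto)+

definition step_fetch :: com where
  "step_fetch =
     Assign 19 (Rd 0 (V 13)) ;;
     Assign 17 (Rd 0 (Op Add (V 13) (N 1))) ;;
     Assign 20 (Rd 0 (Op Add (V 13) (N 2))) ;;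
     Assign 15 (Op Add (V 14) (V 19)) ;;
     Assign 16 (Op Add (V 14) (V 20))"

definition loop_cond :: "relation \<Rightarrow> exp" where
  "loop_cond x = Op Add (Op Equal (V 17) (N 0)) (loop_exp x)"

text \<open>A product expresses a conjunction, but both factors are evaluated. At position
  \<open>n\<close> the address read is that of the first transition, and the other factor is
  \<open>0\<close>.\<close>

definition match_cond :: exp where
  "match_cond = Op Mult (Op Less (V 11) (V 4)) (Op Equal (V 17) (Rd 0 (Op Add (V 11) (N 5))))"

definition step_code :: "relation \<Rightarrow> com" where
  "step_code x =
     step_fetch ;;
     emit_if (loop_cond x) ;;
     Assign 16 (Op Add (V 16) (V 6)) ;;
     emit_if match_cond ;;
     (Assign 12 (Op Add (V 12) (N 1)) ;; Assign 13 (Op Add (V 13) (N 3)))"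

definition boundary_code :: "relation \<Rightarrow> com" where
  "boundary_code x =
     (Assign 15 (V 10) ;; Assign 16 (Op Add (V 14) (V 7)) ;; Assign 17 (N 0)) ;;
     emit_if (start_exp x) ;;
     (Assign 15 (Op Add (V 14) (V 8)) ;; Assign 16 (Op Add (V 10) (N 1)) ;; Assign 17 (N 0)) ;;
     emit_if (end_exp x) ;;
     (Assign 11 (Op Add (V 11) (N 1)) ;; Assign 14 (Op Add (V 14) (V 6)) ;;
      Assign 12 (N 0) ;; Assign 13 (Op Add (V 4) (N 5)))"

text \<open>The nested loops over layers and transitions are flattened: after the last transition of
  a layer, its boundary edges are emitted and the next layer begins.\<close>

definition layer_body :: "relation \<Rightarrow> com" where
  "layer_body x = Cond (Op Less (V 12) (V 5)) (step_code x) (boundary_code x)"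

definition skip_body :: com where
  "skip_body =
     (Assign 15 (V 21) ;; Assign 16 (Op Add (V 21) (V 6)) ;; Assign 17 (N 0)) ;;
     emit_if (N 1) ;; Assign 21 (Op Add (V 21) (N 1))"

definition skip_init :: "relation \<Rightarrow> com" where
  "skip_init x = Assign 21 (N 0) ;; Assign 22 (if x = Subsequence then Op Mult (V 4) (V 6) else N 0)"

definition load_input :: com where
  "load_input =
     Assign 4 (Rd 0 (N 0)) ;; Assign 5 (Rd 0 (N 1)) ;; Assign 6 (Rd 0 (N 2)) ;;
     Assign 7 (Rd 0 (N 3)) ;; Assign 8 (Rd 0 (N 4)) ;; Assign 9 (N 0) ;;
     Assign 10 (Op Mult (Op Add (V 4) (N 1)) (V 6)) ;;
     Assign 11 (N 0) ;; Assign 12 (N 0) ;; Assign 13 (Op Add (V 4) (N 5)) ;; Assign 14 (N 0)"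

definition build_code :: "relation \<Rightarrow> com" where
  "build_code x =
     load_input ;; While (Op Less (V 11) (Op Add (V 4) (N 1))) (layer_body x) ;;
     skip_init x ;; While (Op Less (V 21) (V 22)) skip_body"

lemma length_concat_triples: "length (concat (map (\<lambda>(p, l, q). [f p, g l, h q]) ts)) = 3 * length ts"
  by (induction ts) auto

lemma nth_concat_triples:
  assumes "j < length ts" "ts ! j = (p, l, q)"
  shows "concat (map (\<lambda>(p, l, q). [f p, g l, h q]) ts) ! (3 * j) = f p"
    "concat (map (\<lambda>(p, l, q). [f p, g l, h q]) ts) ! (3 * j + 1) = g l"
    "concat (map (\<lambda>(p, l, q). [f p, g l, h q]) ts) ! (3 * j + 2) = h q"
  using assms
proof (induction ts arbitrary: j)
  case (Cons t ts)
  {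
    case 1
    then show ?case using Cons.IH(1)[of "j - 1"] by (cases t; cases j) auto
  next
    case 2
    then show ?case using Cons.IH(2)[of "j - 1"] by (cases t; cases j) auto
  next
    case 3
    then show ?case using Cons.IH(3)[of "j - 1"] by (cases t; cases j) auto
  }
qed auto

section \<open>Layout of the input and size bounds\<close>

locale matching_input =
  fixes b :: nat and x :: relation and w :: "nat list" and A :: "(nat, nat) enfa"
    and ts :: "(nat \<times> nat option \<times> nat) list"
  assumes valid: "valid_input 4 b w A ts"
begin

definition n where "n = length w"
definition m where "m = length ts"
definition Q where "Q = card (states A)"
definition input_length where "input_length = 5 + n + 3 * m"
definition S where "S = input_length * input_length"
definition s where "s = Suc n * Q"
definition inp where "inp i = (if i < input_length then encode_input w A ts ! i else 0)"

lemma enfa: "enfa A" "states A = {..<Q}" "set ts = transitions A" "distinct ts" "trimmed A"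
  using valid by (auto simp: valid_input_def Q_def)

lemma length_encode: "length (encode_input w A ts) = input_length"
  by (simp add: encode_input_def length_concat_triples input_length_def n_def m_def)

lemma size_m: "enfa_size A = m"
  using enfa(3,4) by (simp add: enfa_size_def m_def distinct_card flip: enfa(3))

text \<open>In a trimmed automaton every state other than the initial one is entered by a
  transition.\<close>

lemma Q_le: "Q \<le> Suc m"
proof -
  have "q \<in> insert (initial A) ((\<lambda>(p, l, q). q) ` set ts)" if "q \<in> states A" for q
  proof -
    have last: "enfa_path A p ls q \<Longrightarrow> q = p \<or> q \<in> (\<lambda>(p, l, q). q) ` transitions A" for p ls
    proof (induction rule: enfa_path.induct)
      case (path_Cons p l q ls r)
      then show ?case by force
    qed simp
    from that enfa(5) obtain ls where "enfa_path A (initial A) ls q"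
      by (auto simp: trimmed_def)
    from last[OF this] show ?thesis using enfa(3) by auto
  qed
  then have "states A \<subseteq> insert (initial A) ((\<lambda>(p, l, q). q) ` set ts)" by blast
  then have "Q \<le> card (insert (initial A) ((\<lambda>(p, l, q). q) ` set ts))"
    unfolding Q_def by (intro card_mono) auto
  also have "\<dots> \<le> Suc (card ((\<lambda>(p, l, q). q) ` set ts))"
    by (rule card_insert_le_m1) auto
  also have "\<dots> \<le> Suc (card (set ts))"
    using card_image_le by auto
  finally show ?thesis
    using enfa(4) by (simp add: m_def distinct_card)
qed

lemma s_le: "s \<le> Suc n * Suc m"
  unfolding s_def using Q_le by (rule mult_le_mono2)

text \<open>This is \<open>4 * y * z \<le> (y + z) ^ 2\<close> for \<open>y = n + 1\<close> and
  \<open>z = 3 * m + 3\<close>, since \<open>input_length = y + z + 1\<close>. The stride is a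
  square because the graph has a size proportional to the product of \<open>n + 1\<close> and
  \<open>m + 1\<close>.\<close>

lemma S_bound: "12 * (Suc n * Suc m) + 8 < S"
proof -
  define y z where "y = Suc n" and "z = 3 * Suc m"
  have input_length: "input_length = y + z + 1" by (simp add: input_length_def y_def z_def)
  have "y \<ge> 1" "z \<ge> 3" by (simp_all add: y_def z_def)
  have "4 * (int y * int z) \<le> (int y + int z)\<^sup>2"
    using zero_le_power2[of "int y - int z"] by (simp add: power2_eq_square algebra_simps)
  then have "4 * (y * z) \<le> (y + z) * (y + z)"
    by (simp add: power2_eq_square flip: of_nat_add of_nat_mult)
  moreover have "S = (y + z) * (y + z) + 2 * (y + z) + 1"
    by (simp add: S_def input_length algebra_simps)
  moreover have "8 \<le> 2 * (y + z)"
    using \<open>y \<ge> 1\<close> \<open>z \<ge> 3\<close> by simp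
  ultimately have "4 * (y * z) + 8 < S" by linarith
  then show ?thesis by (simp add: y_def z_def algebra_simps)
qed

lemma S_bounds: "2 * s + 8 < S" "3 * (Suc n * Suc m) + 2 < S" "input_length \<le> S"
  using S_bound s_le by (simp_all add: S_def input_length_def)

text \<open>The origin of \<open>k = 4\<close>: as the input has at least five words, twenty arrays
  of length \<open>input_length ^ 2\<close> need at most \<open>input_length ^ 4\<close>
  addresses.\<close>

lemma word: "word_ok b S"
proof -
  have "20 \<le> input_length * input_length"
    using mult_le_mono[of 5 input_length 5 input_length] by (simp add: input_length_def)
  then have "20 * S \<le> input_length * input_length * S" by simp
  also have "\<dots> = input_length ^ 4" by (simp add: S_def power4_eq_xxxx)
  also have "\<dots> \<le> 2 ^ b"
    using valid by (simp add: valid_input_def length_encode)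
  finally show ?thesis
    using S_bounds by (simp add: word_ok_def)
qed

lemma word_bounds: "S < 2 ^ b" "20 < (2::nat) ^ b"
  using word S_bounds by (auto simp: word_ok_def)

lemma input_head: "inp 0 = n" "inp (Suc 0) = m" "inp 2 = Q" "inp 3 = initial A" "inp 4 = accepting A"
  by (simp_all add: inp_def input_length_def encode_input_def n_def m_def Q_def numeral_eq_Suc)

lemma input_word: "i < n \<Longrightarrow> inp (i + 5) = Suc (w ! i)"
  by (simp add: inp_def input_length_def encode_input_def n_def nth_append)

lemma input_transition:
  assumes "j < m" "ts ! j = (p, l, q)"
  shows "inp (5 + n + 3 * j) = p" "inp (Suc (5 + n + 3 * j)) = label_word l"
    "inp (Suc (Suc (5 + n + 3 * j))) = q"
proof -
  have enc: "encode_input w A ts ! (5 + n + i) = concat (map (\<lambda>(p, l, q). [p, label_word l, q]) ts) ! i" for i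
    by (simp add: encode_input_def n_def nth_append)
  note ts = nth_concat_triples[where f = "\<lambda>p. p"
    and g = label_word and h = "\<lambda>q. q", OF assms(1)[unfolded m_def] assms(2)]
  show "inp (5 + n + 3 * j) = p"
    using enc[of "3 * j"] ts(1) assms(1) by (simp add: inp_def input_length_def)
  show "inp (Suc (5 + n + 3 * j)) = label_word l"
    using enc[of "3 * j + 1"] ts(2) assms(1) by (simp add: inp_def input_length_def)
  show "inp (Suc (Suc (5 + n + 3 * j))) = q"
    using enc[of "3 * j + 2"] ts(3) assms(1) by (simp add: inp_def input_length_def)
qed

section \<open>Step and boundary edges, layer by layer\<close>

definition built where
  "built i j =
     (\<Union>i' < i. (\<Union>t \<in> set ts. step_edges x w Q i' t) \<union>
        boundary_edges x n Q (initial A) (accepting A) i') \<union>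
     (\<Union>t \<in> set (take j ts). step_edges x w Q i t)"

lemma built_step:
  assumes "j < m" "ts ! j = t"
  shows "built i (Suc j) = built i j \<union> step_edges x w Q i t"
  using assms by (auto simp: built_def m_def take_Suc_conv_app_nth)

lemma built_layer:
  "built (Suc i) 0 = built i m \<union> boundary_edges x n Q (initial A) (accepting A) i"
  by (auto simp: built_def m_def lessThan_Suc)

lemma product_edges_built:
  "product_edges x w Q A = built (Suc n) 0 \<union> skip_edges x n Q"
  by (simp add: product_edges_def built_def enfa(3) n_def lessThan_Suc_atMost)

definition input_store where
  "input_store v a \<longleftrightarrow> v 3 = S \<and> v 4 = n \<and> v 5 = m \<and> v 6 = Q \<and> v 7 = initial A \<and>
     v 8 = accepting A \<and> v 10 = s \<and> a 0 = inp"

text \<open>An iteration emits at most two edges, be it for a transition or for the boundary of a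
  layer; this gives the bound on \<open>v 9\<close>.\<close>

definition layer_inv where
  "layer_inv v a \<longleftrightarrow> input_store v a \<and> v 13 = 5 + n + 3 * v 12 \<and> v 14 = v 11 * Q \<and>
     edges_inv (s + 2) (built (v 11) (v 12)) v a \<and> v 9 \<le> 2 * (v 11 * Suc m + v 12) \<and>
     v 11 \<le> Suc n \<and> v 12 \<le> m \<and> (v 11 = Suc n \<longrightarrow> v 12 = 0)"

definition layer_measure :: "store \<Rightarrow> nat" where
  "layer_measure = (\<lambda>(v, a). (Suc n - v 11) * Suc m - v 12)"

lemma layer_count: "i \<le> n \<Longrightarrow> j \<le> m \<Longrightarrow> i * Suc m + j + 1 \<le> Suc n * Suc m"
proof -
  assume "i \<le> n" "j \<le> m"
  then have "i * Suc m \<le> n * Suc m" by (intro mult_le_mono1)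
  then show ?thesis using \<open>j \<le> m\<close> by simp
qed

lemma states_less: "initial A < Q" "accepting A < Q"
  "(p, l, q) \<in> set ts \<Longrightarrow> p < Q \<and> q < Q"
  using enfa by (auto simp: enfa_def)

lemma Q_le_s: "Q \<le> s"
  by (simp add: s_def)

lemma node_bound: "i \<le> n \<Longrightarrow> p < Q \<Longrightarrow> i * Q + p < s"
  unfolding s_def by (rule node_less)

lemma wp_step_code:
  assumes inv: "layer_inv v a" and i: "v 11 \<le> n" and j: "v 12 < m"
    and post: "\<And>v' a'. layer_inv v' a' \<Longrightarrow> layer_measure (v', a') < layer_measure (v, a) \<Longrightarrow> R (v', a')"
  shows "wp b S (step_code x) R (v, a)"
proof -
  note d = inv[unfolded layer_inv_def input_store_def]
  let ?i = "v 11" and ?j = "v 12"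
  obtain p l q where t: "ts ! ?j = (p, l, q)" by (cases "ts ! ?j")
  then have "(p, l, q) \<in> set ts" using j by (metis m_def nth_mem)
  then have pq: "p < Q" "q < Q" using states_less by auto
  note tr = input_transition[OF j t]
  have tp: "v 13 = 5 + n + 3 * ?j" "v 14 = ?i * Q" "a 0 = inp" "v 4 = n" "v 6 = Q" using d by blast+
  have "5 + n + 3 * ?j + 2 < input_length" using j by (simp add: input_length_def)
  then have bnd: "5 + n + 3 * ?j + 2 < S" "?i + 5 < S" using S_bounds i by auto
  have node: "?i * Q + p < s" "?i * Q + q < s" using node_bound i pq by auto
  have cnt: "v 9 + 2 \<le> 2 * (Suc n * Suc m)"
    using layer_count[of ?i ?j] i j d by auto
  then have cnt': "Suc (Suc (v 9)) < S" using S_bound by linarith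
  have fetch: "wp b S step_fetch R1 (v, a)"
    if "\<And>v'. v' 15 = ?i * Q + p \<Longrightarrow> v' 16 = ?i * Q + q \<Longrightarrow> v' 17 = label_word l \<Longrightarrow>
      \<forall>y. y \<notin> {15, 16, 17, 19, 20} \<longrightarrow> v' y = v y \<Longrightarrow> R1 (v', a)" for R1
    unfolding step_fetch_def
    by (insert tp tr bnd word_bounds node S_bounds, (simp; (intro conjI impI)?; (rule that)?; simp))
  show ?thesis
    unfolding step_code_def wp.simps(4)
  proof (rule fetch)
    fix v1
    assume v1: "v1 15 = ?i * Q + p" "v1 16 = ?i * Q + q" "v1 17 = label_word l"
      "\<forall>y. y \<notin> {15, 16, 17, 19, 20} \<longrightarrow> v1 y = v y"
    have T1: "{e. e = (v1 15, v1 17, v1 16) \<and> exp_val (loop_cond x) (v1, a) \<noteq> 0} =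
        {e. e = (?i * Q + p, label_word l, ?i * Q + q) \<and> (l = None \<or> loop_at x n ?i)}"
      using flag_exps(5)[OF word_bounds(2), of x "(v1, a)"] v1 tp
      by (cases l) (auto simp: loop_cond_def)
    show "wp b S (emit_if (loop_cond x)) (wp b S (Assign 16 (Op Add (V 16) (V 6)))
        (wp b S (emit_if match_cond)
          (wp b S (Assign 12 (Op Add (V 12) (N 1))) (wp b S (Assign 13 (Op Add (V 13) (N 3))) R)))) (v1, a)"
    proof (rule wp_emit_if)
      show "edges_inv (s + 2) (built ?i ?j) v1 a"
        using d v1 by (auto intro: edges_inv_cong)
      show "exp_safe b S (loop_cond x) (v1, a)"
      proof -
        have "exp_val (loop_exp x) (v1, a) \<le> 2" by (rule flag_exps(4)[OF word_bounds(2)])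
        then have "Suc (exp_val (loop_exp x) (v1, a)) < 2 ^ b"
          using word_bounds(2) by linarith
        then show ?thesis
          using flag_exps(1)[OF word_bounds(2), where x = x] by (simp add: loop_cond_def)
      qed
      show "v1 15 < s + 2 \<and> v1 16 < s + 2" using node v1 by simp
      show "2 * (s + 2) + 2 < S" "Suc (v1 9) < S" using S_bounds cnt' v1 by auto
    next
      fix v2 a2
      assume 2: "edges_inv (s + 2) (built ?i ?j \<union> {e. e = (v1 15, v1 17, v1 16) \<and>
          exp_val (loop_cond x) (v1, a) \<noteq> 0}) v2 a2"
        "v2 9 \<le> Suc (v1 9)"
          "\<forall>y. y \<noteq> 9 \<and> y \<noteq> 18 \<longrightarrow> v2 y = v1 y" "a2 0 = a 0"
      let ?v3 = "v2(16 := Suc ?i * Q + q)"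
      have eq3: "v2 16 + v2 6 = Suc ?i * Q + q" using 2 v1 tp by simp
      \<comment> \<open>The node number is computed even for the last layer, where it lies beyond
        all layers but still below \<open>2 * s\<close>.\<close>
      have lt3: "Suc ?i * Q + q < 2 ^ b"
        using node(2) Q_le_s S_bounds word_bounds by simp
      have T2: "{e. e = (?v3 15, ?v3 17, ?v3 16) \<and> exp_val match_cond (?v3, a2) \<noteq> 0} =
          {e. e = (?i * Q + p, label_word l, Suc ?i * Q + q) \<and> ?i < n \<and> l = Some (w ! ?i)}"
        using 2 v1 tp input_word[of ?i] by (cases l) (auto simp: match_cond_def)
      have T3: "built ?i ?j \<union> {e. e = (v1 15, v1 17, v1 16) \<and> exp_val (loop_cond x) (v1, a) \<noteq> 0} \<union>
          {e. e = (?v3 15, ?v3 17, ?v3 16) \<and> exp_val match_cond (?v3, a2) \<noteq> 0} = built ?i (Suc ?j)"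
        unfolding T1 T2 built_step[OF j t] step_edges_def by (auto simp: n_def)
      have "wp b S (emit_if match_cond)
          (wp b S (Assign 12 (Op Add (V 12) (N 1))) (wp b S (Assign 13 (Op Add (V 13) (N 3))) R)) (?v3, a2)"
      proof (rule wp_emit_if)
        show "edges_inv (s + 2) (built ?i ?j \<union> {e. e = (v1 15, v1 17, v1 16) \<and>
            exp_val (loop_cond x) (v1, a) \<noteq> 0}) ?v3 a2"
          by (rule edges_inv_cong[OF 2(1)]) simp
        show "exp_safe b S match_cond (?v3, a2)"
          using 2 v1 tp bnd word_bounds by (simp add: match_cond_def)
        \<comment> \<open>A successful test implies \<open>i < n\<close>, so that layer
          \<open>i + 1\<close> exists.\<close>
        show "?v3 15 < s + 2 \<and> ?v3 16 < s + 2" if "exp_val match_cond (?v3, a2) \<noteq> 0"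
        proof -
          have "?i < n" using that 2 v1 tp by (simp add: match_cond_def split: if_splits)
          then show ?thesis using node_bound[of "Suc ?i" q] pq node 2 v1 by simp
        qed
        show "2 * (s + 2) + 2 < S" "Suc (?v3 9) < S" using S_bounds cnt' v1 2 by auto
      next
        fix v4 a4
        assume 4: "edges_inv (s + 2) (built ?i ?j \<union> {e. e = (v1 15, v1 17, v1 16) \<and>
            exp_val (loop_cond x) (v1, a) \<noteq> 0} \<union>
            {e. e = (?v3 15, ?v3 17, ?v3 16) \<and> exp_val match_cond (?v3, a2) \<noteq> 0}) v4 a4"
          "v4 9 \<le> Suc (?v3 9)"
            "\<forall>y. y \<noteq> 9 \<and> y \<noteq> 18 \<longrightarrow> v4 y = ?v3 y" "a4 0 = a2 0"
        have v4: "v4 y = v y" if "y \<notin> {9, 15, 16, 17, 18, 19, 20}" for y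
          using that 4(3) 2(3) v1(4) by simp
        let ?v5 = "v4(12 := Suc ?j, 13 := 5 + n + 3 * Suc ?j)"
        have "edges_inv (s + 2) (built ?i (Suc ?j)) ?v5 a4"
          by (rule edges_inv_cong[OF 4(1)[unfolded T3]]) simp
        then have "layer_inv ?v5 a4"
          using d j i 4(2,4) 2(2,4) v1(4) by (simp add: layer_inv_def input_store_def v4)
        moreover have "Suc ?j \<le> (Suc n - ?i) * Suc m"
        proof -
          have "1 * Suc m \<le> (Suc n - ?i) * Suc m" using i by (intro mult_le_mono1) simp
          then show ?thesis using j by simp
        qed
        then have "layer_measure (?v5, a4) < layer_measure (v, a)"
          by (simp add: layer_measure_def v4 del: mult_Suc_right mult_Suc)
        ultimately have "R (?v5, a4)" by (rule post)
        then show "wp b S (Assign 12 (Op Add (V 12) (N 1))) (wp b S (Assign 13 (Op Add (V 13) (N 3))) R) (v4, a4)"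
          using bnd word_bounds tp j by (simp add: v4 algebra_simps)
      qed (use word_bounds in auto)
      then show "wp b S (Assign 16 (Op Add (V 16) (V 6))) (wp b S (emit_if match_cond)
          (wp b S (Assign 12 (Op Add (V 12) (N 1))) (wp b S (Assign 13 (Op Add (V 13) (N 3))) R))) (v2, a2)"
        using eq3 lt3 by simp
    qed (use word_bounds in auto)
  qed
qed

lemma wp_boundary_code:
  assumes inv: "layer_inv v a" and i: "v 11 \<le> n" and j: "v 12 = m"
    and post: "\<And>v' a'. layer_inv v' a' \<Longrightarrow> layer_measure (v', a') < layer_measure (v, a) \<Longrightarrow> R (v', a')"
  shows "wp b S (boundary_code x) R (v, a)"
proof -
  note d = inv[unfolded layer_inv_def input_store_def]
  let ?i = "v 11"
  let ?T = "built ?i m"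
  have eqs: "v 14 = ?i * Q" "v 4 = n" "v 6 = Q" "v 7 = initial A" "v 8 = accepting A" "v 10 = s"
    using d by blast+
  have node: "?i * Q + initial A < s" "?i * Q + accepting A < s"
    using node_bound i states_less by auto
  have cnt: "v 9 + 2 \<le> 2 * (Suc n * Suc m)"
    using layer_count[of ?i m] i j d by auto
  then have cnt': "Suc (Suc (v 9)) < S" using S_bound by linarith
  have boundary: "boundary_edges x n Q (initial A) (accepting A) ?i =
      {e. e = (s, 0, ?i * Q + initial A) \<and> start_at x ?i} \<union>
      {e. e = (?i * Q + accepting A, 0, s + 1) \<and> end_at x n ?i}"
    unfolding boundary_edges_def s_def ..
  define end_code where "end_code =
    (Assign 11 (Op Add (V 11) (N 1)) ;; Assign 14 (Op Add (V 14) (V 6)) ;;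
      Assign 12 (N 0) ;; Assign 13 (Op Add (V 4) (N 5)))"
  define mid_code where "mid_code =
    (Assign 15 (Op Add (V 14) (V 8)) ;; Assign 16 (Op Add (V 10) (N 1)) ;; Assign 17 (N 0))"
  let ?v1 = "v(15 := s, 16 := ?i * Q + initial A, 17 := 0)"
  have T1: "{e. e = (?v1 15, ?v1 17, ?v1 16) \<and> exp_val (start_exp x) (?v1, a) \<noteq> 0} =
      {e. e = (s, 0, ?i * Q + initial A) \<and> start_at x ?i}"
    using flag_exps(6)[OF word_bounds(2), of x "(?v1, a)"] by auto
  have "wp b S (emit_if (start_exp x)) (wp b S mid_code (wp b S (emit_if (end_exp x)) (wp b S end_code R)))
      (?v1, a)"
  proof (rule wp_emit_if)
    show "edges_inv (s + 2) ?T ?v1 a"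
      using d j by (auto intro: edges_inv_cong)
    show "exp_safe b S (start_exp x) (?v1, a)" by (rule flag_exps[OF word_bounds(2)])
    show "?v1 15 < s + 2 \<and> ?v1 16 < s + 2" using node by simp
    show "2 * (s + 2) + 2 < S" "Suc (?v1 9) < S" using S_bounds cnt' by auto
  next
    fix v2 a2
    assume 2: "edges_inv (s + 2) (?T \<union> {e. e = (?v1 15, ?v1 17, ?v1 16) \<and> exp_val (start_exp x) (?v1, a) \<noteq> 0}) v2 a2"
      "v2 9 \<le> Suc (?v1 9)"
        "\<forall>y. y \<noteq> 9 \<and> y \<noteq> 18 \<longrightarrow> v2 y = ?v1 y" "a2 0 = a 0"
    let ?v3 = "v2(15 := ?i * Q + accepting A, 16 := Suc s, 17 := 0)"
    have T2: "{e. e = (?v3 15, ?v3 17, ?v3 16) \<and> exp_val (end_exp x) (?v3, a2) \<noteq> 0} =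
        {e. e = (?i * Q + accepting A, 0, s + 1) \<and> end_at x n ?i}"
      using flag_exps(7)[OF word_bounds(2), of x "(?v3, a2)"] 2 eqs by auto
    have T3: "?T \<union> {e. e = (?v1 15, ?v1 17, ?v1 16) \<and> exp_val (start_exp x) (?v1, a) \<noteq> 0} \<union>
        {e. e = (?v3 15, ?v3 17, ?v3 16) \<and> exp_val (end_exp x) (?v3, a2) \<noteq> 0} = built (Suc ?i) 0"
      unfolding T1 T2 built_layer boundary by auto
    have "wp b S (emit_if (end_exp x)) (wp b S end_code R) (?v3, a2)"
    proof (rule wp_emit_if)
      show "edges_inv (s + 2) (?T \<union> {e. e = (?v1 15, ?v1 17, ?v1 16) \<and>
          exp_val (start_exp x) (?v1, a) \<noteq> 0}) ?v3 a2"
        by (rule edges_inv_cong[OF 2(1)]) simp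
      show "exp_safe b S (end_exp x) (?v3, a2)" by (rule flag_exps[OF word_bounds(2)])
      show "?v3 15 < s + 2 \<and> ?v3 16 < s + 2" using node by simp
      show "2 * (s + 2) + 2 < S" "Suc (?v3 9) < S" using S_bounds cnt' 2 by auto
    next
      fix v4 a4
      assume 4: "edges_inv (s + 2) (?T \<union> {e. e = (?v1 15, ?v1 17, ?v1 16) \<and>
          exp_val (start_exp x) (?v1, a) \<noteq> 0} \<union>
          {e. e = (?v3 15, ?v3 17, ?v3 16) \<and> exp_val (end_exp x) (?v3, a2) \<noteq> 0}) v4 a4"
        "v4 9 \<le> Suc (?v3 9)"
          "\<forall>y. y \<noteq> 9 \<and> y \<noteq> 18 \<longrightarrow> v4 y = ?v3 y" "a4 0 = a2 0"
      have v4: "v4 y = v y" if "y \<notin> {9, 15, 16, 17, 18}" for y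
        using that 4(3) 2(3) by simp
      let ?v5 = "v4(11 := Suc ?i, 14 := Suc ?i * Q, 12 := 0, 13 := n + 5)"
      have "edges_inv (s + 2) (built (Suc ?i) 0) ?v5 a4"
        by (rule edges_inv_cong[OF 4(1)[unfolded T3]]) simp
      then have "layer_inv ?v5 a4"
        using d j i 4(2,4) 2(2,4) by (simp add: layer_inv_def input_store_def v4)
      moreover have "(Suc n - ?i) * Suc m = (n - ?i) * Suc m + Suc m"
        using i by (simp add: Suc_diff_le)
      then have "layer_measure (?v5, a4) < layer_measure (v, a)"
        using j by (simp add: layer_measure_def v4)
      ultimately have "R (?v5, a4)" by (rule post)
      moreover have "Suc ?i < 2 ^ b" "Suc ?i * Q < 2 ^ b" "n + 5 < 2 ^ b"
        using i S_bounds word_bounds node(1) Q_le_s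
        by (auto simp: input_length_def intro: le_less_trans)
      ultimately show "wp b S end_code R (v4, a4)"
        unfolding end_code_def using word_bounds eqs by (simp add: v4 add.commute)
    qed (use word_bounds in auto)
    moreover have "v2 14 = ?i * Q" "v2 8 = accepting A" "v2 10 = s" "Suc s < 2 ^ b"
      "?i * Q + accepting A < 2 ^ b"
      using 2(3) eqs S_bounds word_bounds node by auto
    ultimately show "wp b S mid_code (wp b S (emit_if (end_exp x)) (wp b S end_code R)) (v2, a2)"
      unfolding mid_code_def using word_bounds by simp
  qed (use word_bounds in auto)
  moreover have "?i * Q + initial A < 2 ^ b"
    using S_bounds word_bounds node by auto
  ultimately show ?thesis
    unfolding boundary_code_def end_code_def[symmetric] mid_code_def[symmetric] wp_Seq
    using eqs word_bounds by simp
qed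

lemma layer_loop:
  "triple b S (\<lambda>(v, a). layer_inv v a \<and> layer_measure (v, a) \<le> M)
     (While (Op Less (V 11) (Op Add (V 4) (N 1))) (layer_body x))
     (while_time (Op Less (V 11) (Op Add (V 4) (N 1))) (layer_body x) * Suc M)
     (\<lambda>(v, a). layer_inv v a \<and> v 11 = Suc n)"
proof -
  let ?I = "\<lambda>(v, a). layer_inv v a" and ?c = "Op Less (V 11) (Op Add (V 4) (N 1))"
  have "triple b S (\<lambda>t. ?I t \<and> layer_measure t \<le> M) (While ?c (layer_body x))
      (while_time ?c (layer_body x) * Suc M) (\<lambda>t. ?I t \<and> exp_val ?c t = 0)"
  proof (rule triple_While[OF word])
    fix t :: store
    assume I: "?I t"
    obtain v a where t: "t = (v, a)" by (cases t)
    have inv: "layer_inv v a" using I t by simp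
    then have v4: "v 4 = n" "v 5 = m" "v 12 \<le> m" by (auto simp: layer_inv_def input_store_def)
    have "Suc n < 2 ^ b" using S_bounds word_bounds by (auto simp: input_length_def)
    then show "exp_safe b S ?c t" using t v4 word_bounds by simp
    assume "exp_val ?c t \<noteq> 0"
    then have i: "v 11 \<le> n" using t v4 by (auto split: if_splits)
    show "wp b S (layer_body x) (\<lambda>t'. ?I t' \<and> layer_measure t' < layer_measure t) t"
    proof (cases "v 12 < m")
      case True
      have "wp b S (step_code x) (\<lambda>t'. ?I t' \<and> layer_measure t' < layer_measure t) t"
        unfolding t by (rule wp_step_code[OF inv i True]) simp
      then show ?thesis unfolding layer_body_def using True t v4 by simp
    next
      case False
      then have "v 12 = m" using v4 by simp
      have "wp b S (boundary_code x) (\<lambda>t'. ?I t' \<and> layer_measure t' < layer_measure t) t"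
        unfolding t by (rule wp_boundary_code[OF inv i \<open>v 12 = m\<close>]) simp
      then show ?thesis unfolding layer_body_def using False t v4 by simp
    qed
  qed
  then show ?thesis
  proof (rule triple_conseq)
    fix t :: store
    assume t: "?I t \<and> exp_val ?c t = 0"
    obtain v a where va: "t = (v, a)" by (cases t)
    then show "case t of (v, a) \<Rightarrow> layer_inv v a \<and> v 11 = Suc n"
      using t by (auto simp: layer_inv_def input_store_def)
  qed auto
qed

section \<open>Skip edges and the completed product graph\<close>

definition skip_inv where
  "skip_inv v a \<longleftrightarrow> input_store v a \<and> v 22 = (if x = Subsequence then n * Q else 0) \<and> v 21 \<le> v 22 \<and>
     edges_inv (s + 2) (built (Suc n) 0 \<union> {(u, 0, u + Q) | u. u < v 21}) v a \<and>
     v 9 \<le> 2 * (Suc n * Suc m) + v 21"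

definition skip_measure :: "store \<Rightarrow> nat" where
  "skip_measure = (\<lambda>(v, a). v 22 - v 21)"

lemma skip_bound: "skip_inv v a \<Longrightarrow> v 22 + Q \<le> s \<and> v 22 \<le> n * Q"
  by (auto simp: skip_inv_def s_def)

lemma wp_skip_body:
  assumes inv: "skip_inv v a" and lt: "v 21 < v 22"
    and post: "\<And>v' a'. skip_inv v' a' \<Longrightarrow> skip_measure (v', a') < skip_measure (v, a) \<Longrightarrow> R (v', a')"
  shows "wp b S skip_body R (v, a)"
proof -
  note d = inv[unfolded skip_inv_def input_store_def]
  let ?u = "v 21"
  let ?T = "built (Suc n) 0 \<union> {(u, 0, u + Q) | u. u < ?u}"
  have node: "?u + Q < s" "?u < s"
    using skip_bound[OF inv] lt by auto
  have "v 9 + 2 < S"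
    using d lt skip_bound[OF inv] s_le S_bounds(2) Q_le_s by (auto simp: algebra_simps)
  then have cnt: "Suc (Suc (v 9)) < S" by simp
  let ?v1 = "v(15 := ?u, 16 := ?u + Q, 17 := 0)"
  have "wp b S (emit_if (N 1)) (wp b S (Assign 21 (Op Add (V 21) (N 1))) R) (?v1, a)"
  proof (rule wp_emit_if)
    show "edges_inv (s + 2) ?T ?v1 a" using d by (auto intro: edges_inv_cong)
    show "exp_safe b S (N 1) (?v1, a)" using word_bounds by simp
    show "?v1 15 < s + 2 \<and> ?v1 16 < s + 2" using node by simp
    show "2 * (s + 2) + 2 < S" "Suc (?v1 9) < S" using S_bounds cnt by auto
  next
    fix v2 a2
    assume 2: "edges_inv (s + 2) (?T \<union> {e. e = (?v1 15, ?v1 17, ?v1 16) \<and> exp_val (N 1) (?v1, a) \<noteq> 0}) v2 a2"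
      "v2 9 \<le> Suc (?v1 9)"
        "\<forall>y. y \<noteq> 9 \<and> y \<noteq> 18 \<longrightarrow> v2 y = ?v1 y" "a2 0 = a 0"
    have v2: "v2 y = v y" if "y \<notin> {9, 15, 16, 17, 18}" for y
      using that 2(3) by simp
    let ?v3 = "v2(21 := Suc ?u)"
    have T: "?T \<union> {e. e = (?v1 15, ?v1 17, ?v1 16) \<and> exp_val (N 1) (?v1, a) \<noteq> 0} =
        built (Suc n) 0 \<union> {(u, 0, u + Q) | u. u < Suc ?u}"
      by (auto simp: less_Suc_eq)
    have "edges_inv (s + 2) (built (Suc n) 0 \<union> {(u, 0, u + Q) | u. u < Suc ?u}) ?v3 a2"
      by (rule edges_inv_cong[OF 2(1)[unfolded T]]) simp
    then have "skip_inv ?v3 a2"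
      using d lt 2(2,4) by (simp add: skip_inv_def input_store_def v2)
    then have "R (?v3, a2)"
      by (rule post) (use lt in \<open>simp add: skip_measure_def v2\<close>)
    then show "wp b S (Assign 21 (Op Add (V 21) (N 1))) R (v2, a2)"
      using node S_bounds word_bounds by (simp add: v2)
  qed (use word_bounds in auto)
  then show ?thesis
    unfolding skip_body_def wp_Seq
    using d node S_bounds word_bounds by simp
qed

lemma skip_loop:
  "triple b S (\<lambda>(v, a). skip_inv v a \<and> skip_measure (v, a) \<le> M)
     (While (Op Less (V 21) (V 22)) skip_body)
     (while_time (Op Less (V 21) (V 22)) skip_body * Suc M)
     (\<lambda>(v, a). skip_inv v a \<and> v 21 = v 22)"
proof -
  let ?I = "\<lambda>(v, a). skip_inv v a" and ?c = "Op Less (V 21) (V 22)"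
  have "triple b S (\<lambda>t. ?I t \<and> skip_measure t \<le> M) (While ?c skip_body)
      (while_time ?c skip_body * Suc M) (\<lambda>t. ?I t \<and> exp_val ?c t = 0)"
  proof (rule triple_While[OF word])
    fix t :: store
    assume I: "?I t"
    obtain v a where t: "t = (v, a)" by (cases t)
    show "exp_safe b S ?c t" by simp
    assume "exp_val ?c t \<noteq> 0"
    then have "skip_inv v a" "v 21 < v 22" using I t by (auto split: if_splits)
    then show "wp b S skip_body (\<lambda>t'. ?I t' \<and> skip_measure t' < skip_measure t) t"
      unfolding t by (rule wp_skip_body) simp
  qed
  then show ?thesis
  proof (rule triple_conseq)
    fix t :: store
    assume t: "?I t \<and> exp_val ?c t = 0"
    obtain v a where va: "t = (v, a)" by (cases t)
    then show "case t of (v, a) \<Rightarrow> skip_inv v a \<and> v 21 = v 22"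
      using t by (auto simp: skip_inv_def)
  qed auto
qed

definition input_ready :: "store \<Rightarrow> bool" where
  "input_ready = (\<lambda>(v, a). v 3 = S \<and> a 0 = inp \<and> (\<forall>k > 0. a k = (\<lambda>_. 0)))"

lemma load_input:
  "triple b S input_ready load_input (code_size load_input)
     (\<lambda>(v, a). layer_inv v a \<and> layer_measure (v, a) \<le> Suc n * Suc m)"
proof (rule triple_conseq[OF triple_wp[OF word]])
  fix t :: store
  assume t: "input_ready t"
  obtain v a where va: "t = (v, a)" by (cases t)
  have d: "v 3 = S" "a 0 = inp" "\<forall>k > 0. a k = (\<lambda>_. 0)"
    using t by (simp_all add: va input_ready_def)
  have post: "layer_inv v' a'" "layer_measure (v', a') \<le> Suc n * Suc m"
    if "v' 3 = S" "v' 4 = n" "v' 5 = m" "v' 6 = Q" "v' 7 = initial A" "v' 8 = accepting A" "v' 9 = 0"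
      "v' 10 = s" "v' 11 = 0" "v' 12 = 0" "v' 13 = n + 5" "v' 14 = 0" "a' = a" for v' a'
  proof -
    have "edges_inv (s + 2) (built 0 0) v' a'"
      using d that linked_0
      by (simp add: edges_inv_def labelled_graph.edge_set_def built_def)
    then show "layer_inv v' a'"
      using that d by (simp add: layer_inv_def input_store_def)
    show "layer_measure (v', a') \<le> Suc n * Suc m"
      using that by (simp add: layer_measure_def)
  qed
  define R where "R = (\<lambda>(v, a). layer_inv v a \<and> layer_measure (v, a) \<le> Suc n * Suc m)"
  have post': "R (v', a')"
    if "v' 3 = S" "v' 4 = n" "v' 5 = m" "v' 6 = Q" "v' 7 = initial A" "v' 8 = accepting A" "v' 9 = 0"
      "v' 10 = s" "v' 11 = 0" "v' 12 = 0" "v' 13 = n + 5" "v' 14 = 0" "a' = a" for v' a'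
    using post[OF that] by (simp add: R_def del: mult_Suc mult_Suc_right)
  have "5 \<le> input_length" by (simp add: input_length_def)
  then have bnd: "4 < S" using S_bounds by simp
  have n: "n + 5 < 2 ^ b"
    using S_bounds(3) word_bounds by (simp add: input_length_def)
  have s: "s < 2 ^ b" "s = Suc n * Q"
    using S_bounds word_bounds by (auto simp: s_def)
  show "wp b S load_input (\<lambda>(v, a). layer_inv v a \<and> layer_measure (v, a) \<le> Suc n * Suc m) t"
    unfolding va load_input_def R_def[symmetric]
    by (insert bnd n s(1)[unfolded s(2)] word_bounds d(1,2) input_head,
        (simp; (intro conjI)?; (rule post')?; simp add: s(2)))
qed auto

lemma skip_init:
  "triple b S (\<lambda>(v, a). layer_inv v a \<and> v 11 = Suc n) (skip_init x) (code_size (skip_init x))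
     (\<lambda>(v, a). skip_inv v a \<and> skip_measure (v, a) \<le> n * Q)"
proof (rule triple_conseq[OF triple_wp[OF word]])
  fix t :: store
  assume t: "case t of (v, a) \<Rightarrow> layer_inv v a \<and> v 11 = Suc n"
  obtain v a where va: "t = (v, a)" by (cases t)
  have d: "layer_inv v a" "v 11 = Suc n" using t va by auto
  then have e: "edges_inv (s + 2) (built (Suc n) 0) v a" "v 9 \<le> 2 * (Suc n * Suc m)" "input_store v a"
    unfolding layer_inv_def by auto
  have post: "skip_inv v' a" "skip_measure (v', a) \<le> n * Q"
    if "\<forall>y. y \<notin> {21, 22} \<longrightarrow> v' y = v y" "v' 21 = 0"
      "v' 22 = (if x = Subsequence then n * Q else 0)" for v'
  proof -
    have "edges_inv (s + 2) (built (Suc n) 0) v' a"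
      by (rule edges_inv_cong[OF e(1)]) (use that in simp)
    then show "skip_inv v' a"
      using that e(2,3) by (auto simp: skip_inv_def input_store_def)
    show "skip_measure (v', a) \<le> n * Q"
      using that by (simp add: skip_measure_def)
  qed
  define R where "R = (\<lambda>(v, a). skip_inv v a \<and> skip_measure (v, a) \<le> n * Q)"
  have post': "R (v', a)"
    if "\<forall>y. y \<notin> {21, 22} \<longrightarrow> v' y = v y" "v' 21 = 0"
      "v' 22 = (if x = Subsequence then n * Q else 0)" for v'
    using post[OF that] by (simp add: R_def)
  have "n * Q \<le> s" by (simp add: s_def)
  then have nQ: "n * Q < 2 ^ b" using S_bounds word_bounds by simp
  have eqs: "v 4 = n" "v 6 = Q" using e(3) by (simp_all add: input_store_def)
  show "wp b S (skip_init x) (\<lambda>(v, a). skip_inv v a \<and> skip_measure (v, a) \<le> n * Q) t"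
    unfolding va skip_init_def R_def[symmetric]
    by (cases "x = Subsequence"; insert nQ eqs word_bounds, (simp; (rule post')?; simp))
qed auto

definition built_store :: "store \<Rightarrow> bool" where
  "built_store = (\<lambda>(v, a). v 3 = S \<and> v 10 = s \<and> edges_inv (s + 2) (product_edges x w Q A) v a \<and>
     v 9 \<le> 3 * (Suc n * Suc m))"

definition build_time :: nat where
  "build_time = code_size load_input +
     (while_time (Op Less (V 11) (Op Add (V 4) (N 1))) (layer_body x) * Suc (Suc n * Suc m) +
      (code_size (skip_init x) + while_time (Op Less (V 21) (V 22)) skip_body * Suc (n * Q)))"

lemma build_code: "triple b S input_ready (build_code x) build_time built_store"
  unfolding build_code_def build_time_def
proof (intro triple_Seq)
  show "triple b S (\<lambda>(v, a). skip_inv v a \<and> skip_measure (v, a) \<le> n * Q)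
      (While (Op Less (V 21) (V 22)) skip_body) (while_time (Op Less (V 21) (V 22)) skip_body * Suc (n * Q))
      built_store"
  proof (rule triple_conseq[OF skip_loop])
    fix t :: store
    assume t: "case t of (v, a) \<Rightarrow> skip_inv v a \<and> v 21 = v 22"
    obtain v a where va: "t = (v, a)" by (cases t)
    have d: "skip_inv v a" "v 21 = v 22" using t va by auto
    have "product_edges x w Q A = built (Suc n) 0 \<union> {(u, 0, u + Q) | u. u < v 21}"
      unfolding product_edges_built skip_edges_def using d by (auto simp: skip_inv_def)
    \<comment> \<open>At most \<open>n * Q\<close> edges are added, and
      \<open>Q \<le> Suc m\<close>; together with the two edges per iteration of the layer loop this
      gives the factor \<open>3\<close>.\<close>
    moreover have "v 21 \<le> Suc n * Suc m"
      using skip_bound[OF d(1)] d(2) s_le by linarith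
    ultimately show "built_store t"
      using d va by (auto simp: built_store_def skip_inv_def input_store_def)
  qed auto
qed (rule load_input layer_loop skip_init)+

end

section \<open>The complexity bound\<close>

fun search_code :: "variant \<Rightarrow> com" where
  "search_code Min_Variant = min_code"
| "search_code Max_Variant = max_code"

definition build_const :: "relation \<Rightarrow> nat" where
  "build_const x = code_size load_input +
     (while_time (Op Less (V 11) (Op Add (V 4) (N 1))) (layer_body x) * 2 +
      (code_size (skip_init x) + while_time (Op Less (V 21) (V 22)) skip_body * 2))"

definition spell_const :: "exp \<Rightarrow> nat" where
  "spell_const ce = while_time (V 24) (spell_body ce) * 4 +
     code_size (Assign 1 (Op Add (Op Mult (N 17) (V 3)) (V 1)))"

text \<open>The factors come from \<open>s \<le> y\<close>, \<open>E \<le> 3 * y\<close> and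
  \<open>1 \<le> y\<close> with \<open>y = Suc n * Suc m\<close>, where \<open>E\<close> is the
  number of edges. For instance, \<open>Suc (2 * s + 4 + E) \<le> 10 * y\<close>.\<close>

fun search_const :: "variant \<Rightarrow> nat" where
  "search_const Min_Variant =
     code_size min_init + (while_time (Op Less (V 21) (V 22)) bfs_body * 10 +
     (code_size (spell_init ;; min_final) + spell_const (Rd 1 (V 24))))"
| "search_const Max_Variant =
     code_size max_init + (while_time (V 26) dfs_body * 8 +
     (code_size scc_init_code + (while_time (Op Add (V 29) (V 26)) scc_body * 13 +
     (code_size (spell_init ;; max_final) + spell_const (Rd 13 (Rd 1 (V 24)))))))"

lemma const_le: "1 \<le> (y::nat) \<Longrightarrow> c \<le> c * y"
  by simp

text \<open>The stride \<open>(5 + n + 3 * m)\<^sup>2\<close> exceeds every index that occurs.\<close>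

definition stride_code :: "instr list" where
  "stride_code = [Const 4 0, Load 4 4, Const 5 1, Load 5 5, Const 6 3, Binop Mult 5 5 6,
     Binop Add 3 4 5, Const 6 5, Binop Add 3 3 6, Binop Mult 3 3 3]"

definition program :: "variant \<Rightarrow> relation \<Rightarrow> instr list" where
  "program vr x = stride_code @ com_code (length stride_code) (build_code x ;; search_code vr)"

section \<open>Composition of the programs and of their time bounds\<close>

context matching_input
begin

lemma one_le: "1 \<le> Suc n * Suc m"
  by simp

lemma build_time_le: "build_time \<le> build_const x * (Suc n * Suc m)"
proof -
  let ?y = "Suc n * Suc m"
  have "n * Q \<le> ?y"
    using s_le by (simp add: s_def)
  then have "Suc ?y \<le> 2 * ?y" "Suc (n * Q) \<le> 2 * ?y"
    using one_le by linarith+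
  then have "while_time c d * Suc ?y \<le> while_time c d * 2 * ?y"
    "while_time c d * Suc (n * Q) \<le> while_time c d * 2 * ?y" for c d
    unfolding mult.assoc by - (rule mult_le_mono2, assumption)+
  moreover note const_le[OF one_le, of "code_size load_input"] const_le[OF one_le, of "code_size (skip_init x)"]
  ultimately show ?thesis
    unfolding build_time_def build_const_def add_mult_distrib by (intro add_mono)
qed

text \<open>The graph is known at run time only. Fixing the store allows the search locale to be
  instantiated with its arrays.\<close>

lemma search:
  assumes t: "built_store t"
  shows "triple b S (\<lambda>t'. t' = t) (search_code vr) (search_const vr * (Suc n * Suc m))
    (\<lambda>t. \<exists>ans. correct_answer vr x w A ans \<and> stored S (map_answer Suc ans) t)"
proof -
  obtain v a where va: "t = (v, a)" by (cases t)
  define sr where "sr = a 1"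
  note d = t[unfolded built_store_def va edges_inv_def prod.case sr_def[symmetric]]
  let ?y = "Suc n * Suc m"
  have E: "v 9 \<le> 3 * ?y" using t by (simp add: built_store_def va)
  interpret graph_program "v 9" sr "a 2" "a 3" b S s "a 4" "a 6" "a 8"
  proof
    show "word_ok b S" by (rule word)
    show "2 * s + 6 < S" "Suc (v 9) < S" using S_bounds E by linarith+
    show "sr e < s + 2 \<and> a 2 e < s + 2" if "e \<in> {1..v 9}" for e
      using d that by auto
  qed
  have ready: "graph_ready t"
    using d unfolding graph_ready_def va graph_store_def by (simp add: sr_def)
  have lang: "walk s u (s + 1) \<longleftrightarrow> u \<in> map Suc ` matches x w A" for u
    unfolding walk_iff_twalk
    using product_language[OF enfa(1,2), of x w u] d by (simp add: s_def n_def)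
  have answer: "\<exists>ans'. correct_answer vr x w A ans' \<and> stored S (map_answer Suc ans') t'"
    if "walk_answer vr ans" "stored S ans t'" for ans t'
  proof (cases ans)
    case No_Match
    then have "matches x w A = {}" using that(1) lang by (cases vr) auto
    then show ?thesis using that(2) No_Match by (intro exI[of _ No_Match]) simp
  next
    case Arbitrarily_Long
    then have "vr = Max_Variant" "\<forall>n. \<exists>u \<in> matches x w A. n \<le> length u"
      using that(1) lang by (cases vr; fastforce)+
    then show ?thesis using that(2) Arbitrarily_Long by (intro exI[of _ Arbitrarily_Long]) simp
  next
    case (Match u)
    then have "walk s u (s + 1)" using that(1) by (cases vr) auto
    then obtain u' where u': "u = map Suc u'" "u' \<in> matches x w A" using lang by blast
    have "correct_answer vr x w A (Match u')"
      using that(1) u' lang unfolding Match by (cases vr) auto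
    then show ?thesis using that(2) Match u'(1) by (intro exI[of _ "Match u'"]) simp
  qed
  have s: "s \<le> ?y" by (rule s_le)
  have bounds: "Suc (2 * s + 4 + v 9) \<le> 10 * ?y" "Suc (s + 2) \<le> 4 * ?y"
    "Suc (Suc (2 * v 9)) \<le> 8 * ?y"
    "Suc (2 * v 9 + 2 * s + 4) \<le> 13 * ?y"
    using s E one_le by linarith+
  then have loops: "c * Suc (2 * s + 4 + v 9) \<le> c * 10 * ?y" "c * Suc (s + 2) \<le> c * 4 * ?y"
    "c * Suc (Suc (2 * v 9)) \<le> c * 8 * ?y" "c * Suc (2 * v 9 + 2 * s + 4) \<le> c * 13 * ?y" for c
    unfolding mult.assoc by - (rule mult_le_mono2, assumption)+
  note const = const_le[OF one_le]
  show ?thesis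
  proof (cases vr)
    case Min_Variant
    have "min_time \<le> search_const vr * ?y"
      unfolding Min_Variant min_time_def search_const.simps spell_const_def add_mult_distrib
      by (intro add_mono loops const)
    note le = this
    have "triple b S graph_ready (search_code vr) min_time
        (\<lambda>t. \<exists>ans. walk_answer vr ans \<and> stored S ans t)"
      using min_code by (simp add: Min_Variant)
    then show ?thesis
    proof (rule triple_conseq[OF _ _ le])
      show "graph_ready t'" if "t' = t" for t' using that ready by simp
      show "\<exists>ans. correct_answer vr x w A ans \<and> stored S (map_answer Suc ans) t'"
        if "\<exists>ans. walk_answer vr ans \<and> stored S ans t'" for t'
        using that answer by blast
    qed
  next
    case Max_Variant
    have "max_time \<le> search_const vr * ?y"
      unfolding Max_Variant max_time_def search_const.simps spell_const_def add_mult_distrib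
      by (intro add_mono loops const)
    note le = this
    have "triple b S graph_ready (search_code vr) max_time
        (\<lambda>t. \<exists>ans. walk_answer vr ans \<and> stored S ans t)"
      using max_code by (simp add: Max_Variant)
    then show ?thesis
    proof (rule triple_conseq[OF _ _ le])
      show "graph_ready t'" if "t' = t" for t' using that ready by simp
      show "\<exists>ans. correct_answer vr x w A ans \<and> stored S (map_answer Suc ans) t'"
        if "\<exists>ans. walk_answer vr ans \<and> stored S ans t'" for t'
        using that answer by blast
    qed
  qed
qed

lemma build_search:
  "triple b S input_ready (build_code x ;; search_code vr)
     ((build_const x + search_const vr) * (Suc n * Suc m))
     (\<lambda>t. \<exists>ans. correct_answer vr x w A ans \<and> stored S (map_answer Suc ans) t)"
  unfolding add_mult_distrib
proof (rule triple_Seq)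
  show "triple b S input_ready (build_code x) (build_const x * (Suc n * Suc m)) built_store"
    by (rule triple_conseq[OF build_code _ build_time_le]) auto
  show "triple b S built_store (search_code vr) (search_const vr * (Suc n * Suc m))
      (\<lambda>t. \<exists>ans. correct_answer vr x w A ans \<and> stored S (map_answer Suc ans) t)"
    by (rule triple_pre_store) (rule search)
qed

text \<open>The simulation presupposes the stride in register \<open>3\<close>. The code computing
  it is therefore executed on the bare machine, and the absence of truncation is checked by
  hand.\<close>

lemma stride:
  obtains \<sigma> where "(step b (program vr x) ^^ length stride_code) (init_state (encode_input w A ts)) = \<sigma>"
    "pc \<sigma> = length stride_code" "regs \<sigma> 3 = S"
    "mem \<sigma> = (\<lambda>i. if i < input_length then encode_input w A ts ! i else 0)"
proof
  let ?init = "init_state (encode_input w A ts)"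
  let ?\<sigma> = "fold (exec_instr b) stride_code ?init"
  have straight: "\<forall>i \<in> set stride_code. straight i" by (simp add: stride_code_def)
  have pc0: "pc ?init = 0" by (simp add: init_state_def)
  have "code_at (program vr x) (pc ?init) stride_code"
    unfolding code_at_def program_def pc0
    by (intro exI[of _ "[]"] exI[of _ "com_code (length stride_code) (build_code x ;; search_code vr)"]) simp
  from step_straight[OF this straight]
  show "(step b (program vr x) ^^ length stride_code) ?init = ?\<sigma>" .
  show "pc ?\<sigma> = length stride_code"
    unfolding pc_fold[OF straight] pc0 by simp
  have m0: "mem ?init = (\<lambda>i. if i < input_length then encode_input w A ts ! i else 0)"
    by (simp add: init_state_def length_encode)
  then have m: "mem ?init = inp" by (auto simp: inp_def)
  show "mem ?\<sigma> = (\<lambda>i. if i < input_length then encode_input w A ts ! i else 0)"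
    unfolding m0[symmetric] by (simp add: stride_code_def)
  have b: "0 < b" using word_bounds(2) by (cases b) auto
  have lt: "n + m * 3 + 5 < 2 ^ b" "(n + m * 3 + 5) * (n + m * 3 + 5) < 2 ^ b"
    using S_bounds(3) word_bounds by (simp_all add: S_def input_length_def algebra_simps)
  then have tb: "take_bit b (m * 3) = m * 3" "take_bit b (n + m * 3) = n + m * 3"
    "take_bit b (n + m * 3 + 5) = n + m * 3 + 5"
    "take_bit b ((n + m * 3 + 5) * (n + m * 3 + 5)) = (n + m * 3 + 5) * (n + m * 3 + 5)"
    "take_bit b (0::nat) = 0" "take_bit b (1::nat) = 1" "take_bit b (3::nat) = 3" "take_bit b (5::nat) = 5"
    using word_bounds b by (auto intro!: take_bit_nat_eq_self)
  have S: "S = (n + m * 3 + 5) * (n + m * 3 + 5)"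
    by (simp add: S_def input_length_def algebra_simps)
  have "regs ?\<sigma> 3 = take_bit b (take_bit b (take_bit b (inp 0 + take_bit b (inp 1 * 3)) + 5) *
      take_bit b (take_bit b (inp 0 + take_bit b (inp 1 * 3)) + 5))"
    unfolding stride_code_def using m tb(5-8) by (simp add: One_nat_def[symmetric] del: One_nat_def)
  also have "\<dots> = S"
    unfolding S One_nat_def input_head(1,2) tb by simp
  finally show "regs ?\<sigma> 3 = S" .
qed

theorem program_correct:
  shows "\<exists>t \<sigma> ans. t \<le> (10 + (build_const x + search_const vr)) * (Suc n * Suc m) \<and>
    \<sigma> = (step b (program vr x) ^^ t) (init_state (encode_input w A ts)) \<and>
    halted (program vr x) \<sigma> \<and> represents_answer b \<sigma> ans \<and> correct_answer vr x w A ans"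
proof -
  let ?c = "build_code x ;; search_code vr" and ?P = "program vr x"
  obtain \<sigma> where \<sigma>: "(step b ?P ^^ length stride_code) (init_state (encode_input w A ts)) = \<sigma>"
    "pc \<sigma> = length stride_code" "regs \<sigma> 3 = S"
    "mem \<sigma> = (\<lambda>i. if i < input_length then encode_input w A ts ! i else 0)"
    by (rule stride)
  let ?s = "(regs \<sigma>, \<lambda>k. if k = 0 then inp else (\<lambda>_. 0))"
  \<comment> \<open>The input fits into array \<open>0\<close>, so every other array is zero at the
    start.\<close>
  have "mem \<sigma> (k * S + i) = 0" if "0 < k" for k i
  proof -
    have "1 * S \<le> k * S" using that by (intro mult_le_mono1) simp
    then have "\<not> k * S + i < input_length" using S_bounds(3) by linarith
    then show ?thesis using \<sigma>(4) by simp
  qed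
  then have sim: "sim S ?s \<sigma>"
    using \<sigma> by (auto simp: sim_def inp_def)
  have ready: "input_ready ?s"
    using \<sigma>(3) by (simp add: input_ready_def)
  have "code_at ?P (pc \<sigma>) (com_code (pc \<sigma>) ?c)"
    unfolding code_at_def program_def \<sigma>(2) by (intro exI[of _ stride_code] exI[of _ "[]"]) simp
  with build_search[of vr] sim ready obtain t s' where t:
    "t \<le> (build_const x + search_const vr) * (Suc n * Suc m)"
    "\<exists>ans. correct_answer vr x w A ans \<and> stored S (map_answer Suc ans) s'"
    "sim S s' ((step b ?P ^^ t) \<sigma>)" "pc ((step b ?P ^^ t) \<sigma>) = pc \<sigma> + code_size ?c"
    unfolding triple_def by blast
  let ?\<sigma>' = "(step b ?P ^^ t) \<sigma>"
  obtain ans where ans: "correct_answer vr x w A ans" "stored S (map_answer Suc ans) s'"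
    using t(2) by blast
  have regs: "regs ?\<sigma>' y = fst s' y" if "y < 40" for y
    using t(3) that by (simp add: sim_def)
  have "represents_answer b ?\<sigma>' ans"
  proof (cases ans)
    case (Match u)
    then obtain i where i: "fst s' 0 = 2" "fst s' 2 = length u" "fst s' 1 = 17 * S + i" "i + length u \<le> S"
      "\<forall>j < length u. snd s' 17 (i + j) = Suc (u ! j)"
      using ans(2) by auto
    have "17 * S + i + length u \<le> 2 ^ b"
      using word i(4) by (simp add: word_ok_def)
    moreover have "mem ?\<sigma>' (17 * S + i + j) = Suc (u ! j)" if "j < length u" for j
    proof -
      have "\<forall>k < 20. \<forall>i < S. mem ?\<sigma>' (k * S + i) = snd s' k i"
        using t(3) by (simp add: sim_def)
      then have "mem ?\<sigma>' (17 * S + (i + j)) = snd s' 17 (i + j)"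
        using i(4) that by simp
      then show ?thesis using i(5) that by (simp add: add.assoc)
    qed
    then have "output_words ?\<sigma>' (17 * S + i) (length u) = map Suc u"
      by (auto simp: output_words_def intro: nth_equalityI)
    ultimately show ?thesis
      using Match i regs by simp
  qed (use ans(2) regs in auto)
  \<comment> \<open>The machine halts by running past the last instruction.\<close>
  moreover have "halted ?P ?\<sigma>'"
    using t(4) \<sigma>(2) by (simp add: halted_def program_def)
  moreover have "?\<sigma>' = (step b ?P ^^ (t + length stride_code)) (init_state (encode_input w A ts))"
    by (simp only: funpow_add comp_apply \<sigma>(1))
  moreover have "t + length stride_code \<le> (10 + (build_const x + search_const vr)) * (Suc n * Suc m)"
  proof -
    have "length stride_code \<le> 10 * (Suc n * Suc m)" by (simp add: stride_code_def)
    then show ?thesis using t(1) unfolding add_mult_distrib by linarith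
  qed
  ultimately show ?thesis
    using ans(1) by blast
qed

end

text \<open>Replacing \<open>Suc n\<close> by \<open>max 1 n\<close> costs a factor of two, and so
  does the same replacement for \<open>m\<close>; together they give the factor \<open>4\<close> of
  the time constant.\<close>

lemma solvable: "solvable_in_time vr x (\<lambda>n m. max 1 n * max 1 m)"
  unfolding solvable_in_time_def
proof (rule exI[of _ "program vr x"], rule exI[of _ "4 * (10 + (build_const x + search_const vr))"],
    rule exI[of _ 4], intro allI impI)
  fix b w A ts
  assume valid: "valid_input 4 b w A ts"
  interpret matching_input b x w A ts
    by standard (rule valid)
  let ?C = "10 + (build_const x + search_const vr)"
  have "Suc n \<le> 2 * max 1 (length w)" "Suc m \<le> 2 * max 1 (enfa_size A)"
    by (simp_all add: n_def size_m)
  then have "Suc n * Suc m \<le> (2 * max 1 (length w)) * (2 * max 1 (enfa_size A))"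
    by (rule mult_le_mono)
  then have "?C * (Suc n * Suc m) \<le> ?C * ((2 * max 1 (length w)) * (2 * max 1 (enfa_size A)))"
    by (rule mult_le_mono2)
  also have "\<dots> = 4 * ?C * (max 1 (length w) * max 1 (enfa_size A))"
    by (simp only: mult.assoc mult.left_commute)
  finally show "\<exists>t \<sigma> ans. t \<le> 4 * ?C * (max 1 (length w) * max 1 (enfa_size A)) \<and>
      \<sigma> = (step b (program vr x) ^^ t) (init_state (encode_input w A ts)) \<and>
      halted (program vr x) \<sigma> \<and> represents_answer b \<sigma> ans \<and> correct_answer vr x w A ans"
    using program_correct[of vr] by (meson order_trans)
qed

theorem theorem5p1:
  shows "\<forall>x \<in> {Infix, Prefix, Extension, Left_Extension, Subsequence, Supersequence}.
           solvable_in_time Min_Variant x (\<lambda>n m. max 1 n * max 1 m) \<and>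
           solvable_in_time Max_Variant x (\<lambda>n m. max 1 n * max 1 m)"
  using solvable by blast

end
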